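(* For $j=1,2$, as $l\to0$, $$w_j(\cdot,l)=\frac1{il}\big(k_j^0+il\,k_j^1\big)\begin{pmatrix}\frac1{k_\star}H_\star'+il\,\partial_kH_\star\\[2pt] \frac1{k_\star}Q_\star'+il\,\partial_kQ_\star\end{pmatrix}+\bar q_j^0\begin{pmatrix}\partial_{\bar q}H_\star\\ \partial_{\bar q}Q_\star\end{pmatrix}+\mathcal O(l),$$ for some constants $k_j^0,k_j^1,\bar q_j^0$, where $(k_j^0,\bar q_j^0)$ is the first (order-zero) term in a low-frequency expansion of a corresponding eigenvector of the linearized Whitham system. Thereby $v_1$ and $v_2$ may be chosen so that $$v_1(\cdot,l)=\begin{pmatrix}\frac1{k_\star}H_\star'+il\,\partial_kH_\star\\[2pt] \frac1{k_\star}Q_\star'+il\,\partial_kQ_\star\end{pmatrix}+\mathcal O(l^2),\qquad v_2(\cdot,l)=\frac1{\partial_{\bar q}M_\star}\begin{pmatrix}\partial_{\bar q}H_\star\\ \partial_{\bar q}Q_\star\end{pmatrix}+\mathcal O(l).$$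
   Context: **Saint-Venant system.** Fix $\delta>0$, $F>0$ and set $G(h,q)=\frac{q^2}{h}+\frac{h^2}{2F^2}$, $S(h,q)=h-\frac{q^2}{h^2}$. The system is $\partial_t h+\partial_x q=0$, $\partial_t q+\partial_x(G(h,q))=S(h,q)+\delta\partial_x^2 q$. **Periodic travelling waves.** Put $\mathcal G(H,Q;k)=\delta k^2Q''-k(G(H,Q))'+S(H,Q)$, with $\partial_h\mathcal G(H,Q;k)[f]=-k(\partial_hG(H,Q)f)'+\partial_hS(H,Q)f$ and $\partial_q\mathcal G(H,Q;k)[f]=\delta k^2f''-k(\partial_qG(H,Q)f)'+\partial_qS(H,Q)f$. Waves $(H,Q)(kx+\omega t)$ with $1$-periodic $(H,Q)$, $\omega=-kc$, satisfy $cH-Q=\bar q$ for a constant $\bar q$ and $kc^2H'+\mathcal G(H,cH-\bar q;k)=0$. Standing assumption: for $(k,\bar q)$ in the open subset of $\mathbb R^*\times\mathbb R$ considered, this equation has a non-constant $1$-periodic solution for exactly one speed $c=c(k,\bar q)$, unique up to translation; $c$ is smooth, and $H(\cdot;k,\bar q)$ is a smooth choice of solution; $Q(\cdot;k,\bar q)=c(k,\bar q)H(\cdot;k,\bar q)-\bar q$, $\omega(k,\bar q)=-kc(k,\bar q)$, $M(k,\bar q)=\int_0^1H(y;k,\bar q)dy$. The operator $\mathcal Lf=-\omega cf'+\partial_h\mathcal G(H,Q;k)[f]+c\,\partial_q\mathcal G(H,Q;k)[f]$ on $1$-periodic $L^2$ functions has kernel spanned by $H'$, and $A^\omega=-2\frac\omega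 kH'+\frac1k\partial_q\mathcal G(H,Q;k)[H]$ is not in its range. Also $\partial_{\bar q}M\ne0$, $\partial_kc\ne0$, $\partial_{\bar q}c\neq0$. The subscript $\star$ denotes evaluation at a fixed $(k_\star,\bar q_\star)\in\mathbb R^*\times\mathbb R$ in this set. **Bloch operators.** In the frame $(k_\star x+\omega_\star t,t)$ the linearization about $(H_\star,Q_\star)$ is $\partial_t(h,q)=\mathcal A_\star(h,q)$ with $$\mathcal A_\star(h,q)=\big(k_\star\partial_y(c_\star h-q),\ \partial_h\mathcal G(H_\star,Q_\star;k_\star)[h]+\partial_q\mathcal G(H_\star,Q_\star;k_\star)[q]-\omega_\star\partial_yq\big).$$ For $l\in[-\pi,\pi]$, $\check{\mathcal A}_\star(l)f=e^{-il\cdot}\mathcal A_\star(e^{il\cdot}f)$ acts on $L^2_{\mathrm{per}}$ ($1$-periodic functions). The zero eigenspace of $\check{\mathcal A}_\star(0)$ has a one-dimensional kernel, spanned by $(H_\star',Q_\star')$, and a single Jordan chain of height $2$; the left kernel is spanned by the constant $(1,0)$. For $|l|$ small, $\lambda_1(l),\lambda_2(l)$ denote the two (critical) eigenvalues of $\check{\mathcal A}_\star(l)$ near $0$, which are analytic in $l$. For $|l|$ small, $(v_k(\cdot,l))_{k=1,2}$ and $(\tilde v_k(\cdot,l))_{k=1,2}$ are dual bases, analytic in $l$, of the right and left total eigenspaces of $\check{\mathcal A}_\star(l)$ associated with the small eigenvalues, with $\tilde v_2(\cdot,0)=(1,0)$ and $v_1(\cdot,0)$ a non-zero constant multiple of $(H_\star',Q_\star')$.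 For $l\neq0$, $w_j(\cdot,l)$ and $\tilde w_j(\cdot,l)$ are dual right and left eigenfunctions of $\check{\mathcal A}_\star(l)$ for $\lambda_j(l)$, of the form $w_j=\sum_{k=1}^2\beta_{j,k}v_k$, $\tilde w_j=\sum_{k=1}^2\tilde\beta_{j,k}\tilde v_k$, where $(l\beta_{j,1}(l),\beta_{j,2}(l))$ and $(l^{-1}\tilde\beta_{j,1}(l),\tilde\beta_{j,2}(l))$ are analytic in $l$. The $\mathcal O(\cdot)$ are in $L^2_{\mathrm{per}}$. **Linearized Whitham system.** The Whitham system is $\partial_tk-\partial_x(\omega(k,\bar q))=0$, $\partial_t(M(k,\bar q))+\partial_x(N(k,\bar q))=0$ with $N=cM-\bar q$. Linearizing at $(k_\star,\bar q_\star)$ in the frame $(k_\star x+\omega_\star t,t)$ and looking for solutions $e^{\lambda t+\nu x}(k,\bar q)$ with $\nu=il$, $\lambda=k_\star\nu\lambda^0+\mathcal O(\nu^2)$, a (non-zero) eigenvector has order-zero term $(k^0,\bar q^0)$ satisfying $$\lambda^0k^0+k_\star\big(\partial_kc_\star k^0+\partial_{\bar q}c_\star\bar q^0\big)=0,\qquad \lambda^0\Big(\big(\partial_kM_\star-\tfrac{M_\star}{k_\star}\big)k^0+\partial_{\bar q}M_\star\,\bar q^0\Big)-\bar q^0=0.$$ "Corresponding" for index $j$ means with $\lambda^0=\lambda^0_j$, where $\lambda_j(l)=k_\star\,il\,\lambda_j^0+\mathcal O(l^2)$. *)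

theory Defs
  imports "HOL-Analysis.Analysis" "HOL-Library.Landau_Symbols"
begin

section \<open>Smooth functions\<close>

text \<open>On an open set, \<open>Ck_on n f S\<close> says that \<open>f\<close> is \<open>n\<close> times continuously differentiable.\<close>

primrec Ck_on ::
    "nat \<Rightarrow> ('a::euclidean_space \<Rightarrow> 'b::real_normed_vector) \<Rightarrow> 'a set \<Rightarrow> bool" where
  "Ck_on 0 f S \<longleftrightarrow> continuous_on S f"
| "Ck_on (Suc n) f S \<longleftrightarrow>
     f differentiable_on S \<and> (\<forall>v. Ck_on n (\<lambda>x. frechet_derivative f (at x) v) S)"

definition smooth_on :: "('a::euclidean_space \<Rightarrow> 'b::real_normed_vector) \<Rightarrow> 'a set \<Rightarrow> bool" where
  "smooth_on f S \<longleftrightarrow> (\<forall>n. Ck_on n f S)"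


section \<open>Square integrable 1-periodic functions\<close>

text \<open>Elements of \<open>L\<^sup>2\<close> are represented by functions; equality in \<open>L\<^sup>2\<close> is \<open>\<doteq>\<close>.\<close>

abbreviation ae_eq :: "(real \<Rightarrow> 'a) \<Rightarrow> (real \<Rightarrow> 'a) \<Rightarrow> bool" (infix \<open>\<doteq>\<close> 50) where
  "f \<doteq> g \<equiv> (AE y in lebesgue. f y = g y)"

definition L2per :: "(real \<Rightarrow> 'a::euclidean_space) set" where
  "L2per = {f. (\<forall>y. f (y + 1) = f y) \<and> f \<in> borel_measurable lebesgue \<and>
               (\<lambda>y. (norm (f y))\<^sup>2) absolutely_integrable_on {0..1}}"

definition L2norm :: "(real \<Rightarrow> 'a::euclidean_space) \<Rightarrow> real" where
  "L2norm f = sqrt (integral {0..1} (\<lambda>y. (norm (f y))\<^sup>2))"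

text \<open>In dimension one, \<open>f'\<close> is the weak derivative of \<open>f\<close> iff \<open>f\<close> agrees almost everywhere
  with an indefinite integral of the locally integrable function \<open>f'\<close>.\<close>

definition has_weak_deriv :: "(real \<Rightarrow> complex) \<Rightarrow> (real \<Rightarrow> complex) \<Rightarrow> bool" where
  "has_weak_deriv f f' \<longleftrightarrow>
     (\<exists>f0. f \<doteq> f0 \<and>
        (\<forall>a b. a \<le> b \<longrightarrow> f' absolutely_integrable_on {a..b} \<and> f0 b - f0 a = integral {a..b} f'))"

text \<open>Determined up to \<open>\<doteq>\<close>, and meaningful only for functions possessing a weak derivative.\<close>

definition wderiv :: "(real \<Rightarrow> complex) \<Rightarrow> real \<Rightarrow> complex" where
  "wderiv f = (SOME f'. has_weak_deriv f f')"

definition H1per :: "(real \<Rightarrow> complex) set" where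
  "H1per = {f \<in> L2per. \<exists>g\<in>L2per. has_weak_deriv f g}"

definition H2per :: "(real \<Rightarrow> complex) set" where
  "H2per = {f \<in> L2per. \<exists>g\<in>H1per. has_weak_deriv f g}"

type_synonym vfun = "real \<Rightarrow> complex \<times> complex"

definition cmul :: "complex \<Rightarrow> complex \<times> complex \<Rightarrow> complex \<times> complex" (infixr \<open>\<odot>\<close> 75) where
  "a \<odot> u = (a * fst u, a * snd u)"

definition L2inner :: "vfun \<Rightarrow> vfun \<Rightarrow> complex" where
  "L2inner U V = integral {0..1} (\<lambda>y. cnj (fst (U y)) * fst (V y) + cnj (snd (U y)) * snd (V y))"

definition bigo_L2 :: "(real \<Rightarrow> vfun) \<Rightarrow> (real \<Rightarrow> real) \<Rightarrow> bool" where
  "bigo_L2 R g \<longleftrightarrow> (\<forall>\<^sub>F l in at 0. R l \<in> L2per) \<and> (\<lambda>l. L2norm (R l)) \<in> O[at 0](g)"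


section \<open>Analytic dependence on a small real parameter\<close>

definition analytic_near_0 :: "(real \<Rightarrow> complex) \<Rightarrow> bool" where
  "analytic_near_0 f \<longleftrightarrow>
     (\<exists>g. g analytic_on {0} \<and> (\<forall>\<^sub>F l in nhds 0. f l = g (complex_of_real l)))"

text \<open>For functions considered at \<open>l \<noteq> 0\<close> only: analytic after removing the singularity at 0.\<close>

definition analytic_ext_0 :: "(real \<Rightarrow> complex) \<Rightarrow> bool" where
  "analytic_ext_0 f \<longleftrightarrow>
     (\<exists>g. g analytic_on {0} \<and> (\<forall>\<^sub>F l in at 0. f l = g (complex_of_real l)))"

definition L2_analytic_near_0 :: "(real \<Rightarrow> vfun) \<Rightarrow> bool" where
  "L2_analytic_near_0 v \<longleftrightarrow>
     (\<exists>a. (\<forall>n. a n \<in> L2per) \<and>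
        (\<forall>\<^sub>F l in nhds 0. v l \<in> L2per \<and>
           (\<lambda>N. L2norm (\<lambda>y. v l y - (\<Sum>n<N. l ^ n *\<^sub>R a n y))) \<longlonglongrightarrow> 0))"


section \<open>Eigenspaces of unbounded operators\<close>

text \<open>An unbounded operator on \<open>L\<^sup>2\<close> is represented by its graph: \<open>T U V\<close> says that
  \<open>U\<close> is in the domain and that \<open>V\<close> represents the image of \<open>U\<close>.\<close>

type_synonym graph_op = "vfun \<Rightarrow> vfun \<Rightarrow> bool"

definition adjoint_op :: "graph_op \<Rightarrow> graph_op" where
  "adjoint_op T Z Y \<longleftrightarrow> Z \<in> L2per \<and> Y \<in> L2per \<and>
     (\<forall>U V. T U V \<longrightarrow> L2inner Z V = L2inner Y U)"

text \<open>\<open>ker_pow T \<mu> n\<close> is the kernel of \<open>(T - \<mu>)\<^sup>n\<close>.\<close>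

primrec ker_pow :: "graph_op \<Rightarrow> complex \<Rightarrow> nat \<Rightarrow> vfun set" where
  "ker_pow T \<mu> 0 = {U \<in> L2per. U \<doteq> (\<lambda>_. 0)}"
| "ker_pow T \<mu> (Suc n) = {U. \<exists>V. T U V \<and> (\<lambda>y. V y - \<mu> \<odot> U y) \<in> ker_pow T \<mu> n}"

definition eigenfunction :: "graph_op \<Rightarrow> complex \<Rightarrow> vfun \<Rightarrow> bool" where
  "eigenfunction T \<mu> U \<longleftrightarrow> U \<in> ker_pow T \<mu> 1 \<and> \<not> U \<doteq> (\<lambda>_. 0)"

text \<open>Sum of the generalized eigenspaces attached to a finite set of eigenvalues.\<close>

definition total_eigenspace :: "graph_op \<Rightarrow> complex set \<Rightarrow> vfun set" where
  "total_eigenspace T \<Lambda> =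
     {U \<in> L2per. \<exists>W n. (\<forall>\<mu>\<in>\<Lambda>. W \<mu> \<in> ker_pow T \<mu> n) \<and> U \<doteq> (\<lambda>y. \<Sum>\<mu>\<in>\<Lambda>. W \<mu> y)}"

definition L2_span2 :: "(nat \<Rightarrow> vfun) \<Rightarrow> vfun set" where
  "L2_span2 v = {U \<in> L2per. \<exists>a. U \<doteq> (\<lambda>y. \<Sum>k\<in>{1,2}. a k \<odot> v k y)}"


section \<open>The Saint-Venant system and its periodic travelling waves\<close>

definition Gflux :: "real \<Rightarrow> real \<Rightarrow> real \<Rightarrow> real" where
  "Gflux F h q = q\<^sup>2 / h + h\<^sup>2 / (2 * F\<^sup>2)"

definition Ssrc :: "real \<Rightarrow> real \<Rightarrow> real" where
  "Ssrc h q = h - q\<^sup>2 / h\<^sup>2"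

definition dhG :: "real \<Rightarrow> real \<Rightarrow> real \<Rightarrow> real" where
  "dhG F h q = deriv (\<lambda>x. Gflux F x q) h"

definition dqG :: "real \<Rightarrow> real \<Rightarrow> real \<Rightarrow> real" where
  "dqG F h q = deriv (\<lambda>x. Gflux F h x) q"

definition dhS :: "real \<Rightarrow> real \<Rightarrow> real" where
  "dhS h q = deriv (\<lambda>x. Ssrc x q) h"

definition dqS :: "real \<Rightarrow> real \<Rightarrow> real" where
  "dqS h q = deriv (\<lambda>x. Ssrc h x) q"

definition calG :: "real \<Rightarrow> real \<Rightarrow> real \<Rightarrow> (real \<Rightarrow> real) \<Rightarrow> (real \<Rightarrow> real) \<Rightarrow> real \<Rightarrow> real" where
  "calG \<delta> F k H Q y =
     \<delta> * k\<^sup>2 * deriv (deriv Q) y - k * deriv (\<lambda>z. Gflux F (H z) (Q z)) y + Ssrc (H y) (Q y)"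

definition dh_calG ::
    "real \<Rightarrow> real \<Rightarrow> (real \<Rightarrow> real) \<Rightarrow> (real \<Rightarrow> real) \<Rightarrow> (real \<Rightarrow> complex) \<Rightarrow> real \<Rightarrow> complex" where
  "dh_calG F k H Q f y =
     - of_real k * wderiv (\<lambda>z. of_real (dhG F (H z) (Q z)) * f z) y
     + of_real (dhS (H y) (Q y)) * f y"

definition dq_calG ::
    "real \<Rightarrow> real \<Rightarrow> real \<Rightarrow> (real \<Rightarrow> real) \<Rightarrow> (real \<Rightarrow> real) \<Rightarrow> (real \<Rightarrow> complex) \<Rightarrow> real \<Rightarrow> complex"
where
  "dq_calG \<delta> F k H Q f y =
     of_real (\<delta> * k\<^sup>2) * wderiv (wderiv f) y
     - of_real k * wderiv (\<lambda>z. of_real (dqG F (H z) (Q z)) * f z) y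
     + of_real (dqS (H y) (Q y)) * f y"

text \<open>Non-constant 1-periodic solutions of the profile equation with wavenumber \<open>k\<close>, constant of
  integration \<open>b = s h - q\<close> and speed \<open>s\<close>. The condition
  \<open>h y \<noteq> 0\<close> is the domain of \<open>G\<close> and \<open>S\<close>; as \<open>S\<close> has mean zero along a periodic solution
  and \<open>S < 0\<close> where \<open>h < 0\<close>, it amounts to \<open>h > 0\<close>.\<close>

definition periodic_profile ::
    "real \<Rightarrow> real \<Rightarrow> real \<Rightarrow> real \<Rightarrow> real \<Rightarrow> (real \<Rightarrow> real) \<Rightarrow> bool" where
  "periodic_profile \<delta> F k b s h \<longleftrightarrow>
     Ck_on 2 h UNIV \<and> (\<forall>y. h (y + 1) = h y) \<and> (\<forall>y. h y \<noteq> 0) \<and> \<not> h constant_on UNIV \<and>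
     (\<forall>y. k * s\<^sup>2 * deriv h y + calG \<delta> F k h (\<lambda>z. s * h z - b) y = 0)"

text \<open>From here on \<open>c k b\<close> is the speed and \<open>H k b\<close> the profile of the wave with parameters
  \<open>(k, b)\<close>.\<close>

definition Qprof :: "(real \<Rightarrow> real \<Rightarrow> real) \<Rightarrow> (real \<Rightarrow> real \<Rightarrow> real \<Rightarrow> real) \<Rightarrow>
    real \<Rightarrow> real \<Rightarrow> real \<Rightarrow> real" where
  "Qprof c H k b y = c k b * H k b y - b"

definition freq :: "(real \<Rightarrow> real \<Rightarrow> real) \<Rightarrow> real \<Rightarrow> real \<Rightarrow> real" where
  "freq c k b = - k * c k b"

definition mean :: "(real \<Rightarrow> real \<Rightarrow> real \<Rightarrow> real) \<Rightarrow> real \<Rightarrow> real \<Rightarrow> real" where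
  "mean H k b = integral {0..1} (H k b)"

definition wflux :: "(real \<Rightarrow> real \<Rightarrow> real) \<Rightarrow> (real \<Rightarrow> real \<Rightarrow> real \<Rightarrow> real) \<Rightarrow>
    real \<Rightarrow> real \<Rightarrow> real" where
  "wflux c H k b = c k b * mean H k b - b"

definition d1 :: "(real \<Rightarrow> real \<Rightarrow> real) \<Rightarrow> real \<Rightarrow> real \<Rightarrow> real" where
  "d1 f k b = deriv (\<lambda>x. f x b) k"

definition d2 :: "(real \<Rightarrow> real \<Rightarrow> real) \<Rightarrow> real \<Rightarrow> real \<Rightarrow> real" where
  "d2 f k b = deriv (\<lambda>x. f k x) b"

definition dyU :: "(real \<Rightarrow> real \<Rightarrow> real) \<Rightarrow> (real \<Rightarrow> real \<Rightarrow> real \<Rightarrow> real) \<Rightarrow> real \<Rightarrow> real \<Rightarrow> vfun" where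
  "dyU c H k b y = (of_real (deriv (H k b) y), of_real (deriv (Qprof c H k b) y))"

definition dkU :: "(real \<Rightarrow> real \<Rightarrow> real) \<Rightarrow> (real \<Rightarrow> real \<Rightarrow> real \<Rightarrow> real) \<Rightarrow> real \<Rightarrow> real \<Rightarrow> vfun" where
  "dkU c H k b y = (of_real (d1 (\<lambda>k' b'. H k' b' y) k b), of_real (d1 (\<lambda>k' b'. Qprof c H k' b' y) k b))"

definition dbU :: "(real \<Rightarrow> real \<Rightarrow> real) \<Rightarrow> (real \<Rightarrow> real \<Rightarrow> real \<Rightarrow> real) \<Rightarrow> real \<Rightarrow> real \<Rightarrow> vfun" where
  "dbU c H k b y = (of_real (d2 (\<lambda>k' b'. H k' b' y) k b), of_real (d2 (\<lambda>k' b'. Qprof c H k' b' y) k b))"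

definition Lop :: "real \<Rightarrow> real \<Rightarrow> (real \<Rightarrow> real \<Rightarrow> real) \<Rightarrow> (real \<Rightarrow> real \<Rightarrow> real \<Rightarrow> real) \<Rightarrow>
    real \<Rightarrow> real \<Rightarrow> (real \<Rightarrow> complex) \<Rightarrow> real \<Rightarrow> complex" where
  "Lop \<delta> F c H k b f y =
     - of_real (freq c k b * c k b) * wderiv f y
     + dh_calG F k (H k b) (Qprof c H k b) f y
     + of_real (c k b) * dq_calG \<delta> F k (H k b) (Qprof c H k b) f y"

definition A_omega :: "real \<Rightarrow> real \<Rightarrow> (real \<Rightarrow> real \<Rightarrow> real) \<Rightarrow> (real \<Rightarrow> real \<Rightarrow> real \<Rightarrow> real) \<Rightarrow>
    real \<Rightarrow> real \<Rightarrow> real \<Rightarrow> complex" where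
  "A_omega \<delta> F c H k b y =
     - 2 * of_real (freq c k b / k) * of_real (deriv (H k b) y)
     + of_real (1 / k) * dq_calG \<delta> F k (H k b) (Qprof c H k b) (\<lambda>z. of_real (H k b z)) y"

definition wave_family :: "real \<Rightarrow> real \<Rightarrow> (real \<times> real) set \<Rightarrow> (real \<Rightarrow> real \<Rightarrow> real) \<Rightarrow>
    (real \<Rightarrow> real \<Rightarrow> real \<Rightarrow> real) \<Rightarrow> bool" where
  "wave_family \<delta> F \<Omega> c H \<longleftrightarrow>
     open \<Omega> \<and> (\<forall>(k, b)\<in>\<Omega>. k \<noteq> 0) \<and>
     smooth_on (\<lambda>(k, b). c k b) \<Omega> \<and>
     smooth_on (\<lambda>(k, b, y). H k b y) {(k, b, y). (k, b) \<in> \<Omega>} \<and>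
     (\<forall>(k, b)\<in>\<Omega>.
        periodic_profile \<delta> F k b (c k b) (H k b) \<and>
        (\<forall>s h. periodic_profile \<delta> F k b s h \<longrightarrow>
           s = c k b \<and> (\<exists>a. \<forall>y. h y = H k b (y + a))))"

definition nondegenerate_family :: "real \<Rightarrow> real \<Rightarrow> (real \<times> real) set \<Rightarrow>
    (real \<Rightarrow> real \<Rightarrow> real) \<Rightarrow> (real \<Rightarrow> real \<Rightarrow> real \<Rightarrow> real) \<Rightarrow> bool" where
  "nondegenerate_family \<delta> F \<Omega> c H \<longleftrightarrow>
     (\<forall>(k, b)\<in>\<Omega>.
        {f \<in> H2per. Lop \<delta> F c H k b f \<doteq> (\<lambda>_. 0)} =
          {f \<in> L2per. \<exists>a. f \<doteq> (\<lambda>y. a * of_real (deriv (H k b) y))} \<and>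
        \<not> (\<exists>f\<in>H2per. Lop \<delta> F c H k b f \<doteq> A_omega \<delta> F c H k b) \<and>
        d2 (mean H) k b \<noteq> 0 \<and> d1 c k b \<noteq> 0 \<and> d2 c k b \<noteq> 0)"


section \<open>Bloch operators\<close>

definition calA :: "real \<Rightarrow> real \<Rightarrow> (real \<Rightarrow> real \<Rightarrow> real) \<Rightarrow> (real \<Rightarrow> real \<Rightarrow> real \<Rightarrow> real) \<Rightarrow>
    real \<Rightarrow> real \<Rightarrow> vfun \<Rightarrow> vfun" where
  "calA \<delta> F c H k b U y =
     (of_real k * wderiv (\<lambda>z. of_real (c k b) * fst (U z) - snd (U z)) y,
      dh_calG F k (H k b) (Qprof c H k b) (\<lambda>z. fst (U z)) y
      + dq_calG \<delta> F k (H k b) (Qprof c H k b) (\<lambda>z. snd (U z)) y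
      - of_real (freq c k b) * wderiv (\<lambda>z. snd (U z)) y)"

definition bloch :: "real \<Rightarrow> real \<Rightarrow> (real \<Rightarrow> real \<Rightarrow> real) \<Rightarrow> (real \<Rightarrow> real \<Rightarrow> real \<Rightarrow> real) \<Rightarrow>
    real \<Rightarrow> real \<Rightarrow> real \<Rightarrow> graph_op" where
  "bloch \<delta> F c H k b l U V \<longleftrightarrow>
     (\<lambda>y. fst (U y)) \<in> H1per \<and> (\<lambda>y. snd (U y)) \<in> H2per \<and> V \<in> L2per \<and>
     V \<doteq> (\<lambda>y. cis (- l * y) \<odot> calA \<delta> F c H k b (\<lambda>z. cis (l * z) \<odot> U z) y)"

text \<open>Structure of the zero eigenspace: the kernel is spanned by \<open>\<Phi>\<close>, there is one Jordan chain and
  it has height 2, and the left kernel is spanned by the constant \<open>(1, 0)\<close>.\<close>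

definition zero_eigenspace :: "graph_op \<Rightarrow> vfun \<Rightarrow> bool" where
  "zero_eigenspace T \<Phi> \<longleftrightarrow>
     ker_pow T 0 1 = {U \<in> L2per. \<exists>a. U \<doteq> (\<lambda>y. a \<odot> \<Phi> y)} \<and>
     ker_pow T 0 2 \<noteq> ker_pow T 0 1 \<and>
     (\<forall>n\<ge>2. ker_pow T 0 n = ker_pow T 0 2) \<and>
     ker_pow (adjoint_op T) 0 1 = {U \<in> L2per. \<exists>a. U \<doteq> (\<lambda>y. a \<odot> (1, 0))}"

text \<open>The two critical eigenvalues are counted with algebraic multiplicity: the multiplicities are
  fixed by the dimension of the total eigenspace in \<open>critical_bases\<close> below.\<close>

definition critical_eigenvalues :: "(real \<Rightarrow> graph_op) \<Rightarrow> (nat \<Rightarrow> real \<Rightarrow> complex) \<Rightarrow> bool" where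
  "critical_eigenvalues T lam \<longleftrightarrow>
     (\<forall>j\<in>{1,2}. analytic_near_0 (lam j) \<and> lam j 0 = 0) \<and>
     (\<exists>\<epsilon>>0. \<forall>\<^sub>F l in nhds 0.
        {\<mu>. norm \<mu> < \<epsilon> \<and> (\<exists>U. eigenfunction (T l) \<mu> U)} = {lam 1 l, lam 2 l})"

definition critical_bases :: "(real \<Rightarrow> graph_op) \<Rightarrow> (nat \<Rightarrow> real \<Rightarrow> complex) \<Rightarrow> vfun \<Rightarrow>
    (nat \<Rightarrow> real \<Rightarrow> vfun) \<Rightarrow> (nat \<Rightarrow> real \<Rightarrow> vfun) \<Rightarrow> bool" where
  "critical_bases T lam \<Phi> v vt \<longleftrightarrow>
     (\<forall>k\<in>{1,2}. L2_analytic_near_0 (v k) \<and> L2_analytic_near_0 (vt k)) \<and>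
     (\<forall>\<^sub>F l in nhds 0.
        total_eigenspace (T l) {lam 1 l, lam 2 l} = L2_span2 (\<lambda>k. v k l) \<and>
        total_eigenspace (adjoint_op (T l)) {cnj (lam 1 l), cnj (lam 2 l)} = L2_span2 (\<lambda>k. vt k l) \<and>
        (\<forall>j\<in>{1,2}. \<forall>k\<in>{1,2}. L2inner (vt j l) (v k l) = (if j = k then 1 else 0))) \<and>
     vt 2 0 \<doteq> (\<lambda>_. (1, 0)) \<and>
     (\<exists>a. a \<noteq> 0 \<and> v 1 0 \<doteq> (\<lambda>y. a \<odot> \<Phi> y))"

definition dual_eigenfunctions :: "(real \<Rightarrow> graph_op) \<Rightarrow> (nat \<Rightarrow> real \<Rightarrow> complex) \<Rightarrow>
    (nat \<Rightarrow> real \<Rightarrow> vfun) \<Rightarrow> (nat \<Rightarrow> real \<Rightarrow> vfun) \<Rightarrow> bool" where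
  "dual_eigenfunctions T lam w wt \<longleftrightarrow>
     (\<forall>\<^sub>F l in at 0. \<forall>j\<in>{1,2}.
        eigenfunction (T l) (lam j l) (w j l) \<and>
        eigenfunction (adjoint_op (T l)) (cnj (lam j l)) (wt j l) \<and>
        (\<forall>k\<in>{1,2}. L2inner (wt j l) (w k l) = (if j = k then 1 else 0)))"

definition eigenfunction_coordinates :: "(nat \<Rightarrow> real \<Rightarrow> vfun) \<Rightarrow> (nat \<Rightarrow> real \<Rightarrow> vfun) \<Rightarrow>
    (nat \<Rightarrow> real \<Rightarrow> vfun) \<Rightarrow> (nat \<Rightarrow> real \<Rightarrow> vfun) \<Rightarrow>
    (nat \<Rightarrow> nat \<Rightarrow> real \<Rightarrow> complex) \<Rightarrow> (nat \<Rightarrow> nat \<Rightarrow> real \<Rightarrow> complex) \<Rightarrow> bool" where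
  "eigenfunction_coordinates v vt w wt \<beta> \<beta>t \<longleftrightarrow>
     (\<forall>\<^sub>F l in at 0. \<forall>j\<in>{1,2}.
        w j l \<doteq> (\<lambda>y. \<Sum>k\<in>{1,2}. \<beta> j k l \<odot> v k l y) \<and>
        wt j l \<doteq> (\<lambda>y. \<Sum>k\<in>{1,2}. \<beta>t j k l \<odot> vt k l y)) \<and>
     (\<forall>j\<in>{1,2}.
        analytic_ext_0 (\<lambda>l. of_real l * \<beta> j 1 l) \<and> analytic_ext_0 (\<beta> j 2) \<and>
        analytic_ext_0 (\<lambda>l. \<beta>t j 1 l / of_real l) \<and> analytic_ext_0 (\<beta>t j 2))"


section \<open>The linearized Whitham system\<close>

text \<open>\<open>e\<^bsup>\<Lambda>t+\<nu>x\<^esup> (K, B)\<close> solves the linearization at \<open>(k, b)\<close> of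
  \<open>\<partial>\<^sub>t k - \<partial>\<^sub>x \<omega> = 0\<close>, \<open>\<partial>\<^sub>t M + \<partial>\<^sub>x N = 0\<close> written in the frame \<open>(k x + \<omega> t, t)\<close>, in which
  \<open>\<partial>\<^sub>t\<close> becomes \<open>\<partial>\<^sub>t + \<omega> \<partial>\<^sub>x\<close> and \<open>\<partial>\<^sub>x\<close> becomes \<open>k \<partial>\<^sub>x\<close>.\<close>

definition whitham_mode :: "(real \<Rightarrow> real \<Rightarrow> real) \<Rightarrow> (real \<Rightarrow> real \<Rightarrow> real \<Rightarrow> real) \<Rightarrow>
    real \<Rightarrow> real \<Rightarrow> complex \<Rightarrow> complex \<Rightarrow> complex \<Rightarrow> complex \<Rightarrow> bool" where
  "whitham_mode c H k b \<nu> \<Lambda> K B \<longleftrightarrow>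
     (\<Lambda> + of_real (freq c k b) * \<nu>) * K
       - of_real k * \<nu> * (of_real (d1 (freq c) k b) * K + of_real (d2 (freq c) k b) * B) = 0 \<and>
     (\<Lambda> + of_real (freq c k b) * \<nu>) *
         (of_real (d1 (mean H) k b) * K + of_real (d2 (mean H) k b) * B)
       + of_real k * \<nu> * (of_real (d1 (wflux c H) k b) * K + of_real (d2 (wflux c H) k b) * B) = 0"

text \<open>\<open>(K0, B0)\<close> is the non-zero order-zero term of a low-frequency expansion of an eigenvector
  whose eigenvalue is \<open>k \<nu> lam0 + O(\<nu>\<^sup>2)\<close>, with \<open>\<nu> = i l\<close>.\<close>

definition whitham_leading_term :: "(real \<Rightarrow> real \<Rightarrow> real) \<Rightarrow> (real \<Rightarrow> real \<Rightarrow> real \<Rightarrow> real) \<Rightarrow>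
    real \<Rightarrow> real \<Rightarrow> complex \<Rightarrow> complex \<Rightarrow> complex \<Rightarrow> bool" where
  "whitham_leading_term c H k b lam0 K0 B0 \<longleftrightarrow>
     (K0, B0) \<noteq> (0, 0) \<and>
     (\<exists>\<Lambda> K B.
        (\<forall>\<^sub>F l in at (0::real). (K l, B l) \<noteq> (0, 0) \<and>
           whitham_mode c H k b (\<i> * of_real l) (\<Lambda> l) (K l) (B l)) \<and>
        (\<lambda>l. \<Lambda> l - of_real k * \<i> * of_real l * lam0) \<in> O[at 0](\<lambda>l. of_real (l\<^sup>2)) \<and>
        (\<lambda>l. K l - K0) \<in> O[at 0](\<lambda>l. of_real l) \<and>
        (\<lambda>l. B l - B0) \<in> O[at 0](\<lambda>l. of_real l))"

definition whitham_order_zero :: "(real \<Rightarrow> real \<Rightarrow> real) \<Rightarrow> (real \<Rightarrow> real \<Rightarrow> real \<Rightarrow> real) \<Rightarrow>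
    real \<Rightarrow> real \<Rightarrow> complex \<Rightarrow> complex \<Rightarrow> complex \<Rightarrow> bool" where
  "whitham_order_zero c H k b lam0 K0 B0 \<longleftrightarrow>
     lam0 * K0 + of_real k * (of_real (d1 c k b) * K0 + of_real (d2 c k b) * B0) = 0 \<and>
     lam0 * (of_real (d1 (mean H) k b - mean H k b / k) * K0 + of_real (d2 (mean H) k b) * B0) - B0 = 0"

definition modulated_translation :: "(real \<Rightarrow> real \<Rightarrow> real) \<Rightarrow> (real \<Rightarrow> real \<Rightarrow> real \<Rightarrow> real) \<Rightarrow>
    real \<Rightarrow> real \<Rightarrow> real \<Rightarrow> vfun" where
  "modulated_translation c H k b l y =
     of_real (1 / k) \<odot> dyU c H k b y + (\<i> * of_real l) \<odot> dkU c H k b y"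

end

theory Submission
  imports Defs "HOL-Complex_Analysis.Cauchy_Integral_Formula"
begin

text \<open>The waves form a two-parameter family, so differentiating the profile equation along the family gives
explicit solutions of the linearized system. Write \<open>U = (H, Q)\<close> and \<open>A\<close> for the linearization at the wave.
Translation gives \<open>A U' = 0\<close>, the parameter \<open>b\<close> gives \<open>A \<partial>\<^sub>bU = - k \<partial>\<^sub>bc U'\<close>, and the parameter \<open>k\<close> gives
\<open>A (\<partial>\<^sub>kU + (y/k) U') = - k \<partial>\<^sub>kc U'\<close>: the profiles with neighbouring wavenumbers are rescaled to the variable
of the given wave, and the rescaling produces the secular term \<open>(y/k) U'\<close>. All three are instances of
\<open>tangent_solves\<close>.

Let \<open>w\<close> be a critical eigenfunction for \<open>l \<noteq> 0\<close> with eigenvalue \<open>\<lambda>(l) = ilk \<lambda>\<^sup>0 + O(l\<^sup>2)\<close>. The assumed form of its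
coordinates gives \<open>l w = W\<^sub>0 + l W\<^sub>1 + O(l\<^sup>2)\<close> with \<open>W\<^sub>0 = (k\<^sup>0/(ik)) U'\<close> for some \<open>k\<^sup>0\<close>. Conjugation by \<open>e\<^bsup>ily\<^esup>\<close> turns
the Bloch operator into \<open>A\<close> itself, acting on functions that are no longer periodic, and the difference
quotient \<open>(e\<^bsup>ily\<^esup> l w - W\<^sub>0) / l\<close> converges to \<open>W\<^sub>1 + iy W\<^sub>0\<close> locally in mean. As \<open>A\<close> is closed for this convergence
(\<open>solves_limit\<close>), \<open>A (W\<^sub>1 + iy W\<^sub>0) = \<lambda>'(0) W\<^sub>0\<close> (\<open>first_order_equation\<close>). The secular term \<open>iy W\<^sub>0\<close> is the one of
\<open>k\<^sup>0 (\<partial>\<^sub>kU + (y/k) U')\<close>. Since \<open>\<partial>\<^sub>bc \<noteq> 0\<close>, the first Whitham equation defines a number \<open>b\<^sup>0\<close>, and with it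
\<open>W\<^sub>1 - k\<^sup>0 \<partial>\<^sub>kU - b\<^sup>0 \<partial>\<^sub>bU\<close> is periodic and annihilated by \<open>A\<close>, hence a multiple of \<open>U'\<close>. This is the asserted
expansion. The second Whitham equation is the mean over a period of the equation of mass, at order \<open>l\<^sup>2\<close>
(\<open>mean_flux_limit\<close>). If \<open>k\<^sup>0 = b\<^sup>0 = 0\<close>, then \<open>w\<close> would be too small to be dual to an eigenfunction of the
adjoint. These facts make up \<open>eigenfunction_expansion\<close>.

For the bases, duality expresses \<open>v\<^sub>1\<close> through the \<open>l w\<^sub>j\<close> with coefficients analytic in \<open>l\<close>, so that
\<open>v\<^sub>1 = x U' + l (z\<^sub>1 \<partial>\<^sub>kU + z\<^sub>2 \<partial>\<^sub>bU + z\<^sub>3 U') + O(l\<^sup>2)\<close> with \<open>z\<^sub>1 = ikx\<close> (\<open>v1_expansion\<close>). At \<open>l = 0\<close> the generalized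
kernel contains \<open>\<partial>\<^sub>bU\<close>, which determines \<open>v\<^sub>2\<close> there up to a multiple of \<open>U'\<close> (\<open>v2_0\<close>). A change of basis
that is polynomial in \<open>l\<close> and has constant determinant removes the unwanted terms (\<open>adapted_bases\<close>).\<close>

section \<open>Equality almost everywhere\<close>

lemma ae_eq_iff_negligible: "f \<doteq> g \<longleftrightarrow> negligible {y::real. f y \<noteq> g y}"
  unfolding negligible_iff_null_sets
  by (subst completion.AE_iff_null_sets) auto

lemma ae_eq_sym: "f \<doteq> g \<Longrightarrow> g \<doteq> f" for f g :: "real \<Rightarrow> 'a"
  by (auto elim: eventually_mono)

lemma ae_eq_trans [trans]: "f \<doteq> g \<Longrightarrow> g \<doteq> h \<Longrightarrow> f \<doteq> h" for f g h :: "real \<Rightarrow> 'a"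
  by (auto elim: eventually_elim2)

lemma continuous_ae_eq_imp_eq:
  fixes f g :: "real \<Rightarrow> 'a::real_normed_vector"
  assumes "continuous_on UNIV f" "continuous_on UNIV g" "f \<doteq> g"
  shows "f = g"
proof (rule ccontr)
  assume "f \<noteq> g"
  then obtain x where "f x \<noteq> g x" by auto
  have "open {y. f y \<noteq> g y}"
    using assms by (intro open_Collect_neq)
  moreover have "negligible {y. f y \<noteq> g y}"
    using assms(3) by (simp add: ae_eq_iff_negligible)
  ultimately have "{y. f y \<noteq> g y} = {}"
    using open_not_negligible by blast
  with \<open>f x \<noteq> g x\<close> show False by auto
qed

section \<open>Primitives of locally integrable functions\<close>

definition loc_int :: "(real \<Rightarrow> 'a::euclidean_space) \<Rightarrow> bool" where
  "loc_int f \<longleftrightarrow> (\<forall>a b. f absolutely_integrable_on {a..b})"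

text \<open>The primitive that vanishes at 0. The sign for negative arguments makes
\<open>prim g b - prim g a\<close> the integral over \<open>{a..b}\<close> on the whole line.\<close>

definition prim :: "(real \<Rightarrow> 'a::euclidean_space) \<Rightarrow> real \<Rightarrow> 'a" where
  "prim g y = (if 0 \<le> y then integral {0..y} g else - integral {y..0} g)"

lemma loc_intD: "loc_int f \<Longrightarrow> f absolutely_integrable_on {a..b}"
  by (auto simp: loc_int_def)

lemma loc_int_integrable: "loc_int f \<Longrightarrow> f integrable_on {a..b}"
  using loc_intD[of f a b] by (simp add: absolutely_integrable_on_def)

lemma loc_int_norm: "loc_int f \<Longrightarrow> loc_int (\<lambda>y. norm (f y))"
  using absolutely_integrable_norm[where f=f] by (simp add: loc_int_def o_def)

lemma loc_int_norm_integrable: "loc_int f \<Longrightarrow> (\<lambda>y. norm (f y)) integrable_on {a..b}"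
  by (rule loc_int_integrable[OF loc_int_norm])

lemma loc_int_add: "loc_int f \<Longrightarrow> loc_int g \<Longrightarrow> loc_int (\<lambda>y. f y + g y)"
  by (auto simp: loc_int_def intro: set_integral_add)

lemma loc_int_diff: "loc_int f \<Longrightarrow> loc_int g \<Longrightarrow> loc_int (\<lambda>y. f y - g y)"
  by (auto simp: loc_int_def intro: set_integral_diff)

lemma loc_int_continuous: "continuous_on UNIV f \<Longrightarrow> loc_int f"
  unfolding loc_int_def
  by (intro allI absolutely_integrable_continuous_real) (auto intro: continuous_on_subset)

lemma loc_int_mult:
  fixes a g :: "real \<Rightarrow> complex"
  assumes a: "continuous_on UNIV a" and g: "loc_int g"
  shows "loc_int (\<lambda>y. a y * g y)"
  unfolding loc_int_def
proof (intro allI)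
  fix s t :: real
  have c: "continuous_on {s..t} a"
    using a by (auto intro: continuous_on_subset)
  then have "bounded (a ` {s..t})"
    by (intro compact_imp_bounded compact_continuous_image) auto
  moreover have "a \<in> borel_measurable (lebesgue_on {s..t})"
    by (simp add: c continuous_imp_measurable_on_sets_lebesgue)
  ultimately show "(\<lambda>y. a y * g y) absolutely_integrable_on {s..t}"
    using g by (intro absolutely_integrable_bounded_measurable_product[OF bilinear_times])
       (auto simp: loc_int_def)
qed

lemma loc_int_cmult: "loc_int g \<Longrightarrow> loc_int (\<lambda>y. a * g y)" for a :: complex
  by (rule loc_int_mult) auto

lemma loc_int_cong:
  assumes "loc_int f" "f \<doteq> g" shows "loc_int g"
  unfolding loc_int_def
proof (intro allI)
  fix a b
  show "g absolutely_integrable_on {a..b}"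
    by (rule absolutely_integrable_spike[OF loc_intD[OF assms(1)]
            assms(2)[unfolded ae_eq_iff_negligible]]) simp
qed

lemma integral_ae_cong: "f \<doteq> g \<Longrightarrow> integral S f = integral S g"
  unfolding ae_eq_iff_negligible by (rule integral_spike[where S="{y. f y \<noteq> g y}"]) auto

lemma prim_0 [simp]: "prim g 0 = 0"
  by (simp add: prim_def)

lemma prim_diff:
  assumes g: "loc_int g" and "a \<le> b"
  shows "prim g b - prim g a = integral {a..b} g"
proof -
  note c = Henstock_Kurzweil_Integration.integral_combine[OF _ _ loc_int_integrable[OF g]]
  consider "0 \<le> a" | "a < 0" "0 \<le> b" | "b < 0" by linarith
  then show ?thesis
  proof cases
    case 1
    then show ?thesis using c[of 0 a b] \<open>a \<le> b\<close> by (simp add: prim_def algebra_simps)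
  next
    case 2
    then show ?thesis using c[of a 0 b] by (simp add: prim_def algebra_simps)
  next
    case 3
    then show ?thesis using c[of a b 0] \<open>a \<le> b\<close> by (simp add: prim_def algebra_simps)
  qed
qed

lemma prim_unique:
  assumes "loc_int g" "\<And>a b. a \<le> b \<Longrightarrow> F b - F a = integral {a..b} g"
  shows "F y = F 0 + prim g y"
  using assms(2)[of 0 y] assms(2)[of y 0] by (cases "0 \<le> y") (auto simp: prim_def algebra_simps)

lemma prim_cong: "f \<doteq> g \<Longrightarrow> prim f = prim g"
  by (auto simp: prim_def fun_eq_iff integral_ae_cong)

lemma prim_add:
  assumes "loc_int f" "loc_int g"
  shows "prim (\<lambda>y. f y + g y) y = prim f y + prim g y"
  using assms by (auto simp: prim_def integral_add loc_int_integrable)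

lemma prim_diff_fun:
  assumes "loc_int f" "loc_int g"
  shows "prim (\<lambda>y. f y - g y) y = prim f y - prim g y"
  using assms by (auto simp: prim_def integral_diff loc_int_integrable)

lemma prim_cmult: "prim (\<lambda>y. a * g y) y = a * prim g y" for a :: complex
  by (auto simp: prim_def)

lemma norm_prim_diff_le:
  assumes "loc_int g" "a \<le> b"
  shows "norm (prim g b - prim g a) \<le> integral {a..b} (\<lambda>y. norm (g y))"
  unfolding prim_diff[OF assms]
  by (intro integral_norm_bound_integral loc_int_integrable loc_int_norm_integrable assms) auto

lemma continuous_on_prim:
  assumes g: "loc_int g"
  shows "continuous_on UNIV (prim g)"
proof -
  have "continuous_on {-real n..real n} (prim g)" for n
  proof -
    have "continuous_on {-real n..real n} (\<lambda>y. prim g (- real n) + integral {-real n..y} g)"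
      by (intro continuous_intros indefinite_integral_continuous_1 loc_int_integrable g)
    then show ?thesis
      by (rule continuous_on_eq) (use prim_diff[OF g] in \<open>auto simp: algebra_simps\<close>)
  qed
  note on_interval = this
  have "isCont (prim g) x" for x
  proof -
    obtain n :: nat where n: "\<bar>x\<bar> < real n" using reals_Archimedean2 by blast
    have "continuous_on {-real n<..<real n} (prim g)"
      by (rule continuous_on_subset[OF on_interval[of n]]) auto
    then show ?thesis
      by (rule continuous_on_interior) (use n in auto)
  qed
  then show ?thesis by (simp add: continuous_on_eq_continuous_at)
qed

text \<open>A normal form: questions about weak derivatives become questions about primitives and
constants of integration.\<close>

lemma has_weak_deriv_iff:
  "has_weak_deriv f g \<longleftrightarrow> loc_int g \<and> (\<exists>C. f \<doteq> (\<lambda>y. C + prim g y))"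
proof
  assume "has_weak_deriv f g"
  then obtain f0 where f0: "f \<doteq> f0"
    "\<And>a b. a \<le> b \<Longrightarrow> g absolutely_integrable_on {a..b} \<and> f0 b - f0 a = integral {a..b} g"
    by (auto simp: has_weak_deriv_def)
  have g: "loc_int g"
    unfolding loc_int_def
  proof (intro allI)
    fix a b show "g absolutely_integrable_on {a..b}"
      using f0(2)[of a b] by (cases "a \<le> b") auto
  qed
  have "f0 = (\<lambda>y. f0 0 + prim g y)"
    using prim_unique[OF g] f0(2) by blast
  with g f0(1) show "loc_int g \<and> (\<exists>C. f \<doteq> (\<lambda>y. C + prim g y))"
    by metis
next
  assume "loc_int g \<and> (\<exists>C. f \<doteq> (\<lambda>y. C + prim g y))"
  then obtain C where "loc_int g" "f \<doteq> (\<lambda>y. C + prim g y)" by blast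
  then show "has_weak_deriv f g"
    unfolding has_weak_deriv_def
    by (intro exI[of _ "\<lambda>y. C + prim g y"]) (auto simp: prim_diff loc_intD)
qed

lemma has_weak_deriv_cong:
  assumes "has_weak_deriv f g" "f \<doteq> f'" "g \<doteq> g'"
  shows "has_weak_deriv f' g'"
proof -
  obtain C where C: "f \<doteq> (\<lambda>y. C + prim g y)" and g: "loc_int g"
    using assms(1) by (auto simp: has_weak_deriv_iff)
  have "f' \<doteq> (\<lambda>y. C + prim g' y)"
    using ae_eq_trans[OF ae_eq_sym[OF assms(2)] C] by (simp add: prim_cong[OF assms(3)])
  with loc_int_cong[OF g assms(3)] show ?thesis by (auto simp: has_weak_deriv_iff)
qed

lemma has_weak_deriv_add:
  assumes "has_weak_deriv f f'" "has_weak_deriv g g'"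
  shows "has_weak_deriv (\<lambda>y. f y + g y) (\<lambda>y. f' y + g' y)"
proof -
  obtain C D where "f \<doteq> (\<lambda>y. C + prim f' y)" "g \<doteq> (\<lambda>y. D + prim g' y)" 
    and l: "loc_int f'" "loc_int g'"
    using assms by (auto simp: has_weak_deriv_iff)
  then have "(\<lambda>y. f y + g y) \<doteq> (\<lambda>y. (C + D) + prim (\<lambda>y. f' y + g' y) y)"
    by (auto elim!: eventually_elim2 simp: prim_add)
  with l show ?thesis unfolding has_weak_deriv_iff by (blast intro: loc_int_add)
qed

lemma has_weak_deriv_cmult:
  assumes "has_weak_deriv f f'"
  shows "has_weak_deriv (\<lambda>y. a * f y) (\<lambda>y. a * f' y)"
proof -
  obtain C where "f \<doteq> (\<lambda>y. C + prim f' y)"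
    and l: "loc_int f'"
    using assms by (auto simp: has_weak_deriv_iff)
  then have "(\<lambda>y. a * f y) \<doteq> (\<lambda>y. a * C + prim (\<lambda>y. a * f' y) y)"
    by (auto elim!: eventually_mono simp: prim_cmult algebra_simps)
  with l show ?thesis unfolding has_weak_deriv_iff by (blast intro: loc_int_cmult)
qed

lemma has_weak_deriv_diff:
  assumes "has_weak_deriv f f'" "has_weak_deriv g g'"
  shows "has_weak_deriv (\<lambda>y. f y - g y) (\<lambda>y. f' y - g' y)"
  using has_weak_deriv_add[OF assms(1) has_weak_deriv_cmult[OF assms(2), of "-1"]] by simp

lemma has_weak_deriv_classical:
  assumes "\<And>y. (f has_vector_derivative f' y) (at y)" "continuous_on UNIV f'"
  shows "has_weak_deriv f f'"
  unfolding has_weak_deriv_def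
proof (intro exI[of _ f] conjI allI impI)
  fix a b :: real assume "a \<le> b"
  show "f' absolutely_integrable_on {a..b}"
    using loc_int_continuous[OF assms(2)] by (simp add: loc_int_def)
  have "(f' has_integral f b - f a) {a..b}"
    using assms(1) by (intro fundamental_theorem_of_calculus \<open>a \<le> b\<close>) (auto intro: has_vector_derivative_at_within)
  then show "f b - f a = integral {a..b} f'" by (simp add: integral_unique)
qed auto

text \<open>By Lebesgue's theorem a locally integrable function is almost everywhere the derivative of
its primitive.\<close>

lemma ae_zero_if_prim_const:
  assumes g: "loc_int g" and z: "\<And>y. prim g y = 0"
  shows "g \<doteq> (\<lambda>_. 0)"
proof -
  have "\<And>a b. g integrable_on cbox a b" using loc_int_integrable[OF g] by simp
  then obtain N where N: "negligible N" "\<And>x e. \<lbrakk>x \<notin> N; 0 < e\<rbrakk> \<Longrightarrow>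
               \<exists>d>0. \<forall>h. 0 < h \<and> h < d \<longrightarrow>
                         norm(integral (cbox x (x + h *\<^sub>R One)) g /\<^sub>R h ^ DIM(real) - g x) < e"
    using integrable_ccontinuous_explicit by blast
  have "g x = 0" if "x \<notin> N" for x
  proof (rule ccontr)
    assume "g x \<noteq> 0"
    then have "0 < norm (g x)" by simp
    from N(2)[OF that this] obtain d where d: "d > 0" and *: "\<And>h. 0 < h \<Longrightarrow> h < d \<Longrightarrow>
       norm(integral (cbox x (x + h *\<^sub>R One)) g /\<^sub>R h ^ DIM(real) - g x) < norm (g x)"
      by blast
    have "integral {x..x + d/2} g = 0"
      using prim_diff[OF g, of x "x + d/2"] d z by simp
    then show False using *[of "d/2"] d by simp
  qed
  then have "{y. g y \<noteq> 0} \<subseteq> N" by auto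
  with N(1) show ?thesis by (auto simp: ae_eq_iff_negligible intro: negligible_subset)
qed

lemma has_weak_deriv_unique:
  assumes "has_weak_deriv f g" "has_weak_deriv f h"
  shows "g \<doteq> h"
proof -
  let ?d = "\<lambda>y. g y - h y"
  have "has_weak_deriv (\<lambda>y. 0) ?d"
    using has_weak_deriv_diff[OF assms] by simp
  then obtain C where d: "loc_int ?d" and C: "(\<lambda>y. 0) \<doteq> (\<lambda>y. C + prim ?d y)"
    by (auto simp: has_weak_deriv_iff)
  have "(\<lambda>y. 0) = (\<lambda>y. C + prim ?d y)"
    by (intro continuous_ae_eq_imp_eq[OF _ _ C] continuous_intros continuous_on_prim d)
  then have *: "C + prim ?d y = 0" for y by metis
  have "prim ?d y = 0" for y using *[of y] *[of 0] by simp
  from ae_zero_if_prim_const[OF d this] show ?thesis by (auto elim: eventually_mono)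
qed

lemma has_weak_deriv_wderiv:
  assumes "has_weak_deriv f g" shows "has_weak_deriv f (wderiv f)" "wderiv f \<doteq> g"
proof -
  show "has_weak_deriv f (wderiv f)" unfolding wderiv_def using assms by (rule someI[where P="has_weak_deriv f"])
  from has_weak_deriv_unique[OF this assms] show "wderiv f \<doteq> g" .
qed

text \<open>The difference \<open>\<Phi>\<close> of the two sides satisfies \<open>\<bar>\<Phi> t - \<Phi> s\<bar> \<le> 2 L \<bar>t - s\<bar> \<bar>\<mu> t - \<mu> s\<bar>\<close>, where \<open>L\<close> bounds
\<open>a'\<close> and \<open>\<mu>\<close> is the continuous primitive of \<open>\<bar>g\<bar>\<close>. So \<open>\<Phi>\<close> has derivative 0 at every point, although \<open>prim g\<close>
need not be differentiable, and \<open>\<Phi>\<close> is constant.\<close>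

lemma prim_product:
  fixes a a' g :: "real \<Rightarrow> complex"
  assumes a: "\<And>y. (a has_vector_derivative a' y) (at y)" and a': "continuous_on UNIV a'"
    and g: "loc_int g"
  shows "a y * prim g y = prim (\<lambda>y. a' y * prim g y + a y * g y) y"
proof -
  let ?h = "\<lambda>y. a' y * prim g y + a y * g y"
  have ca: "continuous_on UNIV a"
    using a by (meson continuous_at_imp_continuous_on has_vector_derivative_continuous)
  have cp: "continuous_on UNIV (prim g)" by (rule continuous_on_prim[OF g])
  have la: "loc_int (\<lambda>y. a y * g y)" by (rule loc_int_mult[OF ca g])
  have lp: "loc_int (\<lambda>y. a' y * prim g y)" by (intro loc_int_continuous continuous_intros a' cp)
  have lh: "loc_int ?h" by (rule loc_int_add[OF lp la])
  define \<Phi> where "\<Phi> = (\<lambda>y. a y * prim g y - prim ?h y)"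
  define \<mu> where "\<mu> = prim (\<lambda>y. norm (g y))"
  have ln: "loc_int (\<lambda>y. norm (g y))"
    by (rule loc_int_norm[OF g])
  have c\<mu>: "continuous_on UNIV \<mu>" unfolding \<mu>_def by (rule continuous_on_prim[OF ln])
  have bound: "norm (\<Phi> t - \<Phi> s) \<le> 2 * L * (t - s) * (\<mu> t - \<mu> s)"
    if st: "s \<le> t" "{s..t} \<subseteq> {l..u}" and L: "\<And>y. y \<in> {l..u} \<Longrightarrow> norm (a' y) \<le> L" for s t l u L
  proof -
    have mu: "\<mu> t - \<mu> s = integral {s..t} (\<lambda>y. norm (g y))"
      unfolding \<mu>_def by (rule prim_diff[OF ln st(1)])
    have "s \<in> {l..u}" using st by auto
    then have L0: "L \<ge> 0" using L order_trans[OF norm_ge_zero] by blast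
    have lip: "norm (a t - a x) \<le> L * (t - s)" if "x \<in> {s..t}" for x
    proof -
      have "norm (a t - a x) \<le> L * norm (t - x)"
      proof (rule differentiable_bound[of "{s..t}" a "\<lambda>x h. h *\<^sub>R a' x"])
        show "(a has_derivative (\<lambda>h. h *\<^sub>R a' x)) (at x within {s..t})" for x
          using a[of x] by (auto simp: has_vector_derivative_def intro: has_derivative_at_withinI)
        show "onorm (\<lambda>h. h *\<^sub>R a' x) \<le> L" if "x \<in> {s..t}" for x
        proof (rule onorm_bound[OF L0])
          show "norm (h *\<^sub>R a' x) \<le> L * norm h" for h :: real
            using mult_left_mono[OF L[of x], of "\<bar>h\<bar>"] that st by (auto simp: mult.commute)
        qed
      qed (use that in auto)
      also have "\<dots> \<le> L * (t - s)" using that L0 by (intro mult_left_mono) auto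
      finally show ?thesis .
    qed
    have fta: "a t - a s = integral {s..t} a'"
      using fundamental_theorem_of_calculus[OF st(1), of a a'] a
      by (metis has_vector_derivative_at_within integral_unique)
    have i1: "a' integrable_on {s..t}"
      by (intro integrable_continuous_real continuous_on_subset[OF a']) auto
    have i2: "(\<lambda>x. a' x * prim g x) integrable_on {s..t}" by (rule loc_int_integrable[OF lp])
    have i3: "(\<lambda>x. a x * g x) integrable_on {s..t}" by (rule loc_int_integrable[OF la])
    have ig: "g integrable_on {s..t}" by (rule loc_int_integrable[OF g])
    have "\<Phi> t - \<Phi> s = a t * prim g t - a s * prim g s - integral {s..t} ?h"
      unfolding \<Phi>_def prim_diff[OF lh st(1), symmetric] by algebra
    also have "integral {s..t} ?h = integral {s..t} (\<lambda>x. a' x * prim g x) + integral {s..t} (\<lambda>x. a x * g x)"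
      by (rule integral_add[OF i2 i3])
    also have "a t * prim g t - a s * prim g s = a t * (prim g t - prim g s) + (a t - a s) * prim g s"
      by (simp add: algebra_simps)
    also have "\<dots> = integral {s..t} (\<lambda>x. a t * g x) + integral {s..t} (\<lambda>x. a' x * prim g s)"
      using prim_diff[OF g st(1)] fta by simp
    finally have "\<Phi> t - \<Phi> s = integral {s..t} (\<lambda>x. a t * g x) - integral {s..t} (\<lambda>x. a x * g x)
       - (integral {s..t} (\<lambda>x. a' x * prim g x) - integral {s..t} (\<lambda>x. a' x * prim g s))" by simp
    also have "integral {s..t} (\<lambda>x. a t * g x) - integral {s..t} (\<lambda>x. a x * g x) = 
       integral {s..t} (\<lambda>x. a t * g x - a x * g x)"
      using ig by (intro integral_diff[symmetric] i3 integrable_on_mult_right)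
    also have "integral {s..t} (\<lambda>x. a' x * prim g x) - integral {s..t} (\<lambda>x. a' x * prim g s) = 
       integral {s..t} (\<lambda>x. a' x * prim g x - a' x * prim g s)"
      using i1 by (intro integral_diff[symmetric] i2 integrable_on_mult_left)
    finally have eq: "\<Phi> t - \<Phi> s = integral {s..t} (\<lambda>x. a t * g x - a x * g x)
        - integral {s..t} (\<lambda>x. a' x * prim g x - a' x * prim g s)" .
    have "norm (integral {s..t} (\<lambda>x. a t * g x - a x * g x)) \<le> integral {s..t} (\<lambda>x. L * (t - s) * norm (g x))"
    proof (rule integral_norm_bound_integral)
      show "(\<lambda>x. L * (t - s) * norm (g x)) integrable_on {s..t}"
        by (intro integrable_on_mult_right loc_int_norm_integrable g)
      show "norm (a t * g x - a x * g x) \<le> L * (t - s) * norm (g x)" if "x \<in> {s..t}" for x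
        using mult_right_mono[OF lip[OF that], of "norm (g x)"]
        by (metis left_diff_distrib norm_ge_zero norm_mult)
    qed (use ig i3 in \<open>auto intro!: integrable_diff integrable_on_mult_right\<close>)
    also have "\<dots> = L * (t - s) * (\<mu> t - \<mu> s)" by (simp add: mu)
    finally have b1: "norm (integral {s..t} (\<lambda>x. a t * g x - a x * g x)) \<le> L * (t - s) * (\<mu> t - \<mu> s)" .
    have "norm (integral {s..t} (\<lambda>x. a' x * prim g x - a' x * prim g s)) \<le> integral {s..t} (\<lambda>x. L * (\<mu> t - \<mu> s))"
    proof (rule integral_norm_bound_integral)
      fix x assume x: "x \<in> {s..t}"
      have "norm (prim g x - prim g s) \<le> integral {s..x} (\<lambda>y. norm (g y))"
        using x by (intro norm_prim_diff_le g) auto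
      also have "\<dots> \<le> integral {s..t} (\<lambda>y. norm (g y))"
        using x by (intro integral_subset_le loc_int_norm_integrable g) auto
      finally have *: "norm (prim g x - prim g s) \<le> \<mu> t - \<mu> s" by (simp add: mu)
      have "norm (a' x) \<le> L" using L x st by auto
      then have "norm (a' x * (prim g x - prim g s)) \<le> L * (\<mu> t - \<mu> s)"
        unfolding norm_mult using * L0 by (intro mult_mono) auto
      then show "norm (a' x * prim g x - a' x * prim g s) \<le> L * (\<mu> t - \<mu> s)"
        by (simp add: algebra_simps)
    qed (use i1 i2 in \<open>auto intro!: integrable_diff integrable_on_mult_left\<close>)
    also have "\<dots> = L * (t - s) * (\<mu> t - \<mu> s)" using st by (simp add: algebra_simps)
    finally have b2: "norm (integral {s..t} (\<lambda>x. a' x * prim g x - a' x * prim g s)) \<le> L * (t - s) * (\<mu> t - \<mu> s)" .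
    have "norm (\<Phi> t - \<Phi> s) \<le> norm (integral {s..t} (\<lambda>x. a t * g x - a x * g x))
      + norm (integral {s..t} (\<lambda>x. a' x * prim g x - a' x * prim g s))"
      unfolding eq by (rule norm_triangle_ineq4)
    with b1 b2 show ?thesis by simp
  qed
  \<comment> \<open>continuity of \<open>\<mu>\<close> improves the bound to \<open>o(\<bar>t - s\<bar>)\<close>\<close>
  have deriv0: "(\<Phi> has_derivative (\<lambda>h. 0)) (at x)" for x
  proof -
    have "compact (a' ` {x-1..x+1})"
      by (intro compact_continuous_image continuous_on_subset[OF a']) auto
    then obtain L where L: "L > 0" "\<And>y. y \<in> {x-1..x+1} \<Longrightarrow> norm (a' y) \<le> L"
      using bounded_pos[of "a' ` {x-1..x+1}"] compact_imp_bounded by auto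
    have "isCont \<mu> x" using c\<mu> by (simp add: continuous_on_eq_continuous_at)
    show ?thesis
    proof (subst has_derivative_within_alt, intro conjI allI impI)
      show "bounded_linear (\<lambda>h::real. 0::complex)" by (rule bounded_linear_zero)
      fix e :: real assume "e > 0"
      then have "e / (2 * L) > 0" using L by simp
      then obtain d where d: "d > 0" "\<And>y. \<bar>y - x\<bar> < d \<Longrightarrow> \<bar>\<mu> y - \<mu> x\<bar> < e / (2 * L)"
        using \<open>isCont \<mu> x\<close> unfolding continuous_at_eps_delta dist_real_def by blast
      have "norm (\<Phi> y - \<Phi> x) \<le> e * norm (y - x)" if "norm (y - x) < min d 1" for y
      proof -
        have "norm (\<Phi> y - \<Phi> x) \<le> 2 * L * \<bar>y - x\<bar> * \<bar>\<mu> y - \<mu> x\<bar>"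
        proof (cases "x \<le> y")
          case True
          then have "norm (\<Phi> y - \<Phi> x) \<le> 2 * L * (y - x) * (\<mu> y - \<mu> x)"
            using that L(2) by (intro bound[of x y "x-1" "x+1" L]) auto
          also have "\<dots> \<le> 2 * L * \<bar>y - x\<bar> * \<bar>\<mu> y - \<mu> x\<bar>"
            using mult_left_mono[OF abs_ge_self[of "(y - x) * (\<mu> y - \<mu> x)"], of "2 * L"] L(1)
            by (simp add: abs_mult mult.assoc)
          finally show ?thesis .
        next
          case False
          then have "norm (\<Phi> x - \<Phi> y) \<le> 2 * L * (x - y) * (\<mu> x - \<mu> y)"
            using that L(2) by (intro bound[of y x "x-1" "x+1" L]) auto
          also have "\<dots> \<le> 2 * L * \<bar>y - x\<bar> * \<bar>\<mu> y - \<mu> x\<bar>"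
            using mult_left_mono[OF abs_ge_self[of "(x - y) * (\<mu> x - \<mu> y)"], of "2 * L"] L(1)
            by (simp add: abs_mult mult.assoc abs_minus_commute)
          finally show ?thesis by (simp add: norm_minus_commute)
        qed
        also have "\<dots> \<le> 2 * L * \<bar>y - x\<bar> * (e / (2 * L))"
          using d(2)[of y] that L(1) by (intro mult_left_mono) auto
        also have "\<dots> = e * norm (y - x)" using L(1) by simp
        finally show ?thesis .
      qed
      then show "\<exists>d>0. \<forall>y\<in>UNIV. norm (y - x) < d \<longrightarrow> norm (\<Phi> y - \<Phi> x - 0) \<le> e * norm (y - x)"
        using d(1) by (intro exI[of _ "min d 1"]) auto
    qed
  qed
  have "\<Phi> y = \<Phi> 0"
    using has_derivative_zero_unique[of UNIV \<Phi>] deriv0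
    by (metis UNIV_I convex_UNIV has_derivative_zero_constant)
  then show ?thesis by (simp add: \<Phi>_def)
qed

lemma has_weak_deriv_mult:
  assumes a: "\<And>y. (a has_vector_derivative a' y) (at y)" and a': "continuous_on UNIV a'"
    and f: "has_weak_deriv f g"
  shows "has_weak_deriv (\<lambda>y. a y * f y) (\<lambda>y. a' y * f y + a y * g y)"
proof -
  obtain C where g: "loc_int g" and C: "f \<doteq> (\<lambda>y. C + prim g y)"
    using f by (auto simp: has_weak_deriv_iff)
  have ca: "continuous_on UNIV a"
    using a by (meson continuous_at_imp_continuous_on has_vector_derivative_continuous)
  have l: "loc_int (\<lambda>y. a' y * prim g y + a y * g y)"
    by (intro loc_int_add loc_int_mult[OF ca g] loc_int_continuous continuous_intros a' continuous_on_prim g)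
  have "has_weak_deriv (\<lambda>y. a y * prim g y) (\<lambda>y. a' y * prim g y + a y * g y)"
    unfolding has_weak_deriv_iff
    by (intro conjI l exI[of _ 0]) (simp add: prim_product[OF a a' g])
  moreover have "has_weak_deriv (\<lambda>y. C * a y) (\<lambda>y. C * a' y)"
    by (intro has_weak_deriv_cmult has_weak_deriv_classical a a')
  ultimately have "has_weak_deriv (\<lambda>y. a y * prim g y + C * a y) (\<lambda>y. a' y * prim g y + a y * g y + C * a' y)"
    by (rule has_weak_deriv_add)
  then show ?thesis
    by (rule has_weak_deriv_cong) (use C in \<open>auto elim!: eventually_mono simp: algebra_simps\<close>)
qed

section \<open>Local convergence in mean\<close>

text \<open>The notion of limit for \<open>l \<rightarrow> 0\<close>. It is weak enough to follow from convergence of periodic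
functions in \<open>L\<^sup>2\<close>, makes sense for the non-periodic functions that arise from multiplication by \<open>e\<^bsup>ily\<^esup>\<close>, and
weak derivatives pass to the limit.\<close>

definition loc_L1_tendsto :: "('i \<Rightarrow> real \<Rightarrow> complex) \<Rightarrow> (real \<Rightarrow> complex) \<Rightarrow> 'i filter \<Rightarrow> bool" where
  "loc_L1_tendsto f g F \<longleftrightarrow> loc_int g \<and> (\<forall>\<^sub>F n in F. loc_int (f n)) \<and>
     (\<forall>a b. ((\<lambda>n. integral {a..b} (\<lambda>y. norm (f n y - g y))) \<longlongrightarrow> 0) F)"

lemma loc_L1_tendstoD:
  assumes "loc_L1_tendsto f g F"
  shows "loc_int g" "\<forall>\<^sub>F n in F. loc_int (f n)"
    "((\<lambda>n. integral {a..b} (\<lambda>y. norm (f n y - g y))) \<longlongrightarrow> 0) F"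
  using assms by (auto simp: loc_L1_tendsto_def)

lemma loc_L1_tendsto_bound:
  assumes g: "loc_int g" and f: "\<forall>\<^sub>F n in F. loc_int (f n)"
    and b: "\<And>a b. \<exists>e. (e \<longlongrightarrow> 0) F \<and> (\<forall>\<^sub>F n in F. integral {a..b} (\<lambda>y. norm (f n y - g y)) \<le> e n)"
  shows "loc_L1_tendsto f g F"
  unfolding loc_L1_tendsto_def
proof (intro conjI allI g f)
  fix a b :: real
  obtain e where e: "(e \<longlongrightarrow> 0) F" and le: "\<forall>\<^sub>F n in F. integral {a..b} (\<lambda>y. norm (f n y - g y)) \<le> e n"
    using b by blast
  show "((\<lambda>n. integral {a..b} (\<lambda>y. norm (f n y - g y))) \<longlongrightarrow> 0) F"
  proof (rule tendsto_sandwich[OF _ le tendsto_const e])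
    show "\<forall>\<^sub>F n in F. 0 \<le> integral {a..b} (\<lambda>y. norm (f n y - g y))"
      using f by eventually_elim (intro integral_nonneg loc_int_norm_integrable loc_int_diff g, auto)
  qed
qed

lemma loc_L1_tendsto_cong:
  assumes "loc_L1_tendsto f g F" "\<forall>\<^sub>F n in F. f n \<doteq> f' n" "g \<doteq> g'"
  shows "loc_L1_tendsto f' g' F"
proof (rule loc_L1_tendsto_bound)
  show "loc_int g'" using loc_int_cong[OF loc_L1_tendstoD(1)[OF assms(1)] assms(3)] .
  show "\<forall>\<^sub>F n in F. loc_int (f' n)"
    using loc_L1_tendstoD(2)[OF assms(1)] assms(2) by eventually_elim (rule loc_int_cong)
  fix a b :: real
  have "\<forall>\<^sub>F n in F. integral {a..b} (\<lambda>y. norm (f' n y - g' y)) \<le> integral {a..b} (\<lambda>y. norm (f n y - g y))"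
    using assms(2)
  proof eventually_elim
    case (elim n)
    have "(\<lambda>y. norm (f n y - g y)) \<doteq> (\<lambda>y. norm (f' n y - g' y))"
      using elim assms(3) by eventually_elim simp
    from integral_ae_cong[OF this] show ?case by simp
  qed
  then show "\<exists>e. (e \<longlongrightarrow> 0) F \<and> (\<forall>\<^sub>F n in F. integral {a..b} (\<lambda>y. norm (f' n y - g' y)) \<le> e n)"
    using loc_L1_tendstoD(3)[OF assms(1)] by blast
qed

lemma loc_L1_tendsto_add:
  assumes "loc_L1_tendsto f f0 F" "loc_L1_tendsto g g0 F"
  shows "loc_L1_tendsto (\<lambda>n y. f n y + g n y) (\<lambda>y. f0 y + g0 y) F"
proof (rule loc_L1_tendsto_bound)
  note f = loc_L1_tendstoD[OF assms(1)] and g = loc_L1_tendstoD[OF assms(2)]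
  show "loc_int (\<lambda>y. f0 y + g0 y)" by (rule loc_int_add[OF f(1) g(1)])
  show "\<forall>\<^sub>F n in F. loc_int (\<lambda>y. f n y + g n y)"
    using f(2) g(2) by eventually_elim (rule loc_int_add)
  fix a b :: real
  let ?I = "\<lambda>f. integral {a..b} (\<lambda>y. norm (f y))"
  have "\<forall>\<^sub>F n in F. integral {a..b} (\<lambda>y. norm (f n y + g n y - (f0 y + g0 y)))
     \<le> ?I (\<lambda>y. f n y - f0 y) + ?I (\<lambda>y. g n y - g0 y)"
    using f(2) g(2)
  proof eventually_elim
    case (elim n)
    note i = loc_int_diff[OF elim(1) f(1)] loc_int_diff[OF elim(2) g(1)]
    have "integral {a..b} (\<lambda>y. norm (f n y + g n y - (f0 y + g0 y)))
      \<le> integral {a..b} (\<lambda>y. norm (f n y - f0 y) + norm (g n y - g0 y))"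
      by (intro integral_le loc_int_norm_integrable integrable_add loc_int_diff loc_int_add elim f(1) g(1))
         (auto intro: norm_diff_triangle_ineq)
    also have "\<dots> = ?I (\<lambda>y. f n y - f0 y) + ?I (\<lambda>y. g n y - g0 y)"
      by (intro integral_add loc_int_norm_integrable i)
    finally show ?case .
  qed
  then show "\<exists>e. (e \<longlongrightarrow> 0) F \<and> (\<forall>\<^sub>F n in F.
      integral {a..b} (\<lambda>y. norm (f n y + g n y - (f0 y + g0 y))) \<le> e n)"
    using tendsto_add[OF f(3)[of a b] g(3)[of a b]] by auto
qed

lemma loc_L1_tendsto_mult:
  assumes "loc_L1_tendsto f f0 F" and a: "continuous_on UNIV a"
  shows "loc_L1_tendsto (\<lambda>n y. a y * f n y) (\<lambda>y. a y * f0 y) F"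
proof (rule loc_L1_tendsto_bound)
  note f = loc_L1_tendstoD[OF assms(1)]
  show "loc_int (\<lambda>y. a y * f0 y)" by (rule loc_int_mult[OF a f(1)])
  show "\<forall>\<^sub>F n in F. loc_int (\<lambda>y. a y * f n y)"
    using f(2) by eventually_elim (rule loc_int_mult[OF a])
  fix s t :: real
  have "compact (a ` {s..t})"
    by (intro compact_continuous_image continuous_on_subset[OF a]) auto
  then obtain L where L: "L > 0" "\<And>y. y \<in> {s..t} \<Longrightarrow> norm (a y) \<le> L"
    using bounded_pos[of "a ` {s..t}"] compact_imp_bounded by auto
  have "\<forall>\<^sub>F n in F. integral {s..t} (\<lambda>y. norm (a y * f n y - a y * f0 y))
     \<le> L * integral {s..t} (\<lambda>y. norm (f n y - f0 y))"
    using f(2)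
  proof eventually_elim
    case (elim n)
    have "integral {s..t} (\<lambda>y. norm (a y * f n y - a y * f0 y)) \<le> integral {s..t} (\<lambda>y. L * norm (f n y - f0 y))"
    proof (rule integral_le)
      fix y assume "y \<in> {s..t}"
      then show "norm (a y * f n y - a y * f0 y) \<le> L * norm (f n y - f0 y)"
        using L(2)[of y] by (simp add: right_diff_distrib[symmetric] norm_mult mult_right_mono)
    qed (intro loc_int_norm_integrable loc_int_diff loc_int_mult a elim f(1) integrable_on_mult_right)+
    then show ?case by simp
  qed
  then show "\<exists>e. (e \<longlongrightarrow> 0) F \<and> (\<forall>\<^sub>F n in F. integral {s..t} (\<lambda>y. norm (a y * f n y - a y * f0 y)) \<le> e n)"
    using tendsto_mult_right_zero[OF f(3)[of s t], of L] by auto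
qed

lemma loc_L1_tendsto_cmult:
  "loc_L1_tendsto f f0 F \<Longrightarrow> loc_L1_tendsto (\<lambda>n y. a * f n y) (\<lambda>y. a * f0 y) F"
  by (rule loc_L1_tendsto_mult) auto

lemma loc_L1_tendsto_diff:
  assumes "loc_L1_tendsto f f0 F" "loc_L1_tendsto g g0 F"
  shows "loc_L1_tendsto (\<lambda>n y. f n y - g n y) (\<lambda>y. f0 y - g0 y) F"
  using loc_L1_tendsto_add[OF assms(1) loc_L1_tendsto_cmult[OF assms(2), of "-1"]] by simp

lemma loc_L1_tendsto_uniform:
  assumes g: "loc_int g" and f: "\<forall>\<^sub>F n in F. loc_int (f n)"
    and b: "\<And>a b. \<exists>e. (e \<longlongrightarrow> 0) F \<and> (\<forall>\<^sub>F n in F. \<forall>y\<in>{a..b}. norm (f n y - g y) \<le> e n)"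
  shows "loc_L1_tendsto f g F"
proof (rule loc_L1_tendsto_bound[OF g f])
  fix a b :: real
  obtain e where e: "(e \<longlongrightarrow> 0) F" "\<forall>\<^sub>F n in F. \<forall>y\<in>{a..b}. norm (f n y - g y) \<le> e n"
    using b by blast
  have "\<forall>\<^sub>F n in F. integral {a..b} (\<lambda>y. norm (f n y - g y)) \<le> measure lborel {a..b} * e n"
    using e(2) f
  proof eventually_elim
    case (elim n)
    have "integral {a..b} (\<lambda>y. norm (f n y - g y)) \<le> integral {a..b} (\<lambda>y. e n)"
      by (intro integral_le loc_int_norm_integrable loc_int_diff elim g) (use elim in auto)
    then show ?case by simp
  qed
  then show "\<exists>e. (e \<longlongrightarrow> 0) F \<and> (\<forall>\<^sub>F n in F. integral {a..b} (\<lambda>y. norm (f n y - g y)) \<le> e n)"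
    using tendsto_mult_right_zero[OF e(1), of "measure lborel {a..b}"] by blast
qed

lemma loc_L1_tendsto_const:
  assumes "(c \<longlongrightarrow> c0) F" shows "loc_L1_tendsto (\<lambda>n y. c n) (\<lambda>y. c0) F"
proof (rule loc_L1_tendsto_uniform)
  fix a b :: real
  have "((\<lambda>n. norm (c n - c0)) \<longlongrightarrow> 0) F"
    using tendsto_norm[OF LIM_zero[OF assms]] by simp
  then show "\<exists>e. (e \<longlongrightarrow> 0) F \<and> (\<forall>\<^sub>F n in F. \<forall>y\<in>{a..b}. norm (c n - c0) \<le> e n)"
    by (intro exI[of _ "\<lambda>n. norm (c n - c0)"]) auto
qed (auto intro!: loc_int_continuous always_eventually)

lemma loc_L1_tendsto_prim:
  assumes "loc_L1_tendsto g g0 F"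
  shows "loc_L1_tendsto (\<lambda>n. prim (g n)) (prim g0) F"
proof (rule loc_L1_tendsto_uniform)
  note g = loc_L1_tendstoD[OF assms]
  show "loc_int (prim g0)" by (intro loc_int_continuous continuous_on_prim g)
  show "\<forall>\<^sub>F n in F. loc_int (prim (g n))"
    using g(2) by eventually_elim (rule loc_int_continuous[OF continuous_on_prim])
  fix a b :: real
  define R where "R = max \<bar>a\<bar> \<bar>b\<bar>"
  let ?e = "\<lambda>n. integral {-R..R} (\<lambda>y. norm (g n y - g0 y))"
  have "\<forall>\<^sub>F n in F. \<forall>y\<in>{a..b}. norm (prim (g n) y - prim g0 y) \<le> ?e n"
    using g(2)
  proof eventually_elim
    case (elim n)
    let ?d = "\<lambda>y. g n y - g0 y"
    have d: "loc_int ?d" by (rule loc_int_diff[OF elim g(1)])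
    show ?case
    proof
      fix y assume "y \<in> {a..b}"
      then have y: "-R \<le> y" "y \<le> R" "0 \<le> R" by (auto simp: R_def)
      have "norm (prim ?d y) \<le> ?e n"
      proof (cases "0 \<le> y")
        case True
        have "norm (prim ?d y) \<le> integral {0..y} (\<lambda>y. norm (?d y))"
          using norm_prim_diff_le[OF d True] by simp
        also have "\<dots> \<le> ?e n"
          using y True by (intro integral_subset_le loc_int_norm_integrable d) auto
        finally show ?thesis .
      next
        case False
        then have "norm (prim ?d y) \<le> integral {y..0} (\<lambda>y. norm (?d y))"
          using norm_prim_diff_le[OF d, of y 0] by simp
        also have "\<dots> \<le> ?e n"
          using y False by (intro integral_subset_le loc_int_norm_integrable d) auto
        finally show ?thesis .
      qed
      then show "norm (prim (g n) y - prim g0 y) \<le> ?e n"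
        by (simp add: prim_diff_fun[OF elim g(1)])
    qed
  qed
  with g(3) show "\<exists>e. (e \<longlongrightarrow> 0) F \<and> (\<forall>\<^sub>F n in F. \<forall>y\<in>{a..b}. norm (prim (g n) y - prim g0 y) \<le> e n)"
    by blast
qed

lemma loc_L1_tendsto_integral:
  assumes "loc_L1_tendsto f g F"
  shows "((\<lambda>n. integral {a..b} (f n)) \<longlongrightarrow> integral {a..b} g) F"
proof -
  note f = loc_L1_tendstoD[OF assms]
  have "\<forall>\<^sub>F n in F. norm (integral {a..b} (f n) - integral {a..b} g) \<le> integral {a..b} (\<lambda>y. norm (f n y - g y))"
    using f(2)
  proof eventually_elim
    case (elim n)
    have "integral {a..b} (f n) - integral {a..b} g = integral {a..b} (\<lambda>y. f n y - g y)"
      by (intro integral_diff[symmetric] loc_int_integrable elim f(1))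
    then show ?case
      by (simp only:) (intro integral_norm_bound_integral loc_int_integrable loc_int_norm_integrable
          loc_int_diff elim f(1), auto)
  qed
  from Lim_null_comparison[OF this f(3)] show ?thesis by (rule LIM_zero_cancel)
qed

lemma loc_L1_tendsto_unique:
  assumes "loc_L1_tendsto f g F" "loc_L1_tendsto f h F" "F \<noteq> bot"
  shows "g \<doteq> h"
proof -
  let ?d = "\<lambda>y. norm (g y - h y)"
  have t: "loc_L1_tendsto (\<lambda>n y. 0) (\<lambda>y. g y - h y) F"
    using loc_L1_tendsto_diff[OF assms(1,2)] by simp
  then have d: "loc_int ?d" by (intro loc_int_norm loc_L1_tendstoD(1))
  have z: "integral {a..b} ?d = 0" for a b
    using loc_L1_tendstoD(3)[OF t, of a b] assms(3) by (simp add: tendsto_const_iff norm_minus_commute)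
  have "prim ?d y = 0" for y by (simp add: prim_def z)
  from ae_zero_if_prim_const[OF d this] show ?thesis by (auto elim: eventually_mono)
qed

text \<open>The constants of integration converge because each is the mean over \<open>{0..1}\<close> of a function that
converges in mean, the difference of \<open>f n\<close> and the primitive of \<open>g n\<close>.\<close>

lemma has_weak_deriv_limit:
  assumes w: "\<forall>\<^sub>F n in F. has_weak_deriv (f n) (g n)"
    and f: "loc_L1_tendsto f f0 F" and g: "loc_L1_tendsto g g0 F" and F: "F \<noteq> bot"
  shows "has_weak_deriv f0 g0"
proof -
  define C where "C n = integral {0..1} (\<lambda>y. f n y - prim (g n) y)" for n
  define C0 where "C0 = integral {0..1} (\<lambda>y. f0 y - prim g0 y)"
  note p = loc_L1_tendsto_prim[OF g]
  have "(C \<longlongrightarrow> C0) F"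
    unfolding C_def C0_def by (intro loc_L1_tendsto_integral loc_L1_tendsto_diff f p)
  then have lim: "loc_L1_tendsto (\<lambda>n y. C n + prim (g n) y) (\<lambda>y. C0 + prim g0 y) F"
    by (intro loc_L1_tendsto_add loc_L1_tendsto_const p)
  have eq: "\<forall>\<^sub>F n in F. (\<lambda>y. C n + prim (g n) y) \<doteq> f n"
    using w
  proof eventually_elim
    case (elim n)
    then obtain K where K: "f n \<doteq> (\<lambda>y. K + prim (g n) y)" by (auto simp: has_weak_deriv_iff)
    then have "(\<lambda>y. f n y - prim (g n) y) \<doteq> (\<lambda>y. K)" by eventually_elim simp
    from integral_ae_cong[OF this, of "{0..1}"] have "C n = K" by (simp add: C_def)
    with K show ?case by (auto elim: eventually_mono)
  qed
  have "(\<lambda>y. C0 + prim g0 y) \<doteq> f0"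
    by (rule loc_L1_tendsto_unique[OF loc_L1_tendsto_cong[OF lim eq] f F]) simp
  then show ?thesis
    unfolding has_weak_deriv_iff
    by (intro conjI exI[of _ C0] loc_L1_tendstoD(1)[OF g]) (rule ae_eq_sym)
qed

text \<open>For a derivative that is known to converge only up to an additive constant: subtracting the primitive
of \<open>g n\<close> from \<open>f n\<close> leaves an affine function, and its slope is the difference of its means over \<open>{1..2}\<close>
and \<open>{0..1}\<close>.\<close>

lemma has_weak_deriv_limit_slope:
  assumes w: "\<forall>\<^sub>F n in F. has_weak_deriv (f n) (\<lambda>y. c n + g n y)"
    and f: "loc_L1_tendsto f f0 F" and g: "loc_L1_tendsto g g0 F"
  shows "\<exists>c0. (c \<longlongrightarrow> c0) F"
proof -
  let ?\<phi> = "\<lambda>n y. f n y - prim (g n) y"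
  have t: "loc_L1_tendsto ?\<phi> (\<lambda>y. f0 y - prim g0 y) F"
    by (intro loc_L1_tendsto_diff f loc_L1_tendsto_prim g)
  have "\<forall>\<^sub>F n in F. integral {1..2} (?\<phi> n) - integral {0..1} (?\<phi> n) = c n"
    using w loc_L1_tendstoD(2)[OF g]
  proof eventually_elim
    case (elim n)
    have lc: "loc_int (\<lambda>y. c n)" by (intro loc_int_continuous) auto
    obtain K where K: "f n \<doteq> (\<lambda>y. K + prim (\<lambda>y. c n + g n y) y)"
      using elim(1) by (auto simp: has_weak_deriv_iff)
    have pc: "prim (\<lambda>y. c n) y = of_real y * c n" for y
      by (auto simp: prim_def scaleR_conv_of_real)
    have "?\<phi> n \<doteq> (\<lambda>y. K + of_real y * c n)"
      using K by eventually_elim (simp add: prim_add[OF lc elim(2)] pc)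
    note e = integral_ae_cong[OF this]
    have i: "integral {a..b} (\<lambda>y. K + of_real y * c n) = of_real (b - a) * K + of_real ((b\<^sup>2 - a\<^sup>2) / 2) * c n"
      if "a \<le> b" for a b
    proof (rule integral_unique, rule has_integral_eq_rhs, rule fundamental_theorem_of_calculus[OF that])
      show "((\<lambda>y. of_real y * K + of_real (y\<^sup>2 / 2) * c n) has_vector_derivative K + of_real y * c n) (at y within {a..b})" for y
      proof -
        have 1: "((\<lambda>y. y) has_field_derivative 1) (at y within {a..b})"
          and 2: "((\<lambda>y. y\<^sup>2 / 2) has_field_derivative y) (at y within {a..b})"
          by (auto intro!: derivative_eq_intros)
        show ?thesis
          using has_vector_derivative_add[OF
              has_vector_derivative_mult_left[OF has_vector_derivative_of_real[OF 1], of K]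
              has_vector_derivative_mult_left[OF has_vector_derivative_of_real[OF 2], of "c n"]]
          by simp
      qed
    qed (simp add: algebra_simps diff_divide_distrib)
    show ?case unfolding e by (simp add: i algebra_simps)
  qed
  moreover have "((\<lambda>n. integral {1..2} (?\<phi> n) - integral {0..1} (?\<phi> n)) \<longlongrightarrow>
     integral {1..2} (\<lambda>y. f0 y - prim g0 y) - integral {0..1} (\<lambda>y. f0 y - prim g0 y)) F"
    by (intro tendsto_diff loc_L1_tendsto_integral t)
  ultimately show ?thesis using Lim_transform_eventually by blast
qed

section \<open>The linearized system without boundary conditions\<close>

text \<open>The linearized Saint-Venant system with general coefficients on the whole line, without any
periodicity: Bloch waves \<open>e\<^bsup>ily\<^esup> U\<close> for all \<open>l\<close> are handled by one operator.\<close>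

locale weak_system =
  fixes d \<kappa> \<sigma> \<omega> :: complex and gh gq sh sq :: "real \<Rightarrow> complex"
  assumes d_nz: "d \<noteq> 0"
    and cont_gh: "continuous_on UNIV gh" and cont_gq: "continuous_on UNIV gq"
    and cont_sh: "continuous_on UNIV sh" and cont_sq: "continuous_on UNIV sq"
begin

definition mass_flux :: "vfun \<Rightarrow> real \<Rightarrow> complex" where
  "mass_flux u y = \<sigma> * fst (u y) - snd (u y)"

definition momentum_flux :: "vfun \<Rightarrow> (real \<Rightarrow> complex) \<Rightarrow> real \<Rightarrow> complex" where
  "momentum_flux u q' y = d * q' y - \<kappa> * (gh y * fst (u y) + gq y * snd (u y)) - \<omega> * snd (u y)"

definition momentum_source :: "vfun \<Rightarrow> vfun \<Rightarrow> real \<Rightarrow> complex" where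
  "momentum_source u f y = snd (f y) - sh y * fst (u y) - sq y * snd (u y)"

lemmas system_defs = mass_flux_def momentum_flux_def momentum_source_def

text \<open>The equation \<open>A u = f\<close> in integrated form. Both equations are in divergence form, so each says that a
flux has a weak derivative; \<open>q'\<close> is the weak derivative of the second component.\<close>

definition solves :: "vfun \<Rightarrow> vfun \<Rightarrow> bool" where
  "solves u f \<longleftrightarrow> (\<exists>q'. has_weak_deriv (mass_flux u) (\<lambda>y. fst (f y) / \<kappa>) \<and>
     has_weak_deriv (\<lambda>y. snd (u y)) q' \<and> has_weak_deriv (momentum_flux u q') (momentum_source u f))"

lemma solvesI:
  assumes "has_weak_deriv (mass_flux u) (\<lambda>y. fst (f y) / \<kappa>)" "has_weak_deriv (\<lambda>y. snd (u y)) q'"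
    and "has_weak_deriv (momentum_flux u q') (momentum_source u f)"
  shows "solves u f"
  using assms unfolding solves_def by blast

lemma solvesE:
  assumes "solves u f"
  obtains q' where "has_weak_deriv (mass_flux u) (\<lambda>y. fst (f y) / \<kappa>)" "has_weak_deriv (\<lambda>y. snd (u y)) q'"
    "has_weak_deriv (momentum_flux u q') (momentum_source u f)"
  using assms unfolding solves_def by blast

lemma solves_add:
  assumes "solves u f" "solves v g"
  shows "solves (\<lambda>y. u y + v y) (\<lambda>y. f y + g y)"
proof -
  obtain p' where u: "has_weak_deriv (mass_flux u) (\<lambda>y. fst (f y) / \<kappa>)" "has_weak_deriv (\<lambda>y. snd (u y)) p'"
    "has_weak_deriv (momentum_flux u p') (momentum_source u f)" by (rule solvesE[OF assms(1)])
  obtain q' where v: "has_weak_deriv (mass_flux v) (\<lambda>y. fst (g y) / \<kappa>)" "has_weak_deriv (\<lambda>y. snd (v y)) q'"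
    "has_weak_deriv (momentum_flux v q') (momentum_source v g)" by (rule solvesE[OF assms(2)])
  show ?thesis
    by (rule solvesI[where q' = "\<lambda>y. p' y + q' y", OF has_weak_deriv_cong[OF has_weak_deriv_add[OF u(1) v(1)]]
          has_weak_deriv_cong[OF has_weak_deriv_add[OF u(2) v(2)]] has_weak_deriv_cong[OF has_weak_deriv_add[OF u(3) v(3)]]])
      (simp_all add: system_defs add_divide_distrib algebra_simps)
qed

lemma solves_cmul:
  assumes "solves u f"
  shows "solves (\<lambda>y. a \<odot> u y) (\<lambda>y. a \<odot> f y)"
proof -
  obtain p' where u: "has_weak_deriv (mass_flux u) (\<lambda>y. fst (f y) / \<kappa>)" "has_weak_deriv (\<lambda>y. snd (u y)) p'"
    "has_weak_deriv (momentum_flux u p') (momentum_source u f)" by (rule solvesE[OF assms(1)])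
  show ?thesis
    by (rule solvesI[where q' = "\<lambda>y. a * p' y", OF has_weak_deriv_cong[OF has_weak_deriv_cmult[OF u(1), of a]]
          has_weak_deriv_cong[OF has_weak_deriv_cmult[OF u(2), of a]] has_weak_deriv_cong[OF has_weak_deriv_cmult[OF u(3), of a]]])
      (simp_all add: system_defs cmul_def algebra_simps)
qed

lemma solves_diff:
  assumes "solves u f" "solves v g"
  shows "solves (\<lambda>y. u y - v y) (\<lambda>y. f y - g y)"
proof -
  have "- 1 \<odot> w = - w" for w by (simp add: cmul_def prod_eq_iff)
  then show ?thesis using solves_add[OF assms(1) solves_cmul[OF assms(2), of "-1"]] by simp
qed

lemma solves_cong:
  assumes "solves u f" "u \<doteq> v" "f \<doteq> g"
  shows "solves v g"
proof -
  obtain p' where u: "has_weak_deriv (mass_flux u) (\<lambda>y. fst (f y) / \<kappa>)" "has_weak_deriv (\<lambda>y. snd (u y)) p'"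
    "has_weak_deriv (momentum_flux u p') (momentum_source u f)" by (rule solvesE[OF assms(1)])
  have ae: "mass_flux u \<doteq> mass_flux v" "(\<lambda>y. fst (f y) / \<kappa>) \<doteq> (\<lambda>y. fst (g y) / \<kappa>)" "(\<lambda>y. snd (u y)) \<doteq> (\<lambda>y. snd (v y))"
    "momentum_flux u p' \<doteq> momentum_flux v p'" "momentum_source u f \<doteq> momentum_source v g"
    using assms(2,3) by (eventually_elim, simp add: system_defs)+
  show ?thesis
    by (rule solvesI[OF has_weak_deriv_cong[OF u(1) ae(1,2)] has_weak_deriv_cong[OF u(2) ae(3)] has_weak_deriv_cong[OF u(3) ae(4,5)]]) simp
qed

text \<open>The operator is closed. The derivative of the second component is not assumed to converge; the
integrated momentum equation expresses it by convergent terms up to a constant, and the constant converges by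
\<open>has_weak_deriv_limit_slope\<close>.\<close>

lemma solves_limit:
  assumes s: "\<forall>\<^sub>F n in F. solves (u n) (f n)" and F: "F \<noteq> bot"
    and u1: "loc_L1_tendsto (\<lambda>n y. fst (u n y)) (\<lambda>y. fst (u0 y)) F"
    and u2: "loc_L1_tendsto (\<lambda>n y. snd (u n y)) (\<lambda>y. snd (u0 y)) F"
    and f1: "loc_L1_tendsto (\<lambda>n y. fst (f n y)) (\<lambda>y. fst (f0 y)) F"
    and f2: "loc_L1_tendsto (\<lambda>n y. snd (f n y)) (\<lambda>y. snd (f0 y)) F"
  shows "solves u0 f0"
proof -
  define b where "b v y = \<kappa> * (gh y * fst (v y) + gq y * snd (v y)) + \<omega> * snd (v y)" for v :: vfun and y
  have flux: "momentum_flux v q' y = d * q' y - b v y" for v q' y by (simp add: b_def momentum_flux_def diff_diff_eq)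
  let ?s = momentum_source
  note lims = loc_L1_tendsto_add loc_L1_tendsto_diff loc_L1_tendsto_cmult
    loc_L1_tendsto_mult[OF _ cont_gh] loc_L1_tendsto_mult[OF _ cont_gq]
    loc_L1_tendsto_mult[OF _ cont_sh] loc_L1_tendsto_mult[OF _ cont_sq] u1 u2 f1 f2
  have b_lim: "loc_L1_tendsto (\<lambda>n. b (u n)) (b u0) F"
    unfolding b_def by (intro lims)
  have s_lim: "loc_L1_tendsto (\<lambda>n. ?s (u n) (f n)) (?s u0 f0) F"
    unfolding momentum_source_def[abs_def] by (intro lims)
  define g where "g v h y = inverse d * (prim (?s v h) y + b v y)" for v h :: vfun and y
  have g_lim: "loc_L1_tendsto (\<lambda>n. g (u n) (f n)) (g u0 f0) F"
    unfolding g_def by (intro lims loc_L1_tendsto_prim s_lim b_lim)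
  obtain q' where q': "\<forall>\<^sub>F n in F. has_weak_deriv (mass_flux (u n)) (\<lambda>y. fst (f n y) / \<kappa>) \<and>
     has_weak_deriv (\<lambda>y. snd (u n y)) (q' n) \<and> has_weak_deriv (momentum_flux (u n) (q' n)) (?s (u n) (f n))"
    using s unfolding solves_def eventually_ex by blast
  then have "\<forall>\<^sub>F n in F. \<exists>K. q' n \<doteq> (\<lambda>y. K + g (u n) (f n) y)"
  proof eventually_elim
    case (elim n)
    then obtain K where "momentum_flux (u n) (q' n) \<doteq> (\<lambda>y. K + prim (?s (u n) (f n)) y)"
      by (auto simp: has_weak_deriv_iff)
    then have "q' n \<doteq> (\<lambda>y. inverse d * K + g (u n) (f n) y)"
    proof eventually_elim
      case (elim y)
      then have "d * q' n y = K + prim (?s (u n) (f n)) y + b (u n) y" by (simp add: flux algebra_simps)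
      then have "q' n y = inverse d * (K + prim (?s (u n) (f n)) y + b (u n) y)"
        using d_nz by (simp add: field_simps)
      then show ?case by (simp add: g_def algebra_simps)
    qed
    then show ?case by blast
  qed
  then obtain K where K: "\<forall>\<^sub>F n in F. q' n \<doteq> (\<lambda>y. K n + g (u n) (f n) y)"
    unfolding eventually_ex by blast
  have "\<forall>\<^sub>F n in F. has_weak_deriv (\<lambda>y. snd (u n y)) (\<lambda>y. K n + g (u n) (f n) y)"
    using K q' by eventually_elim (auto intro: has_weak_deriv_cong)
  from has_weak_deriv_limit_slope[OF this u2 g_lim] obtain K0 where K0: "(K \<longlongrightarrow> K0) F" by blast
  have q'_lim: "loc_L1_tendsto q' (\<lambda>y. K0 + g u0 f0 y) F"
    by (rule loc_L1_tendsto_cong[OF loc_L1_tendsto_add[OF loc_L1_tendsto_const[OF K0] g_lim]])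
       (use K in \<open>auto elim!: eventually_mono intro: ae_eq_sym\<close>)
  have mass: "loc_L1_tendsto (\<lambda>n. mass_flux (u n)) (mass_flux u0) F"
    unfolding mass_flux_def[abs_def] by (intro lims)
  have force: "loc_L1_tendsto (\<lambda>n y. fst (f n y) / \<kappa>) (\<lambda>y. fst (f0 y) / \<kappa>) F"
    using loc_L1_tendsto_cmult[OF f1, of "inverse \<kappa>"] by (simp add: divide_inverse mult.commute)
  have momentum: "loc_L1_tendsto (\<lambda>n. momentum_flux (u n) (q' n)) (momentum_flux u0 (\<lambda>y. K0 + g u0 f0 y)) F"
    unfolding flux[abs_def] by (intro lims q'_lim b_lim)
  show ?thesis
    by (rule solvesI[OF has_weak_deriv_limit[OF _ mass force F] has_weak_deriv_limit[OF _ u2 q'_lim F]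
          has_weak_deriv_limit[OF _ momentum s_lim F]])
       (use q' in \<open>auto elim: eventually_mono\<close>)
qed

end

section \<open>Periodic square integrable functions\<close>

lemma L2perD:
  assumes "f \<in> L2per"
  shows "f (y + 1) = f y" "f \<in> borel_measurable lebesgue" "(\<lambda>y. (norm (f y))\<^sup>2) integrable_on {0..1}"
  using assms by (auto simp: L2per_def absolutely_integrable_on_def)

lemma L2perI:
  fixes f :: "real \<Rightarrow> 'a::euclidean_space"
  assumes per: "\<And>y. f (y + 1) = f y" and meas: "f \<in> borel_measurable lebesgue"
    and g: "g integrable_on {0..1}" "\<And>y. y \<in> {0..1} \<Longrightarrow> (norm (f y))\<^sup>2 \<le> g y"
  shows "f \<in> L2per"
proof -
  have "(\<lambda>y. (norm (f y))\<^sup>2) absolutely_integrable_on {0..1}"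
  proof (rule measurable_bounded_by_integrable_imp_absolutely_integrable[OF _ _ g(1)])
    have "(\<lambda>y. (norm (f y))\<^sup>2) \<in> borel_measurable lebesgue"
      using meas by measurable
    then show "(\<lambda>y. (norm (f y))\<^sup>2) \<in> borel_measurable (lebesgue_on {0..1})"
      by (rule measurable_restrict_space1)
  qed (use g in auto)
  then show ?thesis using per meas by (auto simp: L2per_def)
qed

lemma continuous_periodic_L2per:
  fixes f :: "real \<Rightarrow> 'a::euclidean_space"
  assumes "continuous_on UNIV f" "\<And>y. f (y + 1) = f y"
  shows "f \<in> L2per"
proof (rule L2perI)
  show "f (y + 1) = f y" for y by (rule assms(2))
  show "f \<in> borel_measurable lebesgue"
    using borel_measurable_continuous_onI[OF assms(1)] by (simp add: measurable_completion)
  show "(\<lambda>y. (norm (f y))\<^sup>2) integrable_on {0..1}"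
    by (intro integrable_continuous_real continuous_intros continuous_on_subset[OF assms(1)]) auto
qed auto

lemma L2per_bounded_image:
  fixes f :: "real \<Rightarrow> 'a::euclidean_space" and g :: "real \<Rightarrow> 'b::euclidean_space"
  assumes f: "f \<in> L2per" and per: "\<And>y. g (y + 1) = g y" and meas: "g \<in> borel_measurable lebesgue"
    and le: "\<And>y. y \<in> {0..1} \<Longrightarrow> norm (g y) \<le> B * norm (f y)"
  shows "g \<in> L2per"
proof (rule L2perI[OF per meas])
  show "(\<lambda>y. B\<^sup>2 * (norm (f y))\<^sup>2) integrable_on {0..1}"
    by (intro integrable_on_mult_right L2perD[OF f])
  show "(norm (g y))\<^sup>2 \<le> B\<^sup>2 * (norm (f y))\<^sup>2" if "y \<in> {0..1}" for y
    using power_mono[OF le[OF that], of 2] by (simp add: power_mult_distrib)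
qed

lemma norm_cmul [simp]: "norm (a \<odot> u) = norm a * norm u"
  by (simp add: cmul_def norm_prod_def norm_mult power_mult_distrib flip: distrib_left)
     (simp add: real_sqrt_mult)

lemma cmul_add_right: "a \<odot> (u + v) = a \<odot> u + a \<odot> v"
  and cmul_diff_right: "a \<odot> (u - v) = a \<odot> u - a \<odot> v"
  and cmul_add_left: "(a + b) \<odot> u = a \<odot> u + b \<odot> u"
  and cmul_diff_left: "(a - b) \<odot> u = a \<odot> u - b \<odot> u"
  and cmul_cmul: "a \<odot> b \<odot> u = (a * b) \<odot> u"
  and cmul_one [simp]: "1 \<odot> u = u"
  and cmul_zero_left [simp]: "0 \<odot> u = 0"
  and cmul_zero_right [simp]: "a \<odot> 0 = 0"
  and scaleR_cmul: "r *\<^sub>R u = of_real r \<odot> u"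
  by (auto simp: cmul_def prod_eq_iff algebra_simps scaleR_conv_of_real)

lemma fst_cmul [simp]: "fst (a \<odot> u) = a * fst u" and snd_cmul [simp]: "snd (a \<odot> u) = a * snd u"
  by (auto simp: cmul_def)

lemma norm_fst_le_norm: "norm (fst u) \<le> norm u" and norm_snd_le_norm: "norm (snd u) \<le> norm u"
  for u :: "complex \<times> complex"
  by (simp_all add: norm_prod_def)

lemma borel_measurable_vfun_iff:
  fixes f :: vfun
  shows "f \<in> borel_measurable M \<longleftrightarrow>
    (\<lambda>y. fst (f y)) \<in> borel_measurable M \<and> (\<lambda>y. snd (f y)) \<in> borel_measurable M"
proof
  assume "f \<in> borel_measurable M"
  then show "(\<lambda>y. fst (f y)) \<in> borel_measurable M \<and> (\<lambda>y. snd (f y)) \<in> borel_measurable M"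
    using borel_measurable_continuous_on[OF continuous_on_fst[OF continuous_on_id], of f M]
      borel_measurable_continuous_on[OF continuous_on_snd[OF continuous_on_id], of f M] by simp
next
  assume "(\<lambda>y. fst (f y)) \<in> borel_measurable M \<and> (\<lambda>y. snd (f y)) \<in> borel_measurable M"
  then have "(\<lambda>y. (fst (f y), snd (f y))) \<in> borel_measurable M"
    by (intro borel_measurable_Pair) blast+
  then show "f \<in> borel_measurable M" by simp
qed

lemma L2per_vfun_iff:
  fixes f :: vfun
  shows "f \<in> L2per \<longleftrightarrow> (\<lambda>y. fst (f y)) \<in> L2per \<and> (\<lambda>y. snd (f y)) \<in> L2per"
proof
  assume f: "f \<in> L2per"
  note D = L2perD(1)[OF f] L2perD(2)[OF f, unfolded borel_measurable_vfun_iff]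
  show "(\<lambda>y. fst (f y)) \<in> L2per \<and> (\<lambda>y. snd (f y)) \<in> L2per"
    using D by (auto intro!: L2per_bounded_image[OF f, where B=1] simp: norm_fst_le_norm norm_snd_le_norm)
next
  assume *: "(\<lambda>y. fst (f y)) \<in> L2per \<and> (\<lambda>y. snd (f y)) \<in> L2per"
  then have f1: "(\<lambda>y. fst (f y)) \<in> L2per" and f2: "(\<lambda>y. snd (f y)) \<in> L2per" by auto
  show "f \<in> L2per"
  proof (rule L2perI)
    show "f (y + 1) = f y" for y using L2perD(1)[OF f1] L2perD(1)[OF f2] by (simp add: prod_eq_iff)
    show "f \<in> borel_measurable lebesgue"
      unfolding borel_measurable_vfun_iff using L2perD(2)[OF f1] L2perD(2)[OF f2] by blast
    show "(\<lambda>y. (norm (fst (f y)))\<^sup>2 + (norm (snd (f y)))\<^sup>2) integrable_on {0..1}"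
      by (intro integrable_add L2perD f1 f2)
  qed (simp add: norm_prod_def)
qed

lemma L2per_add:
  fixes f g :: "real \<Rightarrow> 'a::euclidean_space"
  assumes f: "f \<in> L2per" and g: "g \<in> L2per"
  shows "(\<lambda>y. f y + g y) \<in> L2per"
proof (rule L2perI)
  show "f (y + 1) + g (y + 1) = f y + g y" for y using L2perD(1)[OF f] L2perD(1)[OF g] by simp
  show "(\<lambda>y. f y + g y) \<in> borel_measurable lebesgue"
    using L2perD(2)[OF f] L2perD(2)[OF g] by simp
  show "(\<lambda>y. 2 * (norm (f y))\<^sup>2 + 2 * (norm (g y))\<^sup>2) integrable_on {0..1}"
    by (intro integrable_add integrable_on_mult_right L2perD f g)
  show "(norm (f y + g y))\<^sup>2 \<le> 2 * (norm (f y))\<^sup>2 + 2 * (norm (g y))\<^sup>2" for y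
  proof -
    have "(norm (f y + g y))\<^sup>2 \<le> (norm (f y) + norm (g y))\<^sup>2"
      by (intro power_mono norm_triangle_ineq) auto
    also have "\<dots> \<le> 2 * (norm (f y))\<^sup>2 + 2 * (norm (g y))\<^sup>2"
      using sum_squares_bound[of "norm (f y)" "norm (g y)"] by (simp add: power2_sum)
    finally show ?thesis .
  qed
qed

lemma L2per_mult:
  fixes f a :: "real \<Rightarrow> complex"
  assumes f: "f \<in> L2per" and a: "continuous_on UNIV a" "\<And>y. a (y + 1) = a y"
  shows "(\<lambda>y. a y * f y) \<in> L2per"
proof -
  have "compact (a ` {0..1})"
    by (intro compact_continuous_image continuous_on_subset[OF a(1)]) auto
  then obtain L where L: "\<And>y. y \<in> {0..1} \<Longrightarrow> norm (a y) \<le> L"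
    using compact_imp_bounded[of "a ` {0..1}"] unfolding bounded_iff by blast
  show ?thesis
  proof (rule L2per_bounded_image[OF f])
    show "(\<lambda>y. a y * f y) \<in> borel_measurable lebesgue"
      using L2perD(2)[OF f] borel_measurable_continuous_onI[OF a(1)]
      by (intro borel_measurable_times) (auto simp: measurable_completion)
    show "norm (a y * f y) \<le> L * norm (f y)" if "y \<in> {0..1}" for y
      using L[OF that] by (simp add: norm_mult mult_right_mono)
  qed (use a L2perD(1)[OF f] in auto)
qed

lemma L2per_cmult: "f \<in> L2per \<Longrightarrow> (\<lambda>y. a * f y) \<in> L2per" for a :: complex
  by (rule L2per_mult) auto

lemma L2per_cmul: "f \<in> L2per \<Longrightarrow> (\<lambda>y. a \<odot> f y) \<in> L2per"
  by (subst L2per_vfun_iff) (auto simp: L2per_vfun_iff[of f] intro: L2per_cmult)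

lemma L2per_minus: 
  fixes f :: "real \<Rightarrow> 'a::euclidean_space"
  assumes "f \<in> L2per" shows "(\<lambda>y. - f y) \<in> L2per"
  using L2perD[OF assms] by (intro L2per_bounded_image[OF assms, where B=1]) auto

lemma L2per_diff:
  fixes f g :: "real \<Rightarrow> 'a::euclidean_space"
  assumes f: "f \<in> L2per" and g: "g \<in> L2per"
  shows "(\<lambda>y. f y - g y) \<in> L2per"
  using L2per_add[OF f L2per_minus[OF g]] by simp

lemma L2per_scaleR: "f \<in> L2per \<Longrightarrow> (\<lambda>y. r *\<^sub>R f y) \<in> L2per" for f :: vfun
  by (simp add: scaleR_cmul L2per_cmul)

lemma L2per_zero [simp]: "(\<lambda>y. 0) \<in> L2per"
  by (rule continuous_periodic_L2per) auto

lemma L2per_sum: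
  assumes "\<And>i. i \<in> I \<Longrightarrow> f i \<in> L2per"
  shows "(\<lambda>y. \<Sum>i\<in>I. f i y) \<in> L2per"
  using assms by (induction I rule: infinite_finite_induct) (auto intro: L2per_add)

lemma L2norm_sq:
  assumes "f \<in> L2per"
  shows "(L2norm f)\<^sup>2 = integral {0..1} (\<lambda>y. (norm (f y))\<^sup>2)"
  unfolding L2norm_def by (intro real_sqrt_pow2 integral_nonneg L2perD assms) auto

lemma L2norm_nonneg [simp]: "0 \<le> L2norm f"
proof (cases "(\<lambda>y. (norm (f y))\<^sup>2) integrable_on {0..1}")
  case True
  then show ?thesis unfolding L2norm_def by (intro real_sqrt_ge_zero integral_nonneg) auto
next
  case False
  then show ?thesis by (simp add: L2norm_def not_integrable_integral)
qed

lemma L2norm_cong: "f \<doteq> g \<Longrightarrow> L2norm f = L2norm g"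
  unfolding L2norm_def by (subst integral_ae_cong[of _ "\<lambda>y. (norm (g y))\<^sup>2"]) (auto elim: eventually_mono)

lemma L2norm_zero [simp]: "L2norm (\<lambda>y. 0) = 0"
  by (simp add: L2norm_def)

lemma L2norm_cmul: "L2norm (\<lambda>y. a \<odot> f y) = norm a * L2norm f"
  by (simp add: L2norm_def power_mult_distrib real_sqrt_mult)

lemma L2norm_scaleR: "L2norm (\<lambda>y. r *\<^sub>R f y) = \<bar>r\<bar> * L2norm f"
  by (simp add: L2norm_def power_mult_distrib real_sqrt_mult)

text \<open>Young's inequality with the weight \<open>B / A\<close>, which is optimal when \<open>A\<close> and \<open>B\<close> are the two norms. Adding
\<open>e / 2\<close> to the norms keeps the weight defined when a norm vanishes.\<close>

lemma L2norm_triangle: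
  assumes f: "f \<in> L2per" and g: "g \<in> L2per"
  shows "L2norm (\<lambda>y. f y + g y) \<le> L2norm f + L2norm g"
proof (rule field_le_epsilon)
  fix e :: real assume "e > 0"
  define A where "A = L2norm f + e / 2"
  define B where "B = L2norm g + e / 2"
  have AB: "A > 0" "B > 0" "L2norm f \<le> A" "L2norm g \<le> B"
    using \<open>e > 0\<close> by (auto simp: A_def B_def intro: add_nonneg_pos)
  have pt: "(norm (f y + g y))\<^sup>2 \<le> (1 + B / A) * (norm (f y))\<^sup>2 + (1 + A / B) * (norm (g y))\<^sup>2" for y
  proof -
    have "(norm (f y + g y))\<^sup>2 \<le> (norm (f y) + norm (g y))\<^sup>2"
      by (intro power_mono norm_triangle_ineq) auto
    also have "\<dots> = (norm (f y))\<^sup>2 + (norm (g y))\<^sup>2 + 2 * norm (f y) * norm (g y)"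
      by (simp add: power2_sum)
    also have "2 * norm (f y) * norm (g y) \<le> B / A * (norm (f y))\<^sup>2 + A / B * (norm (g y))\<^sup>2"
    proof -
      have "0 \<le> (B * norm (f y) - A * norm (g y))\<^sup>2 / (A * B)" using AB by simp
      also have "\<dots> = B / A * (norm (f y))\<^sup>2 + A / B * (norm (g y))\<^sup>2 - 2 * norm (f y) * norm (g y)"
        using AB by (simp add: field_simps power2_eq_square)
      finally show ?thesis by simp
    qed
    finally show ?thesis by (simp add: algebra_simps)
  qed
  have "(L2norm (\<lambda>y. f y + g y))\<^sup>2 = integral {0..1} (\<lambda>y. (norm (f y + g y))\<^sup>2)"
    by (rule L2norm_sq[OF L2per_add[OF f g]])
  also have "\<dots> \<le> integral {0..1} (\<lambda>y. (1 + B / A) * (norm (f y))\<^sup>2 + (1 + A / B) * (norm (g y))\<^sup>2)"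
    by (intro integral_le pt integrable_add integrable_on_mult_right L2perD f g L2per_add)
  also have "\<dots> = (1 + B / A) * (L2norm f)\<^sup>2 + (1 + A / B) * (L2norm g)\<^sup>2"
    unfolding L2norm_sq[OF f] L2norm_sq[OF g]
    by (subst integral_add) (auto intro!: integrable_on_mult_right L2perD f g)
  also have "\<dots> \<le> (1 + B / A) * A\<^sup>2 + (1 + A / B) * B\<^sup>2"
    using AB by (intro add_mono mult_left_mono power_mono) auto
  also have "\<dots> = (A + B)\<^sup>2"
    using AB by (simp add: field_simps power2_eq_square)
  finally have "L2norm (\<lambda>y. f y + g y) \<le> A + B"
    by (rule power2_le_imp_le) (use AB in auto)
  then show "L2norm (\<lambda>y. f y + g y) \<le> L2norm f + L2norm g + e" by (simp add: A_def B_def)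
qed

lemma L2norm_minus: "L2norm (\<lambda>y. - f y) = L2norm f"
  by (simp add: L2norm_def)

lemma L2norm_triangle_diff:
  assumes f: "f \<in> L2per" and g: "g \<in> L2per"
  shows "L2norm (\<lambda>y. f y - g y) \<le> L2norm f + L2norm g"
  using L2norm_triangle[OF f L2per_minus[OF g]] by (simp add: L2norm_minus)

lemma L2norm_sum:
  assumes "\<And>i. i \<in> I \<Longrightarrow> f i \<in> L2per"
  shows "L2norm (\<lambda>y. \<Sum>i\<in>I. f i y) \<le> (\<Sum>i\<in>I. L2norm (f i))"
  using assms
proof (induction I rule: infinite_finite_induct)
  case (insert i I)
  then show ?case
    using L2norm_triangle[of "f i" "\<lambda>y. \<Sum>i\<in>I. f i y"] L2per_sum[of I f] by fastforce
qed auto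

lemma L2per_integrable:
  fixes f :: "real \<Rightarrow> 'a::euclidean_space"
  assumes f: "f \<in> L2per"
  shows "f absolutely_integrable_on {0..1}"
proof (rule measurable_bounded_by_integrable_imp_absolutely_integrable)
  show "f \<in> borel_measurable (lebesgue_on {0..1})"
    by (intro measurable_restrict_space1 L2perD f)
  show "(\<lambda>y. 1 + (norm (f y))\<^sup>2) integrable_on {0..1}"
    by (intro integrable_add L2perD f) auto
  show "norm (f y) \<le> 1 + (norm (f y))\<^sup>2" for y
    using sum_squares_bound[of 1 "norm (f y)"] norm_ge_zero[of "f y"]
    by (simp add: power2_eq_square del: norm_ge_zero)
qed auto

text \<open>Again Young's inequality, \<open>2 \<bar>f\<bar> \<le> \<bar>f\<bar>\<^sup>2 / t + t\<close>, with the optimal \<open>t\<close> perturbed by \<open>e\<close>.\<close>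

lemma L1_le_L2norm:
  fixes f :: "real \<Rightarrow> 'a::euclidean_space"
  assumes f: "f \<in> L2per"
  shows "integral {0..1} (\<lambda>y. norm (f y)) \<le> L2norm f"
proof (rule field_le_epsilon)
  fix e :: real assume "e > 0"
  define t where "t = L2norm f + e"
  have t: "t > 0" "L2norm f \<le> t" using \<open>e > 0\<close> by (auto simp: t_def intro: add_nonneg_pos)
  have i: "(\<lambda>y. norm (f y)) integrable_on {0..1}"
    using L2per_integrable[OF f] by (simp add: absolutely_integrable_on_def)
  have "integral {0..1} (\<lambda>y. norm (f y)) \<le> integral {0..1} (\<lambda>y. inverse (2 * t) * (norm (f y))\<^sup>2 + t / 2)"
  proof (intro integral_le i integrable_add integrable_on_mult_right L2perD f)
    fix y
    have "0 \<le> (norm (f y) - t)\<^sup>2 / (2 * t)" using t by simp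
    also have "\<dots> = inverse (2 * t) * (norm (f y))\<^sup>2 + t / 2 - norm (f y)"
      using t by (simp add: field_simps power2_eq_square)
    finally show "norm (f y) \<le> inverse (2 * t) * (norm (f y))\<^sup>2 + t / 2" by simp
  qed auto
  also have "\<dots> = inverse (2 * t) * (L2norm f)\<^sup>2 + t / 2"
    unfolding L2norm_sq[OF f]
    by (subst integral_add) (auto intro!: integrable_on_mult_right L2perD f)
  also have "\<dots> \<le> inverse (2 * t) * t\<^sup>2 + t / 2"
    using t by (intro add_mono mult_left_mono power_mono) auto
  also have "\<dots> = t" using t by (simp add: field_simps power2_eq_square)
  finally show "integral {0..1} (\<lambda>y. norm (f y)) \<le> L2norm f + e" by (simp add: t_def)
qed

lemma periodic_int_shift:
  fixes f :: "real \<Rightarrow> 'a"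
  assumes "\<And>y. f (y + 1) = f y"
  shows "f (y + of_int m) = f y"
proof (induction m rule: int_induct[of _ 0])
  case (step1 i)
  then show ?case using assms[of "y + of_int i"] by (simp add: add.assoc)
next
  case (step2 i)
  then show ?case using assms[of "y + of_int (i - 1)"] by (simp add: algebra_simps)
qed simp

lemma absolutely_integrable_periodic_shift:
  fixes f :: "real \<Rightarrow> 'a::euclidean_space"
  assumes per: "\<And>y. f (y + 1) = f y" and f: "f absolutely_integrable_on {0..1}"
  shows "f absolutely_integrable_on {of_int m..of_int m + 1}"
    and "integral {of_int m..of_int m + 1} f = integral {0..1} f"
proof -
  let ?m = "of_int m :: real"
  have sh: "(g has_integral I) {?m..?m + 1}" if "(g has_integral I) {0..1}" "\<And>y. g (y + 1) = g y"
    for g :: "real \<Rightarrow> 'b::euclidean_space" and I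
  proof -
    have "((\<lambda>y. g (1 *\<^sub>R y + (- ?m))) has_integral (1 / \<bar>1\<bar> ^ DIM(real)) *\<^sub>R I) ((\<lambda>y. (1 / 1) *\<^sub>R y + - ((1 / 1) *\<^sub>R (- ?m))) ` cbox 0 1)"
      by (rule has_integral_affinity) (use that in auto)
    moreover have "g (y - ?m) = g y" for y
      using periodic_int_shift[of g "y - ?m" m] that(2) by simp
    moreover have "(\<lambda>y. y + ?m) ` {0..1} = {?m..?m+1}"
      by (simp add: image_add_atLeastAtMost' add.commute)
    ultimately show ?thesis by (simp add: add.commute)
  qed
  have "(f has_integral integral {0..1} f) {0..1}"
    using f by (simp add: absolutely_integrable_on_def integrable_integral)
  from sh[OF this per] show "integral {of_int m..of_int m + 1} f = integral {0..1} f"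
    and i: "f absolutely_integrable_on {of_int m..of_int m + 1}"
  proof -
    assume a: "(f has_integral integral {0..1} f) {?m..?m + 1}"
    show "integral {of_int m..of_int m + 1} f = integral {0..1} f" using a by (rule integral_unique)
    have "((\<lambda>y. norm (f y)) has_integral integral {0..1} (\<lambda>y. norm (f y))) {0..1}"
      using f by (simp add: absolutely_integrable_on_def integrable_integral)
    from sh[OF this] per have "(\<lambda>y. norm (f y)) integrable_on {?m..?m+1}" by auto
    with a show "f absolutely_integrable_on {of_int m..of_int m + 1}"
      by (auto simp: absolutely_integrable_on_def)
  qed
qed

lemma periodic_integral_bound:
  fixes f :: "real \<Rightarrow> 'a::euclidean_space"
  assumes per: "\<And>y. f (y + 1) = f y" and f: "f absolutely_integrable_on {0..1}"
  shows "f absolutely_integrable_on {- real N..real N}"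
    and "integral {- real N..real N} (\<lambda>y. norm (f y)) = 2 * real N * integral {0..1} (\<lambda>y. norm (f y))"
proof -
  have n: "(\<lambda>y. norm (f y)) absolutely_integrable_on {0..1}"
    using absolutely_integrable_norm[OF f] by (simp add: o_def)
  have pn: "\<And>y. norm (f (y + 1)) = norm (f y)" using per by simp
  have sh1: "f absolutely_integrable_on {real N..real N + 1}" "f absolutely_integrable_on {- real N - 1..- real N}" for N
    using absolutely_integrable_periodic_shift(1)[OF per f, of "int N"]
      absolutely_integrable_periodic_shift(1)[OF per f, of "- int N - 1"] by simp_all
  have sh2: "integral {real N..real N + 1} (\<lambda>y. norm (f y)) = integral {0..1} (\<lambda>y. norm (f y))"
    "integral {- real N - 1..- real N} (\<lambda>y. norm (f y)) = integral {0..1} (\<lambda>y. norm (f y))" for N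
    using absolutely_integrable_periodic_shift(2)[of "\<lambda>y. norm (f y)", OF pn n, of "int N"]
      absolutely_integrable_periodic_shift(2)[of "\<lambda>y. norm (f y)", OF pn n, of "- int N - 1"] by simp_all
  have "f absolutely_integrable_on {- real N..real N} \<and>
    integral {- real N..real N} (\<lambda>y. norm (f y)) = 2 * real N * integral {0..1} (\<lambda>y. norm (f y))"
  proof (induction N)
    case (Suc N)
    have 1: "f absolutely_integrable_on {- real N - 1..real N}"
      by (rule absolutely_integrable_on_combine[where c="- real N"]) (use Suc sh1 in auto)
    have 2: "f absolutely_integrable_on {- real N - 1..real N + 1}"
      by (rule absolutely_integrable_on_combine[where c="real N"]) (use 1 sh1 in auto)
    note c = Henstock_Kurzweil_Integration.integral_combine
    have i1: "(\<lambda>y. norm (f y)) integrable_on {- real N - 1..real N}"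
      and i2: "(\<lambda>y. norm (f y)) integrable_on {- real N - 1..real N + 1}"
      using 1 2 by (auto simp: absolutely_integrable_on_def)
    have "integral {- real N - 1..real N + 1} (\<lambda>y. norm (f y)) =
      integral {- real N - 1..- real N} (\<lambda>y. norm (f y)) + integral {- real N..real N} (\<lambda>y. norm (f y))
       + integral {real N..real N + 1} (\<lambda>y. norm (f y))"
      using c[of "- real N - 1" "- real N" "real N", OF _ _ i1]
        c[of "- real N - 1" "real N" "real N + 1", OF _ _ i2] by simp
    moreover have "- real (Suc N) = - real N - 1" "real (Suc N) = real N + 1" by simp_all
    ultimately show ?case using 2 Suc sh2 by (simp only:) (simp add: algebra_simps)
  qed (auto intro: absolutely_integrable_negligible)
  then show "f absolutely_integrable_on {- real N..real N}"
    and "integral {- real N..real N} (\<lambda>y. norm (f y)) = 2 * real N * integral {0..1} (\<lambda>y. norm (f y))"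
    by auto
qed

lemma interval_subset_symmetric: "\<exists>N. {a..b} \<subseteq> {- real N..real N}"
proof -
  obtain N :: nat where "max \<bar>a\<bar> \<bar>b\<bar> < real N" using reals_Archimedean2 by blast
  then show ?thesis by (intro exI[of _ N]) auto
qed

lemma L2per_loc_int:
  fixes f :: "real \<Rightarrow> 'a::euclidean_space"
  assumes f: "f \<in> L2per" shows "loc_int f"
  unfolding loc_int_def
proof (intro allI)
  fix a b :: real
  obtain N where "{a..b} \<subseteq> {- real N..real N}" using interval_subset_symmetric by blast
  with periodic_integral_bound(1)[OF L2perD(1)[OF f] L2per_integrable[OF f]]
  show "f absolutely_integrable_on {a..b}" by (rule absolutely_integrable_on_subinterval)
qed

lemma L2norm_eq_0_imp:
  assumes f: "f \<in> L2per" and z: "L2norm f = 0"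
  shows "f \<doteq> (\<lambda>_. 0)"
proof -
  let ?n = "\<lambda>y. norm (f y)"
  have l: "loc_int ?n" by (intro loc_int_norm L2per_loc_int f)
  have z1: "integral {0..1} ?n = 0"
    using L1_le_L2norm[OF f] z integral_nonneg[OF loc_int_integrable[OF l], of 0 1] by fastforce
  have z2: "integral {a..b} ?n = 0" for a b
  proof -
    obtain N where N: "{a..b} \<subseteq> {- real N..real N}" using interval_subset_symmetric by blast
    have "integral {a..b} ?n \<le> integral {- real N..real N} ?n"
      using N by (intro integral_subset_le loc_int_integrable l) auto
    also have "\<dots> = 0"
      using periodic_integral_bound(2)[OF L2perD(1)[OF f] L2per_integrable[OF f]] z1 by simp
    finally show ?thesis using integral_nonneg[OF loc_int_integrable[OF l], of a b] by fastforce
  qed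
  have "prim ?n y = 0" for y by (simp add: prim_def z2)
  from ae_zero_if_prim_const[OF l this] show ?thesis by (auto elim: eventually_mono)
qed

lemma L2per_limit_loc_L1:
  fixes f :: "'i \<Rightarrow> real \<Rightarrow> complex"
  assumes f: "\<forall>\<^sub>F n in F. f n \<in> L2per" and f0: "f0 \<in> L2per"
    and lim: "((\<lambda>n. L2norm (\<lambda>y. f n y - f0 y)) \<longlongrightarrow> 0) F"
  shows "loc_L1_tendsto f f0 F"
proof (rule loc_L1_tendsto_bound)
  show "loc_int f0" by (rule L2per_loc_int[OF f0])
  show "\<forall>\<^sub>F n in F. loc_int (f n)" using f by eventually_elim (rule L2per_loc_int)
  fix a b :: real
  obtain N where N: "{a..b} \<subseteq> {- real N..real N}" using interval_subset_symmetric by blast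
  have "\<forall>\<^sub>F n in F. integral {a..b} (\<lambda>y. norm (f n y - f0 y)) \<le> 2 * real N * L2norm (\<lambda>y. f n y - f0 y)"
    using f
  proof eventually_elim
    case (elim n)
    let ?d = "\<lambda>y. f n y - f0 y"
    have d: "?d \<in> L2per" by (rule L2per_diff[OF elim f0])
    have "integral {a..b} (\<lambda>y. norm (?d y)) \<le> integral {- real N..real N} (\<lambda>y. norm (?d y))"
      using N by (intro integral_subset_le loc_int_norm_integrable L2per_loc_int d) auto
    also have "\<dots> = 2 * real N * integral {0..1} (\<lambda>y. norm (?d y))"
      by (rule periodic_integral_bound(2)[OF L2perD(1)[OF d] L2per_integrable[OF d]])
    also have "\<dots> \<le> 2 * real N * L2norm ?d"
      by (intro mult_left_mono L1_le_L2norm d) auto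
    finally show ?case .
  qed
  then show "\<exists>e. (e \<longlongrightarrow> 0) F \<and> (\<forall>\<^sub>F n in F. integral {a..b} (\<lambda>y. norm (f n y - f0 y)) \<le> e n)"
    using tendsto_mult_right_zero[OF lim, of "2 * real N"] by blast
qed

lemma L2norm_component_le:
  fixes f :: vfun
  assumes "f \<in> L2per"
  shows "L2norm (\<lambda>y. fst (f y)) \<le> L2norm f" "L2norm (\<lambda>y. snd (f y)) \<le> L2norm f"
  using assms unfolding L2norm_def
  by (auto intro!: real_sqrt_le_mono integral_le L2perD power_mono simp: L2per_vfun_iff[of f] norm_fst_le_norm norm_snd_le_norm)

section \<open>Expansions in the Floquet parameter\<close>

definition scal_order :: "nat \<Rightarrow> (real \<Rightarrow> complex) \<Rightarrow> bool" where
  "scal_order n g \<longleftrightarrow> (\<exists>C. \<forall>\<^sub>F l in at 0. norm (g l) \<le> C * \<bar>l\<bar> ^ n)"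

definition L2_order :: "nat \<Rightarrow> (real \<Rightarrow> vfun) \<Rightarrow> bool" where
  "L2_order n R \<longleftrightarrow> (\<exists>C. \<forall>\<^sub>F l in at 0. R l \<in> L2per \<and> L2norm (R l) \<le> C * \<bar>l\<bar> ^ n)"

lemma scal_order_bigo: "scal_order n g \<Longrightarrow> g \<in> O[at 0](\<lambda>l. of_real (l ^ n))"
  unfolding scal_order_def
proof (elim exE)
  fix C assume "\<forall>\<^sub>F l in at 0. norm (g l) \<le> C * \<bar>l\<bar> ^ n"
  then show "g \<in> O[at 0](\<lambda>l. of_real (l ^ n))"
    by (intro bigoI[where c=C]) (simp add: norm_power)
qed

lemma L2_order_bigo: "L2_order n R \<Longrightarrow> bigo_L2 R (\<lambda>l. l ^ n)"
  unfolding L2_order_def bigo_L2_def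
proof (elim exE, intro conjI)
  fix C assume *: "\<forall>\<^sub>F l in at 0. R l \<in> L2per \<and> L2norm (R l) \<le> C * \<bar>l\<bar> ^ n"
  then show "\<forall>\<^sub>F l in at 0. R l \<in> L2per" by eventually_elim simp
  show "(\<lambda>l. L2norm (R l)) \<in> O[at 0](\<lambda>l. l ^ n)"
    by (rule bigoI[where c=C]) (use * in eventually_elim, simp add: power_abs)
qed

lemma scal_order_const: "scal_order 0 (\<lambda>_. c)"
  unfolding scal_order_def by (intro exI[of _ "norm c"]) simp

lemma scal_order_var: "scal_order 1 (\<lambda>l. of_real l)"
  unfolding scal_order_def by (intro exI[of _ 1]) simp

lemma scal_order_add:
  assumes "scal_order n f" "scal_order n g" shows "scal_order n (\<lambda>l. f l + g l)"
proof -
  obtain C D where "\<forall>\<^sub>F l in at 0. norm (f l) \<le> C * \<bar>l\<bar> ^ n" "\<forall>\<^sub>F l in at 0. norm (g l) \<le> D * \<bar>l\<bar> ^ n"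
    using assms unfolding scal_order_def by blast
  then have "\<forall>\<^sub>F l in at 0. norm (f l + g l) \<le> (C + D) * \<bar>l\<bar> ^ n"
    by eventually_elim (metis add_mono distrib_right norm_triangle_le)
  then show ?thesis unfolding scal_order_def by blast
qed

lemma scal_order_mult:
  assumes "scal_order m f" "scal_order n g" shows "scal_order (m + n) (\<lambda>l. f l * g l)"
proof -
  obtain C D where "\<forall>\<^sub>F l in at 0. norm (f l) \<le> C * \<bar>l\<bar> ^ m" "\<forall>\<^sub>F l in at 0. norm (g l) \<le> D * \<bar>l\<bar> ^ n"
    using assms unfolding scal_order_def by blast
  then have "\<forall>\<^sub>F l in at 0. norm (f l * g l) \<le> (C * D) * \<bar>l\<bar> ^ (m + n)"
  proof eventually_elim
    case (elim l)
    have "norm (f l * g l) \<le> (C * \<bar>l\<bar> ^ m) * (D * \<bar>l\<bar> ^ n)"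
      unfolding norm_mult using elim order_trans[OF norm_ge_zero elim(1)] by (intro mult_mono) auto
    then show ?case by (simp add: power_add mult_ac)
  qed
  then show ?thesis unfolding scal_order_def by blast
qed

lemma scal_order_mono: assumes "scal_order n f" "m \<le> n" shows "scal_order m f"
proof -
  obtain C where C: "\<forall>\<^sub>F l in at 0. norm (f l) \<le> C * \<bar>l\<bar> ^ n" using assms unfolding scal_order_def by blast
  have "\<forall>\<^sub>F l in at (0::real). \<bar>l\<bar> < 1"
    unfolding eventually_at by (intro exI[of _ 1]) auto
  with C have "\<forall>\<^sub>F l in at 0. norm (f l) \<le> \<bar>C\<bar> * \<bar>l\<bar> ^ m"
  proof eventually_elim
    case (elim l)
    have "C * \<bar>l\<bar> ^ n \<le> \<bar>C\<bar> * \<bar>l\<bar> ^ m"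
      using elim assms(2) by (intro mult_mono power_decreasing) auto
    with elim show ?case by simp
  qed
  then show ?thesis unfolding scal_order_def by blast
qed

lemma L2_order_add:
  assumes "L2_order n f" "L2_order n g" shows "L2_order n (\<lambda>l y. f l y + g l y)"
proof -
  obtain C D where "\<forall>\<^sub>F l in at 0. f l \<in> L2per \<and> L2norm (f l) \<le> C * \<bar>l\<bar> ^ n"
     "\<forall>\<^sub>F l in at 0. g l \<in> L2per \<and> L2norm (g l) \<le> D * \<bar>l\<bar> ^ n"
    using assms unfolding L2_order_def by blast
  then have "\<forall>\<^sub>F l in at 0. (\<lambda>y. f l y + g l y) \<in> L2per \<and> L2norm (\<lambda>y. f l y + g l y) \<le> (C + D) * \<bar>l\<bar> ^ n"
  proof eventually_elim
    case (elim l)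
    then show ?case
      using L2norm_triangle[of "f l" "g l"] by (simp add: L2per_add distrib_right)
  qed
  then show ?thesis unfolding L2_order_def by blast
qed

lemma L2_order_scal:
  assumes "scal_order m f" "L2_order n g" shows "L2_order (m + n) (\<lambda>l y. f l \<odot> g l y)"
proof -
  obtain C D where "\<forall>\<^sub>F l in at 0. norm (f l) \<le> C * \<bar>l\<bar> ^ m"
     "\<forall>\<^sub>F l in at 0. g l \<in> L2per \<and> L2norm (g l) \<le> D * \<bar>l\<bar> ^ n"
    using assms unfolding L2_order_def scal_order_def by blast
  then have "\<forall>\<^sub>F l in at 0. (\<lambda>y. f l \<odot> g l y) \<in> L2per \<and> L2norm (\<lambda>y. f l \<odot> g l y) \<le> (C * D) * \<bar>l\<bar> ^ (m + n)"
  proof eventually_elim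
    case (elim l)
    have "norm (f l) * L2norm (g l) \<le> (C * \<bar>l\<bar> ^ m) * (D * \<bar>l\<bar> ^ n)"
      using elim order_trans[OF norm_ge_zero elim(1)] by (intro mult_mono) auto
    then show ?case using elim by (simp add: L2per_cmul L2norm_cmul power_add mult_ac)
  qed
  then show ?thesis unfolding L2_order_def by blast
qed

lemma L2_order_cong:
  assumes "L2_order n f" "\<forall>\<^sub>F l in at 0. f l \<doteq> g l \<and> g l \<in> L2per"
  shows "L2_order n g"
proof -
  obtain C where "\<forall>\<^sub>F l in at 0. f l \<in> L2per \<and> L2norm (f l) \<le> C * \<bar>l\<bar> ^ n"
    using assms unfolding L2_order_def by blast
  with assms(2) have "\<forall>\<^sub>F l in at 0. g l \<in> L2per \<and> L2norm (g l) \<le> C * \<bar>l\<bar> ^ n"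
    by eventually_elim (metis L2norm_cong)
  then show ?thesis unfolding L2_order_def by blast
qed

lemma L2_order_const: "a \<in> L2per \<Longrightarrow> L2_order 0 (\<lambda>_. a)"
  unfolding L2_order_def by (intro exI[of _ "L2norm a"]) simp

lemma L2_order_cmult: "L2_order n f \<Longrightarrow> L2_order n (\<lambda>l y. c \<odot> f l y)"
  using L2_order_scal[OF scal_order_const] by simp

lemma L2_order_diff:
  assumes "L2_order n f" "L2_order n g" shows "L2_order n (\<lambda>l y. f l y - g l y)"
proof -
  have "- 1 \<odot> w = - w" for w by (simp add: cmul_def prod_eq_iff)
  then show ?thesis using L2_order_add[OF assms(1) L2_order_cmult[OF assms(2), of "-1"]] by simp
qed

lemma L2_order_mono: assumes "L2_order n f" "m \<le> n" shows "L2_order m f"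
proof -
  obtain C where C: "\<forall>\<^sub>F l in at 0. f l \<in> L2per \<and> L2norm (f l) \<le> C * \<bar>l\<bar> ^ n"
    using assms unfolding L2_order_def by blast
  have "\<forall>\<^sub>F l in at (0::real). \<bar>l\<bar> < 1"
    unfolding eventually_at by (intro exI[of _ 1]) auto
  with C have "\<forall>\<^sub>F l in at 0. f l \<in> L2per \<and> L2norm (f l) \<le> \<bar>C\<bar> * \<bar>l\<bar> ^ m"
  proof eventually_elim
    case (elim l)
    have "C * \<bar>l\<bar> ^ n \<le> \<bar>C\<bar> * \<bar>l\<bar> ^ m"
      using elim assms(2) by (intro mult_mono power_decreasing) auto
    with elim show ?case by simp
  qed
  then show ?thesis unfolding L2_order_def by blast
qed

lemma L2_order_divide:
  assumes "L2_order (Suc n) f" shows "L2_order n (\<lambda>l y. (1 / of_real l) \<odot> f l y)"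
proof -
  obtain C where C: "\<forall>\<^sub>F l in at 0. f l \<in> L2per \<and> L2norm (f l) \<le> C * \<bar>l\<bar> ^ Suc n"
    using assms unfolding L2_order_def by blast
  have "\<forall>\<^sub>F l in at (0::real). l \<noteq> 0" by (rule eventually_neq_at_within)
  with C have "\<forall>\<^sub>F l in at 0. (\<lambda>y. (1 / of_real l) \<odot> f l y) \<in> L2per \<and>
     L2norm (\<lambda>y. (1 / of_real l) \<odot> f l y) \<le> C * \<bar>l\<bar> ^ n"
  proof eventually_elim
    case (elim l)
    then show ?case by (simp add: L2per_cmul L2norm_cmul norm_divide field_simps)
  qed
  then show ?thesis unfolding L2_order_def by blast
qed

lemma L2_order_tendsto:
  assumes "L2_order (Suc n) f" shows "((\<lambda>l. L2norm (f l)) \<longlongrightarrow> 0) (at 0)"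
proof -
  obtain C where C: "\<forall>\<^sub>F l in at 0. f l \<in> L2per \<and> L2norm (f l) \<le> C * \<bar>l\<bar> ^ Suc n"
    using assms unfolding L2_order_def by blast
  have "((\<lambda>l. C * \<bar>l\<bar> ^ Suc n) \<longlongrightarrow> C * \<bar>0\<bar> ^ Suc n) (at (0::real))" by (intro tendsto_intros)
  then have lim: "((\<lambda>l. C * \<bar>l\<bar> ^ Suc n) \<longlongrightarrow> 0) (at (0::real))" by simp
  show ?thesis
    by (rule tendsto_sandwich[OF _ _ tendsto_const lim]) (use C in \<open>auto elim: eventually_mono\<close>)
qed

definition scal_exp2 :: "(real \<Rightarrow> complex) \<Rightarrow> complex \<Rightarrow> complex \<Rightarrow> bool" where
  "scal_exp2 g g0 g1 \<longleftrightarrow> scal_order 2 (\<lambda>l. g l - (g0 + of_real l * g1))"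

definition L2_exp2 :: "(real \<Rightarrow> vfun) \<Rightarrow> vfun \<Rightarrow> vfun \<Rightarrow> bool" where
  "L2_exp2 V a0 a1 \<longleftrightarrow> a0 \<in> L2per \<and> a1 \<in> L2per \<and>
     L2_order 2 (\<lambda>l y. V l y - (a0 y + of_real l \<odot> a1 y))"

lemma scal_order_cong: "scal_order n f \<Longrightarrow> \<forall>\<^sub>F l in at 0. f l = g l \<Longrightarrow> scal_order n g"
  unfolding scal_order_def by (elim exE) (rule exI, auto elim: eventually_elim2)

lemma scal_order_norm_eq: "scal_order n f \<Longrightarrow> (\<And>l. norm (g l) = norm (f l)) \<Longrightarrow> scal_order n g"
  unfolding scal_order_def by simp

lemma scal_exp2_cnj: "scal_exp2 g g0 g1 \<Longrightarrow> scal_exp2 (\<lambda>l. cnj (g l)) (cnj g0) (cnj g1)"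
  unfolding scal_exp2_def
proof (erule scal_order_norm_eq)
  fix l
  have "cnj (g l) - (cnj g0 + of_real l * cnj g1) = cnj (g l - (g0 + of_real l * g1))" by simp
  then show "norm (cnj (g l) - (cnj g0 + of_real l * cnj g1)) = norm (g l - (g0 + of_real l * g1))"
    by (metis complex_mod_cnj)
qed

lemma scal_exp2_order_1:
  assumes "scal_exp2 g g0 g1" shows "scal_order 1 (\<lambda>l. g l - g0)"
proof -
  have "scal_order 1 (\<lambda>l. of_real l * g1)"
    using scal_order_mult[OF scal_order_var scal_order_const] by simp
  from scal_order_add[OF this scal_order_mono[OF assms[unfolded scal_exp2_def], of 1]]
  show ?thesis by simp
qed

lemma scal_exp2_order_0:
  assumes "scal_exp2 g g0 g1" shows "scal_order 0 g"
  using scal_order_add[OF scal_order_mono[OF scal_exp2_order_1[OF assms], of 0] scal_order_const[of g0]]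
  by simp

lemma scal_exp2_var_mult:
  assumes "scal_exp2 g g0 g1" shows "scal_exp2 (\<lambda>l. of_real l * g l) 0 g0"
  using scal_order_mult[OF scal_order_var scal_exp2_order_1[OF assms]]
  by (simp add: scal_exp2_def algebra_simps eval_nat_numeral)

lemma L2_exp2_order_1:
  assumes "L2_exp2 V a0 a1" shows "L2_order 1 (\<lambda>l y. V l y - a0 y)"
proof -
  have "L2_order 1 (\<lambda>l y. of_real l \<odot> a1 y)"
    using L2_order_scal[OF scal_order_var L2_order_const[of a1]] assms by (simp add: L2_exp2_def)
  from L2_order_add[OF this L2_order_mono[of 2 _ 1]] assms
  show ?thesis by (fastforce simp: L2_exp2_def)
qed

lemma L2_exp2_add:
  assumes "L2_exp2 V a0 a1" "L2_exp2 W b0 b1"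
  shows "L2_exp2 (\<lambda>l y. V l y + W l y) (\<lambda>y. a0 y + b0 y) (\<lambda>y. a1 y + b1 y)"
  using assms L2_order_add[of 2 "\<lambda>l y. V l y - (a0 y + of_real l \<odot> a1 y)" "\<lambda>l y. W l y - (b0 y + of_real l \<odot> b1 y)"]
  by (auto simp: L2_exp2_def L2per_add cmul_add_right algebra_simps)

text \<open>The product rule for Taylor coefficients of first order, with remainder.\<close>

lemma L2_exp2_mult:
  assumes g: "scal_exp2 g g0 g1" and V: "L2_exp2 V a0 a1"
  shows "L2_exp2 (\<lambda>l y. g l \<odot> V l y) (\<lambda>y. g0 \<odot> a0 y) (\<lambda>y. g0 \<odot> a1 y + g1 \<odot> a0 y)"
proof -
  have a: "a0 \<in> L2per" "a1 \<in> L2per" and R: "L2_order 2 (\<lambda>l y. V l y - (a0 y + of_real l \<odot> a1 y))"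
    using V by (auto simp: L2_exp2_def)
  have "L2_order 2 (\<lambda>l y. g l \<odot> (V l y - (a0 y + of_real l \<odot> a1 y)))" (is "L2_order 2 ?A")
    using L2_order_scal[OF scal_exp2_order_0[OF g] R] by (simp only: add_0)
  moreover have "L2_order 2 (\<lambda>l y. (g l - (g0 + of_real l * g1)) \<odot> a0 y)" (is "L2_order 2 ?B")
    using L2_order_scal[OF g[unfolded scal_exp2_def] L2_order_const[OF a(1)]] by simp
  moreover have "L2_order 2 (\<lambda>l y. (of_real l * (g l - g0)) \<odot> a1 y)" (is "L2_order 2 ?C")
    using L2_order_scal[OF scal_order_mult[OF scal_order_var scal_exp2_order_1[OF g]] L2_order_const[OF a(2)]]
    by (simp add: eval_nat_numeral)
  ultimately have "L2_order 2 (\<lambda>l y. (?A l y + ?B l y) + ?C l y)"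
    by (intro L2_order_add)
  moreover have "(?A l y + ?B l y) + ?C l y =
      g l \<odot> V l y - (g0 \<odot> a0 y + of_real l \<odot> (g0 \<odot> a1 y + g1 \<odot> a0 y))" for l y
    by (simp add: prod_eq_iff algebra_simps)
  ultimately show ?thesis
    using a by (simp add: L2_exp2_def L2per_cmul L2per_add)
qed

lemma L2_exp2_cong:
  assumes "L2_exp2 V a0 a1" "\<forall>\<^sub>F l in at 0. V l \<doteq> W l \<and> W l \<in> L2per"
    and "a0 \<doteq> b0" "b0 \<in> L2per" "a1 \<doteq> b1" "b1 \<in> L2per"
  shows "L2_exp2 W b0 b1"
proof -
  have "L2_order 2 (\<lambda>l y. W l y - (b0 y + of_real l \<odot> b1 y))"
  proof (rule L2_order_cong)
    show "L2_order 2 (\<lambda>l y. V l y - (a0 y + of_real l \<odot> a1 y))" using assms(1) by (simp add: L2_exp2_def)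
    show "\<forall>\<^sub>F l in at 0. (\<lambda>y. V l y - (a0 y + of_real l \<odot> a1 y)) \<doteq> (\<lambda>y. W l y - (b0 y + of_real l \<odot> b1 y))
      \<and> (\<lambda>y. W l y - (b0 y + of_real l \<odot> b1 y)) \<in> L2per"
      using assms(2)
    proof eventually_elim
      case (elim l)
      then have 1: "V l \<doteq> W l" and 2: "W l \<in> L2per" by auto
      have "(\<lambda>y. V l y - (a0 y + of_real l \<odot> a1 y)) \<doteq> (\<lambda>y. W l y - (b0 y + of_real l \<odot> b1 y))"
        using 1 assms(3,5) by eventually_elim simp
      with 2 show ?case by (auto intro!: L2per_diff L2per_add L2per_cmul assms)
    qed
  qed
  with assms show ?thesis by (simp add: L2_exp2_def)
qed

lemma L2_exp2_unique:
  assumes "L2_exp2 V a0 a1" "L2_exp2 V b0 b1" shows "a0 \<doteq> b0"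
proof -
  have "L2_order (Suc 0) (\<lambda>l y. (V l y - a0 y) - (V l y - b0 y))"
    using L2_order_diff[OF L2_exp2_order_1[OF assms(1)] L2_exp2_order_1[OF assms(2)]] by simp
  then have *: "L2_order (Suc 0) (\<lambda>l y. b0 y - a0 y)" by (simp add: algebra_simps)
  have "L2norm (\<lambda>y. b0 y - a0 y) = 0"
    using L2_order_tendsto[OF *] by (simp add: tendsto_const_iff)
  moreover have "(\<lambda>y. b0 y - a0 y) \<in> L2per"
    using assms by (auto simp: L2_exp2_def intro: L2per_diff)
  ultimately have "(\<lambda>y. b0 y - a0 y) \<doteq> (\<lambda>_. 0)" by (intro L2norm_eq_0_imp)
  then show ?thesis by (auto elim: eventually_mono)
qed

text \<open>Removing the singularity of the difference quotient; applied twice it gives a Taylor expansion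
with quadratic remainder.\<close>

lemma analytic_factor:
  assumes "g analytic_on {0}"
  shows "\<exists>h. h analytic_on {0} \<and> (\<forall>z. g z = g 0 + z * h z)"
proof -
  obtain r where r: "r > 0" "g holomorphic_on ball 0 r"
    using assms by (auto simp: analytic_on_def)
  let ?h = "\<lambda>z. if z = 0 then deriv g 0 else (g z - g 0) / (z - 0)"
  have "?h holomorphic_on ball 0 r" by (rule pole_lemma_open[OF r(2)]) simp
  then have "?h analytic_on {0}" using r(1) by (auto simp: analytic_on_def)
  then show ?thesis by (intro exI[of _ ?h]) auto
qed

lemma analytic_scal_exp2:
  assumes "g analytic_on {0}"
  shows "\<exists>g1. scal_exp2 (\<lambda>l. g (of_real l)) (g 0) g1"
proof -
  obtain h where h: "h analytic_on {0}" "\<And>z. g z = g 0 + z * h z" using analytic_factor[OF assms] by blast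
  obtain k where k: "k analytic_on {0}" "\<And>z. h z = h 0 + z * k z" using analytic_factor[OF h(1)] by blast
  have "isCont k 0" using k(1) by (simp add: analytic_at_imp_isCont)
  then have "isCont (\<lambda>l. k (complex_of_real l)) 0"
    by (intro isCont_o2[where f=of_real and g=k]) auto
  then have "((\<lambda>l. norm (k (complex_of_real l))) \<longlongrightarrow> norm (k 0)) (at 0)"
    unfolding isCont_def by (auto intro: tendsto_norm)
  then have "\<forall>\<^sub>F l in at 0. norm (k (complex_of_real l)) < norm (k 0) + 1"
    by (rule order_tendstoD) simp
  then have "\<forall>\<^sub>F l in at 0. norm (g (complex_of_real l) - (g 0 + of_real l * h 0)) \<le> (norm (k 0) + 1) * \<bar>l\<bar> ^ 2"
  proof eventually_elim
    case (elim l)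
    have "g (complex_of_real l) - (g 0 + of_real l * h 0) = of_real (l ^ 2) * k (of_real l)"
      using h(2)[of "of_real l"] k(2)[of "of_real l"] by (simp add: algebra_simps power2_eq_square)
    then show ?case using elim
      by (simp add: norm_mult norm_power mult.commute[of "l\<^sup>2"] mult_right_mono)
  qed
  then show ?thesis unfolding scal_exp2_def scal_order_def by blast
qed

lemma analytic_ext_0_scal_exp2:
  assumes "analytic_ext_0 g" shows "\<exists>g0 g1. scal_exp2 g g0 g1"
proof -
  obtain h where h: "h analytic_on {0}" "\<forall>\<^sub>F l in at 0. g l = h (complex_of_real l)"
    using assms by (auto simp: analytic_ext_0_def)
  obtain h1 where "scal_exp2 (\<lambda>l. h (of_real l)) (h 0) h1" using analytic_scal_exp2[OF h(1)] by blast
  then have "scal_exp2 g (h 0) h1" unfolding scal_exp2_def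
    by (rule scal_order_cong) (use h(2) in \<open>auto elim: eventually_mono\<close>)
  then show ?thesis by blast
qed

lemma analytic_near_0_scal_exp2:
  assumes "analytic_near_0 g" shows "\<exists>g1. scal_exp2 g (g 0) g1"
proof -
  obtain h where h: "h analytic_on {0}" and *: "\<forall>\<^sub>F l in nhds 0. g l = h (complex_of_real l)"
    using assms by (auto simp: analytic_near_0_def)
  have 0: "g 0 = h 0" using eventually_nhds_x_imp_x[OF *] by simp
  have "\<forall>\<^sub>F l in at 0. g l = h (complex_of_real l)"
    using * by (simp add: eventually_at_filter eventually_mono)
  obtain h1 where "scal_exp2 (\<lambda>l. h (of_real l)) (h 0) h1" using analytic_scal_exp2[OF h(1)] by blast
  then have "scal_exp2 g (h 0) h1" unfolding scal_exp2_def
    by (rule scal_order_cong) (use \<open>\<forall>\<^sub>F l in at 0. _ l\<close> in \<open>auto elim: eventually_mono\<close>)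
  then show ?thesis using 0 by auto
qed

text \<open>Convergence of the power series at a single \<open>l\<^sub>0 > 0\<close> bounds \<open>l\<^sub>0\<^sup>n \<parallel>a\<^sub>n\<parallel>\<close>. For \<open>\<bar>l\<bar> \<le> l\<^sub>0 / 2\<close> the tail of the
series from \<open>n = 2\<close> on is then dominated by a geometric series times \<open>l\<^sup>2\<close>.\<close>

lemma L2_analytic_exp2:
  assumes "L2_analytic_near_0 v"
  shows "\<exists>a1. v 0 \<in> L2per \<and> L2_exp2 v (v 0) a1"
proof -
  obtain a where a: "\<And>n. a n \<in> L2per" and ev: "\<forall>\<^sub>F l in nhds 0. v l \<in> L2per \<and>
       (\<lambda>N. L2norm (\<lambda>y. v l y - (\<Sum>n<N. l ^ n *\<^sub>R a n y))) \<longlonglongrightarrow> 0"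
    using assms by (auto simp: L2_analytic_near_0_def)
  define S where "S l N y = (\<Sum>n<N. l ^ n *\<^sub>R a n y)" for l N y
  have S: "S l N \<in> L2per" for l N
    unfolding S_def by (intro L2per_sum L2per_scaleR a)
  obtain r where r: "r > 0" "\<And>l. \<bar>l\<bar> < r \<Longrightarrow> v l \<in> L2per"
    "\<And>l. \<bar>l\<bar> < r \<Longrightarrow> (\<lambda>N. L2norm (\<lambda>y. v l y - S l N y)) \<longlonglongrightarrow> 0"
    using ev unfolding eventually_nhds_metric S_def by (auto simp: dist_real_def)
  define l0 where "l0 = r / 2"
  have l0: "l0 > 0" "\<bar>l0\<bar> < r" using r(1) by (auto simp: l0_def)
  obtain K where K: "K > 0" "\<And>N. L2norm (\<lambda>y. v l0 y - S l0 N y) \<le> K"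
    using convergent_imp_Bseq[OF convergentI[OF r(3)[OF l0(2)]]] by (auto simp: Bseq_def)
  have an: "l0 ^ n * L2norm (a n) \<le> 2 * K" for n
  proof -
    have "l0 ^ n * L2norm (a n) = L2norm (\<lambda>y. l0 ^ n *\<^sub>R a n y)"
      using l0 by (simp add: L2norm_scaleR)
    also have "(\<lambda>y. l0 ^ n *\<^sub>R a n y) = (\<lambda>y. (v l0 y - S l0 n y) - (v l0 y - S l0 (Suc n) y))"
      by (simp add: S_def fun_eq_iff)
    also have "L2norm \<dots> \<le> L2norm (\<lambda>y. v l0 y - S l0 n y) + L2norm (\<lambda>y. v l0 y - S l0 (Suc n) y)"
      by (intro L2norm_triangle_diff L2per_diff r l0 S)
    finally show ?thesis using K(2)[of n] K(2)[of "Suc n"] by linarith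
  qed
  have bound: "L2norm (\<lambda>y. v l y - (a 0 y + of_real l \<odot> a 1 y)) \<le> (4 * K / l0\<^sup>2) * \<bar>l\<bar> ^ 2"
    if l: "\<bar>l\<bar> \<le> l0 / 2" for l
  proof -
    have lr: "\<bar>l\<bar> < r" using l l0 by auto
    have "L2norm (\<lambda>y. v l y - (a 0 y + of_real l \<odot> a 1 y)) \<le>
        L2norm (\<lambda>y. v l y - S l (N + 2) y) + (4 * K / l0\<^sup>2) * \<bar>l\<bar> ^ 2" for N
    proof -
      let ?T = "\<lambda>y. \<Sum>n<N. l ^ (n + 2) *\<^sub>R a (n + 2) y"
      have T: "?T \<in> L2per" by (intro L2per_sum L2per_scaleR a)
      have "S l (N + 2) y = a 0 y + of_real l \<odot> a 1 y + ?T y" for y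
        by (induction N) (simp_all add: S_def scaleR_cmul eval_nat_numeral)
      then have "(\<lambda>y. v l y - (a 0 y + of_real l \<odot> a 1 y)) = (\<lambda>y. (v l y - S l (N + 2) y) + ?T y)"
        by (simp add: fun_eq_iff)
      then have "L2norm (\<lambda>y. v l y - (a 0 y + of_real l \<odot> a 1 y)) \<le> L2norm (\<lambda>y. v l y - S l (N + 2) y) + L2norm ?T"
        using L2norm_triangle[OF L2per_diff[OF r(2)[OF lr] S] T] by simp
      also have "L2norm ?T \<le> (\<Sum>n<N. L2norm (\<lambda>y. l ^ (n + 2) *\<^sub>R a (n + 2) y))"
        by (intro L2norm_sum L2per_scaleR a)
      also have "\<dots> \<le> (\<Sum>n<N. (1/2) ^ n * (2 * K / l0\<^sup>2 * \<bar>l\<bar>\<^sup>2))"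
      proof (rule sum_mono)
        fix n
        have "L2norm (\<lambda>y. l ^ (n + 2) *\<^sub>R a (n + 2) y) = \<bar>l\<bar> ^ n * \<bar>l\<bar>\<^sup>2 * L2norm (a (n + 2))"
          unfolding L2norm_scaleR by (simp add: power_abs[symmetric] abs_mult power2_eq_square)
        also have "\<dots> \<le> (l0 / 2) ^ n * \<bar>l\<bar>\<^sup>2 * L2norm (a (n + 2))"
          using l by (intro mult_right_mono power_mono) auto
        also have "\<dots> = (1/2) ^ n * \<bar>l\<bar>\<^sup>2 / l0\<^sup>2 * (l0 ^ (n + 2) * L2norm (a (n + 2)))"
          using l0 by (simp add: power_divide power2_eq_square)
        also have "\<dots> \<le> (1/2) ^ n * \<bar>l\<bar>\<^sup>2 / l0\<^sup>2 * (2 * K)"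
          by (intro mult_left_mono an) auto
        finally show "L2norm (\<lambda>y. l ^ (n + 2) *\<^sub>R a (n + 2) y) \<le> (1/2) ^ n * (2 * K / l0\<^sup>2 * \<bar>l\<bar>\<^sup>2)"
          by (simp add: mult_ac)
      qed
      also have "\<dots> = (\<Sum>n<N. (1/2) ^ n) * (2 * K / l0\<^sup>2 * \<bar>l\<bar>\<^sup>2)"
        by (simp only: sum_distrib_right)
      also have "\<dots> \<le> 2 * (2 * K / l0\<^sup>2 * \<bar>l\<bar>\<^sup>2)"
      proof (rule mult_right_mono)
        show "(\<Sum>n<N. (1/2::real) ^ n) \<le> 2" by (simp add: geometric_sum)
      qed (use K in auto)
      finally show ?thesis by simp
    qed
    moreover have "(\<lambda>N. L2norm (\<lambda>y. v l y - S l (N + 2) y) + (4 * K / l0\<^sup>2) * \<bar>l\<bar> ^ 2) \<longlonglongrightarrow> 0 + (4 * K / l0\<^sup>2) * \<bar>l\<bar> ^ 2"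
      by (intro tendsto_intros LIMSEQ_ignore_initial_segment r lr)
    ultimately have "L2norm (\<lambda>y. v l y - (a 0 y + of_real l \<odot> a 1 y)) \<le> 0 + (4 * K / l0\<^sup>2) * \<bar>l\<bar> ^ 2"
      by (intro LIMSEQ_le_const) blast+
    then show ?thesis by simp
  qed
  have "\<forall>\<^sub>F l in at 0. \<bar>l\<bar> \<le> l0 / 2"
    unfolding eventually_at using l0 by (intro exI[of _ "l0/2"]) auto
  then have "\<forall>\<^sub>F l in at 0. (\<lambda>y. v l y - (a 0 y + of_real l \<odot> a 1 y)) \<in> L2per \<and>
     L2norm (\<lambda>y. v l y - (a 0 y + of_real l \<odot> a 1 y)) \<le> (4 * K / l0\<^sup>2) * \<bar>l\<bar> ^ 2"
    by eventually_elim (use bound l0 in \<open>auto intro!: L2per_diff L2per_add L2per_cmul a r\<close>)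
  then have e: "L2_exp2 v (a 0) (a 1)"
    using a unfolding L2_exp2_def L2_order_def by blast
  have v0: "v 0 \<in> L2per" using r(1,2) by simp
  have "L2norm (\<lambda>y. v 0 y - a 0 y) = 0"
  proof -
    have "S 0 (Suc N) y = a 0 y" for N y unfolding S_def by (subst sum.lessThan_Suc_shift) simp
    then have "(\<lambda>N. L2norm (\<lambda>y. v 0 y - a 0 y)) \<longlonglongrightarrow> 0"
      using LIMSEQ_Suc[OF r(3)[of 0]] r(1) by simp
    then show ?thesis by (simp add: LIMSEQ_const_iff)
  qed
  then have "(\<lambda>y. v 0 y - a 0 y) \<doteq> (\<lambda>_. 0)"
    by (intro L2norm_eq_0_imp L2per_diff v0 a)
  then have "a 0 \<doteq> v 0" by (auto elim: eventually_mono)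
  have "\<forall>\<^sub>F l in at 0. v l \<doteq> v l \<and> v l \<in> L2per"
    unfolding eventually_at using r by (intro exI[of _ r]) auto
  from L2_exp2_cong[OF e this \<open>a 0 \<doteq> v 0\<close> v0 _ a] v0 show ?thesis by blast
qed

section \<open>Analytic families with polynomial coefficients\<close>

lemma L2_analytic_add:
  assumes "L2_analytic_near_0 v" "L2_analytic_near_0 w"
  shows "L2_analytic_near_0 (\<lambda>l y. v l y + w l y)"
proof -
  obtain a where a: "\<And>n. a n \<in> L2per" and va: "\<forall>\<^sub>F l in nhds 0. v l \<in> L2per \<and>
       (\<lambda>N. L2norm (\<lambda>y. v l y - (\<Sum>n<N. l ^ n *\<^sub>R a n y))) \<longlonglongrightarrow> 0"
    using assms(1) by (auto simp: L2_analytic_near_0_def)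
  obtain b where b: "\<And>n. b n \<in> L2per" and wb: "\<forall>\<^sub>F l in nhds 0. w l \<in> L2per \<and>
       (\<lambda>N. L2norm (\<lambda>y. w l y - (\<Sum>n<N. l ^ n *\<^sub>R b n y))) \<longlonglongrightarrow> 0"
    using assms(2) by (auto simp: L2_analytic_near_0_def)
  have "\<forall>\<^sub>F l in nhds 0. (\<lambda>y. v l y + w l y) \<in> L2per \<and>
       (\<lambda>N. L2norm (\<lambda>y. v l y + w l y - (\<Sum>n<N. l ^ n *\<^sub>R (a n y + b n y)))) \<longlonglongrightarrow> 0"
    using va wb
  proof eventually_elim
    case (elim l)
    let ?A = "\<lambda>N y. v l y - (\<Sum>n<N. l ^ n *\<^sub>R a n y)" and ?B = "\<lambda>N y. w l y - (\<Sum>n<N. l ^ n *\<^sub>R b n y)"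
    have AB: "?A N \<in> L2per" "?B N \<in> L2per" for N
      using elim by (auto intro!: L2per_diff L2per_sum L2per_scaleR a b)
    have eq: "v l y + w l y - (\<Sum>n<N. l ^ n *\<^sub>R (a n y + b n y)) = ?A N y + ?B N y" for N y
      by (simp add: scaleR_add_right sum.distrib)
    have "(\<lambda>N. L2norm (?A N) + L2norm (?B N)) \<longlonglongrightarrow> 0"
      using tendsto_add[of _ 0 _ _ 0] elim by fastforce
    then have "(\<lambda>N. L2norm (\<lambda>y. ?A N y + ?B N y)) \<longlonglongrightarrow> 0"
      by (rule tendsto_sandwich[OF _ _ tendsto_const, rotated 2]) (auto intro!: always_eventually L2norm_triangle AB)
    with elim show ?case by (simp add: eq L2per_add)
  qed
  then show ?thesis unfolding L2_analytic_near_0_def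
    by (intro exI[of _ "\<lambda>n y. a n y + b n y"]) (auto intro: L2per_add a b)
qed

lemma L2_analytic_cmul:
  assumes "L2_analytic_near_0 v" shows "L2_analytic_near_0 (\<lambda>l y. c \<odot> v l y)"
proof -
  obtain a where a: "\<And>n. a n \<in> L2per" and va: "\<forall>\<^sub>F l in nhds 0. v l \<in> L2per \<and>
       (\<lambda>N. L2norm (\<lambda>y. v l y - (\<Sum>n<N. l ^ n *\<^sub>R a n y))) \<longlonglongrightarrow> 0"
    using assms(1) by (auto simp: L2_analytic_near_0_def)
  have "\<forall>\<^sub>F l in nhds 0. (\<lambda>y. c \<odot> v l y) \<in> L2per \<and>
       (\<lambda>N. L2norm (\<lambda>y. c \<odot> v l y - (\<Sum>n<N. l ^ n *\<^sub>R (c \<odot> a n y)))) \<longlonglongrightarrow> 0"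
    using va
  proof eventually_elim
    case (elim l)
    have "(\<Sum>n<N. l ^ n *\<^sub>R (c \<odot> a n y)) = c \<odot> (\<Sum>n<N. l ^ n *\<^sub>R a n y)" for N y
      by (induction N) (auto simp: cmul_add_right scaleR_cmul cmul_cmul mult.commute)
    then have "(\<lambda>y. c \<odot> v l y - (\<Sum>n<N. l ^ n *\<^sub>R (c \<odot> a n y))) = (\<lambda>y. c \<odot> (v l y - (\<Sum>n<N. l ^ n *\<^sub>R a n y)))" for N
      by (simp add: cmul_diff_right)
    with elim show ?case by (auto simp: L2per_cmul L2norm_cmul intro: tendsto_mult_right_zero)
  qed
  then show ?thesis unfolding L2_analytic_near_0_def
    by (intro exI[of _ "\<lambda>n y. c \<odot> a n y"]) (auto intro: L2per_cmul a)
qed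

lemma L2_analytic_var_mult:
  assumes "L2_analytic_near_0 v" shows "L2_analytic_near_0 (\<lambda>l y. of_real l \<odot> v l y)"
proof -
  obtain a where a: "\<And>n. a n \<in> L2per" and va: "\<forall>\<^sub>F l in nhds 0. v l \<in> L2per \<and>
       (\<lambda>N. L2norm (\<lambda>y. v l y - (\<Sum>n<N. l ^ n *\<^sub>R a n y))) \<longlonglongrightarrow> 0"
    using assms(1) by (auto simp: L2_analytic_near_0_def)
  define b where "b n = (case n of 0 \<Rightarrow> (\<lambda>y. 0) | Suc m \<Rightarrow> a m)" for n
  have "\<forall>\<^sub>F l in nhds 0. (\<lambda>y. of_real l \<odot> v l y) \<in> L2per \<and>
       (\<lambda>N. L2norm (\<lambda>y. of_real l \<odot> v l y - (\<Sum>n<N. l ^ n *\<^sub>R b n y))) \<longlonglongrightarrow> 0"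
    using va
  proof eventually_elim
    case (elim l)
    have "(\<Sum>n<Suc N. l ^ n *\<^sub>R b n y) = of_real l \<odot> (\<Sum>n<N. l ^ n *\<^sub>R a n y)" for N y
      by (subst sum.lessThan_Suc_shift) (simp add: b_def scaleR_sum_right flip: scaleR_cmul)
    then have "(\<lambda>y. of_real l \<odot> v l y - (\<Sum>n<Suc N. l ^ n *\<^sub>R b n y)) = (\<lambda>y. of_real l \<odot> (v l y - (\<Sum>n<N. l ^ n *\<^sub>R a n y)))" for N
      by (simp only: cmul_diff_right)
    then have "(\<lambda>N. L2norm (\<lambda>y. of_real l \<odot> v l y - (\<Sum>n<Suc N. l ^ n *\<^sub>R b n y))) \<longlonglongrightarrow> 0"
      using elim by (simp only: L2norm_cmul) (auto intro: tendsto_mult_right_zero)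
    with elim show ?case by (simp only: L2per_cmul) (rule conjI[OF TrueI LIMSEQ_imp_Suc])
  qed
  then show ?thesis unfolding L2_analytic_near_0_def
    by (intro exI[of _ b]) (auto simp: b_def a split: nat.splits)
qed

text \<open>Multiplication by \<open>l\<close> shifts the coefficients of the power series, so polynomial factors need no
product of infinite series.\<close>

lemma L2_analytic_poly_mult:
  assumes "L2_analytic_near_0 v"
  shows "L2_analytic_near_0 (\<lambda>l y. poly p (of_real l) \<odot> v l y)"
proof (induction p)
  case 0
  show ?case using L2_analytic_cmul[OF assms, of 0] by simp
next
  case (pCons c p)
  from L2_analytic_add[OF L2_analytic_cmul[OF assms, of c] L2_analytic_var_mult[OF pCons(2)]]
  show ?case by (simp add: cmul_add_left cmul_cmul)
qed

lemma analytic_ext_0_add: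
  assumes "analytic_ext_0 f" "analytic_ext_0 g" shows "analytic_ext_0 (\<lambda>l. f l + g l)"
proof -
  obtain F G where F: "F analytic_on {0}" "\<forall>\<^sub>F l in at 0. f l = F (complex_of_real l)"
    and G: "G analytic_on {0}" "\<forall>\<^sub>F l in at 0. g l = G (complex_of_real l)"
    using assms unfolding analytic_ext_0_def by blast
  have "\<forall>\<^sub>F l in at 0. f l + g l = F (complex_of_real l) + G (complex_of_real l)"
    using F(2) G(2) by eventually_elim simp
  then show ?thesis unfolding analytic_ext_0_def
    by (intro exI[of _ "\<lambda>z. F z + G z"] conjI analytic_intros F G)
qed

lemma analytic_ext_0_poly_mult:
  assumes "analytic_ext_0 f" shows "analytic_ext_0 (\<lambda>l. poly p (of_real l) * f l)"
proof -
  obtain F where F: "F analytic_on {0}" "\<forall>\<^sub>F l in at 0. f l = F (complex_of_real l)"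
    using assms unfolding analytic_ext_0_def by blast
  have "poly p analytic_on {0}"
    by (intro holomorphic_on_imp_analytic_at[of _ UNIV] holomorphic_intros) auto
  then have "(\<lambda>z. poly p z * F z) analytic_on {0}" by (intro analytic_intros F)
  moreover have "\<forall>\<^sub>F l in at 0. poly p (of_real l) * f l = poly p (complex_of_real l) * F (complex_of_real l)"
    using F(2) by eventually_elim simp
  ultimately show ?thesis unfolding analytic_ext_0_def by blast
qed

lemma analytic_ext_0_cong:
  assumes "analytic_ext_0 f" "\<forall>\<^sub>F l in at 0. f l = g l" shows "analytic_ext_0 g"
proof -
  obtain F where F: "F analytic_on {0}" "\<forall>\<^sub>F l in at 0. f l = F (complex_of_real l)"
    using assms unfolding analytic_ext_0_def by blast
  have "\<forall>\<^sub>F l in at 0. g l = F (complex_of_real l)" using F(2) assms(2) by eventually_elim simp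
  with F(1) show ?thesis unfolding analytic_ext_0_def by blast
qed

section \<open>Tangent vectors to the family of waves\<close>

lemma has_weak_deriv_of_real:
  fixes f g :: "real \<Rightarrow> real"
  assumes g: "continuous_on UNIV g" and fg: "\<And>a b. a \<le> b \<Longrightarrow> f b - f a = integral {a..b} g"
  shows "has_weak_deriv (\<lambda>y. complex_of_real (f y)) (\<lambda>y. complex_of_real (g y))"
  unfolding has_weak_deriv_def
proof (intro exI[of _ "\<lambda>y. complex_of_real (f y)"] conjI allI impI)
  fix a b :: real assume "a \<le> b"
  have c: "continuous_on UNIV (\<lambda>y. complex_of_real (g y))" by (intro continuous_intros g)
  show "(\<lambda>y. complex_of_real (g y)) absolutely_integrable_on {a..b}"
    using loc_int_continuous[OF c] by (simp add: loc_int_def)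
  have "g integrable_on {a..b}" by (intro integrable_continuous_real continuous_on_subset[OF g]) auto
  then show "complex_of_real (f b) - complex_of_real (f a) = integral {a..b} (\<lambda>y. complex_of_real (g y))"
    using integral_linear[of g "{a..b}" complex_of_real] fg[OF \<open>a \<le> b\<close>]
    by (simp add: o_def bounded_linear_of_real flip: of_real_diff)
qed auto

lemma DERIV_integral_parameter:
  fixes f :: "real \<Rightarrow> real \<Rightarrow> real"
  assumes U: "open U" "s0 \<in> U"
    and int: "\<And>s. s \<in> U \<Longrightarrow> f s integrable_on {a..b}"
    and f': "\<And>s y. s \<in> U \<Longrightarrow> ((\<lambda>s. f s y) has_real_derivative f' s y) (at s)"
    and cont: "continuous_on (U \<times> UNIV) (\<lambda>(s, y). f' s y)"
  shows "((\<lambda>s. integral {a..b} (f s)) has_real_derivative integral {a..b} (f' s0)) (at s0)"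
proof -
  obtain e where e: "e > 0" "ball s0 e \<subseteq> U" using U by (meson openE)
  have "((\<lambda>s. integral (cbox a b) (f s)) has_real_derivative integral (cbox a b) (f' s0)) (at s0 within ball s0 e)"
  proof (rule leibniz_rule_field_derivative)
    show "((\<lambda>s. f s y) has_real_derivative f' s y) (at s within ball s0 e)" if "s \<in> ball s0 e" for s y
      by (rule has_field_derivative_at_within[OF f']) (use e that in auto)
    show "continuous_on (ball s0 e \<times> cbox a b) (\<lambda>(s, y). f' s y)"
      by (rule continuous_on_subset[OF cont]) (use e in auto)
  qed (use e int in auto)
  moreover have "s0 \<in> ball s0 e" using e(1) by simp
  ultimately show ?thesis by (simp add: at_within_open[OF _ open_ball])
qed

text \<open>Differentiation of an integrated equation with respect to a parameter: if \<open>g s\<close> is the derivative of \<open>f s\<close>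
for every \<open>s\<close>, then the derivative of \<open>f\<close> in \<open>s\<close> has the derivative of \<open>g\<close> in \<open>s\<close> as its weak derivative.\<close>

lemma has_weak_deriv_parameter:
  fixes f g :: "real \<Rightarrow> real \<Rightarrow> real"
  assumes U: "open U" "s0 \<in> U"
    and fg: "\<And>s a b. s \<in> U \<Longrightarrow> a \<le> b \<Longrightarrow> (g s has_integral f s b - f s a) {a..b}"
    and f': "\<And>y. ((\<lambda>s. f s y) has_real_derivative f' y) (at s0)"
    and g': "\<And>s y. s \<in> U \<Longrightarrow> ((\<lambda>s. g s y) has_real_derivative g' s y) (at s)"
    and cg': "continuous_on (U \<times> UNIV) (\<lambda>(s, y). g' s y)"
  shows "has_weak_deriv (\<lambda>y. complex_of_real (f' y)) (\<lambda>y. complex_of_real (g' s0 y))"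
proof (rule has_weak_deriv_of_real)
  have "continuous_on UNIV ((\<lambda>(s, y). g' s y) \<circ> (\<lambda>y. (s0, y)))"
    by (intro continuous_on_compose continuous_intros continuous_on_subset[OF cg']) (use U in auto)
  then show "continuous_on UNIV (g' s0)" by (simp add: o_def)
  fix a b :: real assume "a \<le> b"
  have "((\<lambda>s. integral {a..b} (g s)) has_real_derivative integral {a..b} (g' s0)) (at s0)"
    by (rule DERIV_integral_parameter[OF U has_integral_integrable[OF fg[OF _ \<open>a \<le> b\<close>]] g' cg'])
  moreover have "\<forall>\<^sub>F s in nhds s0. integral {a..b} (g s) = f s b - f s a"
    using eventually_nhds_in_open[OF U] by eventually_elim (rule integral_unique[OF fg[OF _ \<open>a \<le> b\<close>]])
  ultimately have "((\<lambda>s. f s b - f s a) has_real_derivative integral {a..b} (g' s0)) (at s0)"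
    by (simp add: DERIV_cong_ev[OF refl _ refl])
  moreover have "((\<lambda>s. f s b - f s a) has_real_derivative f' b - f' a) (at s0)"
    by (intro derivative_intros f')
  ultimately show "f' b - f' a = integral {a..b} (g' s0)" by (metis DERIV_unique)
qed

lemma DERIV_Gflux_h:
  "h \<noteq> 0 \<Longrightarrow> ((\<lambda>x. Gflux F x q) has_real_derivative - q\<^sup>2 / h\<^sup>2 + h / F\<^sup>2) (at h)"
proof -
  assume "h \<noteq> 0"
  then have 1: "((\<lambda>x. q\<^sup>2 / x) has_real_derivative - q\<^sup>2 / h\<^sup>2) (at h)"
    by (auto intro!: derivative_eq_intros simp: power2_eq_square)
  have "((\<lambda>x. x\<^sup>2) has_real_derivative 2 * h) (at h)" by (auto intro!: derivative_eq_intros)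
  from DERIV_add[OF 1 DERIV_cdivide[OF this, of "2 * F\<^sup>2"]] show ?thesis by (simp add: Gflux_def)
qed

lemma dhG_eq: "h \<noteq> 0 \<Longrightarrow> dhG F h q = - q\<^sup>2 / h\<^sup>2 + h / F\<^sup>2"
  unfolding dhG_def by (rule DERIV_imp_deriv[OF DERIV_Gflux_h])

lemma dqG_eq: "dqG F h q = 2 * q / h"
  unfolding dqG_def Gflux_def divide_inverse
  by (rule DERIV_imp_deriv) (auto intro!: derivative_eq_intros)

lemma dhS_eq: "h \<noteq> 0 \<Longrightarrow> dhS h q = 1 + 2 * q\<^sup>2 / h ^ 3"
  unfolding dhS_def Ssrc_def
  by (rule DERIV_imp_deriv) (auto intro!: derivative_eq_intros simp: field_simps eval_nat_numeral)

lemma dqS_eq: "dqS h q = - 2 * q / h\<^sup>2"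
  unfolding dqS_def Ssrc_def divide_inverse
  by (rule DERIV_imp_deriv) (auto intro!: derivative_eq_intros)

lemma DERIV_Gflux:
  assumes "(h has_real_derivative h') (at s)" "(q has_real_derivative q') (at s)" "h s \<noteq> 0"
  shows "((\<lambda>s. Gflux F (h s) (q s)) has_real_derivative dhG F (h s) (q s) * h' + dqG F (h s) (q s) * q') (at s)"
proof -
  have 1: "((\<lambda>s. (q s)\<^sup>2 / h s) has_real_derivative - (q s)\<^sup>2 / (h s)\<^sup>2 * h' + 2 * q s / h s * q') (at s)"
    using assms by (auto intro!: derivative_eq_intros simp: field_simps power2_eq_square)
  have "((\<lambda>s. (h s)\<^sup>2) has_real_derivative 2 * h s * h') (at s)"
    using assms by (auto intro!: derivative_eq_intros)
  from DERIV_add[OF 1 DERIV_cdivide[OF this, of "2 * F\<^sup>2"]] show ?thesis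
    by (simp add: Gflux_def dhG_eq[OF assms(3)] dqG_eq algebra_simps)
qed

lemma DERIV_Ssrc:
  assumes "(h has_real_derivative h') (at s)" "(q has_real_derivative q') (at s)" "h s \<noteq> 0"
  shows "((\<lambda>s. Ssrc (h s) (q s)) has_real_derivative dhS (h s) (q s) * h' + dqS (h s) (q s) * q') (at s)"
  unfolding Ssrc_def dhS_eq[OF assms(3)] dqS_eq
  using assms by (auto intro!: derivative_eq_intros simp: field_simps eval_nat_numeral)

lemma linear_triple:
  fixes L :: "real \<times> real \<times> real \<Rightarrow> real"
  assumes "linear L"
  shows "L (a, b, g) = a * L (1, 0, 0) + b * L (0, 1, 0) + g * L (0, 0, 1)"
proof -
  have "(a, b, g) = a *\<^sub>R (1, 0, 0) + b *\<^sub>R (0, 1, 0) + g *\<^sub>R (0, 0, 1)" by simp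
  then show ?thesis by (simp only: linear_add[OF assms] linear_scale[OF assms]) simp
qed

lemma linear_pair:
  fixes L :: "real \<times> real \<Rightarrow> real"
  assumes "linear L"
  shows "L (a, b) = a * L (1, 0) + b * L (0, 1)"
proof -
  have "(a, b) = a *\<^sub>R (1, 0) + b *\<^sub>R (0, 1)" by simp
  then show ?thesis by (simp only: linear_add[OF assms] linear_scale[OF assms]) simp
qed

lemma Ck_on_Suc_has_derivative:
  assumes "Ck_on (Suc n) f S" "open S" "x \<in> S"
  shows "(f has_derivative frechet_derivative f (at x)) (at x)"
proof -
  have "f differentiable (at x)"
    using assms(1,3) by (auto simp: differentiable_on_def at_within_open[OF assms(3,2)])
  then show ?thesis by (simp add: frechet_derivative_works)
qed

lemma Ck_on_continuous: "Ck_on n f S \<Longrightarrow> continuous_on S f"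
  by (cases n) (auto intro: differentiable_imp_continuous_on)

lemma DERIV_along_path:
  fixes f :: "'a::euclidean_space \<Rightarrow> real"
  assumes "(f has_derivative D) (at (p s))" "(p has_vector_derivative p') (at s)"
  shows "((\<lambda>s. f (p s)) has_real_derivative D p') (at s)"
proof -
  have "((\<lambda>s. f (p s)) has_derivative (\<lambda>h. D (h *\<^sub>R p'))) (at s)"
    using diff_chain_at[OF assms(2)[unfolded has_vector_derivative_def] assms(1)] by (simp add: o_def)
  moreover have "D (h *\<^sub>R p') = D p' * h" for h
    using linear_scale[OF has_derivative_linear[OF assms(1)]] by simp
  ultimately show ?thesis by (simp add: has_field_derivative_def)
qed

locale wave_point =
  fixes \<delta> F :: real and \<Omega> :: "(real \<times> real) set" and c :: "real \<Rightarrow> real \<Rightarrow> real"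
    and H :: "real \<Rightarrow> real \<Rightarrow> real \<Rightarrow> real" and k b :: real
  assumes delta: "\<delta> > 0" and froude: "F > 0" and family: "wave_family \<delta> F \<Omega> c H" and point: "(k, b) \<in> \<Omega>"
begin

abbreviation "Hf \<equiv> \<lambda>(k, b, y). H k b y"
abbreviation "cf \<equiv> \<lambda>(k, b). c k b"
definition "wave_dom = {(k, b, y::real). (k, b) \<in> \<Omega>}"
definition "DH v x = frechet_derivative Hf (at x) v"
definition "DDH u v x = frechet_derivative (DH u) (at x) v"
definition "Dc v x = frechet_derivative cf (at x) v"

lemma open_Omega: "open \<Omega>" and k_nonzero: "(k', b') \<in> \<Omega> \<Longrightarrow> k' \<noteq> 0"
  and profile: "(k', b') \<in> \<Omega> \<Longrightarrow> periodic_profile \<delta> F k' b' (c k' b') (H k' b')"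
  using family by (auto simp: wave_family_def)

lemma open_dom: "open wave_dom"
proof -
  have "wave_dom = (\<lambda>x. (fst x, fst (snd x))) -` \<Omega>" by (auto simp: wave_dom_def)
  then show ?thesis
    by (simp only:) (intro open_vimage open_Omega continuous_intros)
qed

lemma smooth_H: "Ck_on n Hf wave_dom" and smooth_c: "Ck_on n cf \<Omega>"
  using family by (auto simp: wave_family_def smooth_on_def wave_dom_def)

lemma Ck_DH: "Ck_on n (DH v) wave_dom"
  using smooth_H[of "Suc n"] unfolding Ck_on.simps(2) DH_def[abs_def] by blast

lemma Ck_DDH: "Ck_on n (DDH u v) wave_dom"
  using Ck_DH[of "Suc n" u] unfolding Ck_on.simps(2) DDH_def[abs_def] by blast

lemma Ck_Dc: "Ck_on n (Dc v) \<Omega>"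
  using smooth_c[of "Suc n"] unfolding Ck_on.simps(2) Dc_def[abs_def] by blast

lemma Hf_derivative: "x \<in> wave_dom \<Longrightarrow> (Hf has_derivative (\<lambda>v. DH v x)) (at x)"
  unfolding DH_def by (rule Ck_on_Suc_has_derivative[OF smooth_H[of "Suc 0"] open_dom])

lemma DH_derivative: "x \<in> wave_dom \<Longrightarrow> (DH u has_derivative (\<lambda>v. DDH u v x)) (at x)"
  unfolding DDH_def by (rule Ck_on_Suc_has_derivative[OF Ck_DH[of "Suc 0"] open_dom])

lemma cf_derivative: "x \<in> \<Omega> \<Longrightarrow> (cf has_derivative (\<lambda>v. Dc v x)) (at x)"
  unfolding Dc_def by (rule Ck_on_Suc_has_derivative[OF smooth_c[of "Suc 0"] open_Omega])

lemma DH_split: "x \<in> wave_dom \<Longrightarrow> DH (\<alpha>, \<beta>, \<gamma>) x = \<alpha> * DH (1, 0, 0) x + \<beta> * DH (0, 1, 0) x + \<gamma> * DH (0, 0, 1) x"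
  by (rule linear_triple[of "\<lambda>v. DH v x"]) (rule has_derivative_linear[OF Hf_derivative])

lemma DDH_split: "x \<in> wave_dom \<Longrightarrow>
    DDH u (\<alpha>, \<beta>, \<gamma>) x = \<alpha> * DDH u (1, 0, 0) x + \<beta> * DDH u (0, 1, 0) x + \<gamma> * DDH u (0, 0, 1) x"
  by (rule linear_triple[of "\<lambda>v. DDH u v x"]) (rule has_derivative_linear[OF DH_derivative])

lemma Dc_split: "x \<in> \<Omega> \<Longrightarrow> Dc (\<alpha>, \<beta>) x = \<alpha> * Dc (1, 0) x + \<beta> * Dc (0, 1) x"
  by (rule linear_pair[of "\<lambda>v. Dc v x"]) (rule has_derivative_linear[OF cf_derivative])

lemma DERIV_H_path:
  assumes "p s \<in> wave_dom" "(p has_vector_derivative p') (at s)"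
  shows "((\<lambda>s. Hf (p s)) has_real_derivative DH p' (p s)) (at s)"
  by (rule DERIV_along_path[OF Hf_derivative[OF assms(1)] assms(2)])

lemma DERIV_H:
  assumes "(k', b') \<in> \<Omega>"
  shows DERIV_H_y: "(H k' b' has_real_derivative DH (0, 0, 1) (k', b', y)) (at y)"
    and DERIV_H_k: "((\<lambda>k. H k b' y) has_real_derivative DH (1, 0, 0) (k', b', y)) (at k')"
    and DERIV_H_b: "((\<lambda>b. H k' b y) has_real_derivative DH (0, 1, 0) (k', b', y)) (at b')"
  using DERIV_H_path[of "\<lambda>y. (k', b', y)" y "(0, 0, 1)"] DERIV_H_path[of "\<lambda>k. (k, b', y)" k' "(1, 0, 0)"]
    DERIV_H_path[of "\<lambda>b. (k', b, y)" b' "(0, 1, 0)"] assms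
  by (simp_all add: wave_dom_def has_vector_derivative_Pair has_vector_derivative_const has_vector_derivative_id)

lemma DERIV_c:
  assumes "(k', b') \<in> \<Omega>"
  shows DERIV_c_k: "((\<lambda>k. c k b') has_real_derivative Dc (1, 0) (k', b')) (at k')"
    and DERIV_c_b: "((\<lambda>b. c k' b) has_real_derivative Dc (0, 1) (k', b')) (at b')"
  using DERIV_along_path[OF cf_derivative, of "\<lambda>k. (k, b')" k' "(1, 0)"]
    DERIV_along_path[OF cf_derivative, of "\<lambda>b. (k', b)" b' "(0, 1)"] assms
  by (simp_all add: has_vector_derivative_Pair has_vector_derivative_const has_vector_derivative_id)

lemma H_nonzero: "(k', b') \<in> \<Omega> \<Longrightarrow> H k' b' y \<noteq> 0"
  and H_periodic: "(k', b') \<in> \<Omega> \<Longrightarrow> H k' b' (y + 1) = H k' b' y"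
  using profile by (auto simp: periodic_profile_def)

text \<open>The profile equation in divergence form: \<open>k c\<^sup>2 H' = k c Q'\<close> is a derivative too.\<close>

lemma profile_flux:
  assumes "(k', b') \<in> \<Omega>"
  defines "Q \<equiv> Qprof c H k' b'"
  shows "((\<lambda>y. \<delta> * k'\<^sup>2 * (c k' b' * DH (0, 0, 1) (k', b', y)) - k' * Gflux F (H k' b' y) (Q y) + k' * c k' b' * Q y)
    has_real_derivative - Ssrc (H k' b' y) (Q y)) (at y)"
proof -
  let ?h = "H k' b'" and ?h' = "\<lambda>y. DH (0, 0, 1) (k', b', y)" and ?s = "c k' b'"
  have h: "(?h has_real_derivative ?h' y) (at y)" for y by (rule DERIV_H_y[OF assms(1)])
  have Q: "(Q has_real_derivative ?s * ?h' y) (at y)" for y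
    unfolding Q_def Qprof_def[abs_def] by (auto intro!: derivative_eq_intros h)
  have dh: "deriv ?h = ?h'" and dQ: "deriv Q = (\<lambda>y. ?s * ?h' y)"
    using h Q by (auto intro!: DERIV_imp_deriv)
  have h2: "(?h' has_real_derivative DDH (0, 0, 1) (0, 0, 1) (k', b', y)) (at y)" for y
  proof -
    have 1: "((\<lambda>y. (k', b', y)) has_vector_derivative (0, 0, 1)) (at y)"
      by (intro has_vector_derivative_Pair has_vector_derivative_const has_vector_derivative_id)
    have "(DH (0, 0, 1) has_derivative (\<lambda>v. DDH (0, 0, 1) v (k', b', y))) (at (k', b', y))"
      using assms by (intro DH_derivative) (simp add: wave_dom_def)
    from DERIV_along_path[OF this 1] show ?thesis by simp
  qed
  have G: "((\<lambda>z. Gflux F (?h z) (Q z)) has_real_derivative deriv (\<lambda>z. Gflux F (?h z) (Q z)) y) (at y)"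
    unfolding DERIV_imp_deriv[OF DERIV_Gflux[OF h Q H_nonzero[OF assms(1)]]]
    by (rule DERIV_Gflux[OF h Q H_nonzero[OF assms(1)]])
  have ddQ: "deriv (deriv Q) y = ?s * DDH (0, 0, 1) (0, 0, 1) (k', b', y)"
    unfolding dQ by (auto intro!: DERIV_imp_deriv derivative_eq_intros h2)
  have "k' * ?s\<^sup>2 * deriv ?h y + calG \<delta> F k' ?h Q y = 0"
    using profile[OF assms(1)] by (auto simp: periodic_profile_def Q_def Qprof_def[abs_def])
  then have eq: "- Ssrc (?h y) (Q y) = \<delta> * k'\<^sup>2 * (?s * DDH (0, 0, 1) (0, 0, 1) (k', b', y))
     - k' * deriv (\<lambda>z. Gflux F (?h z) (Q z)) y + k' * ?s * (?s * ?h' y)"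
    by (simp add: calG_def ddQ dh power2_eq_square)
  show ?thesis
    unfolding eq
    by (rule DERIV_add[OF DERIV_diff[OF DERIV_cmult[OF DERIV_cmult[OF h2]] DERIV_cmult[OF G]] DERIV_cmult[OF Q]])
qed

abbreviation "H_y y \<equiv> DH (0, 0, 1) (k, b, y)"
abbreviation "H_k y \<equiv> DH (1, 0, 0) (k, b, y)"
abbreviation "H_b y \<equiv> DH (0, 1, 0) (k, b, y)"

definition "gh y = complex_of_real (dhG F (H k b y) (Qprof c H k b y))"
definition "gq y = complex_of_real (dqG F (H k b y) (Qprof c H k b y))"
definition "sh y = complex_of_real (dhS (H k b y) (Qprof c H k b y))"
definition "sq y = complex_of_real (dqS (H k b y) (Qprof c H k b y))"

lemma continuous_H: "(k', b') \<in> \<Omega> \<Longrightarrow> continuous_on UNIV (H k' b')"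
  using DERIV_H_y by (meson DERIV_continuous continuous_at_imp_continuous_on)

lemma continuous_Q: "(k', b') \<in> \<Omega> \<Longrightarrow> continuous_on UNIV (Qprof c H k' b')"
  unfolding Qprof_def[abs_def] by (intro continuous_intros continuous_H)

lemma coefficients_continuous:
  "continuous_on UNIV gh" "continuous_on UNIV gq" "continuous_on UNIV sh" "continuous_on UNIV sq"
  unfolding gh_def[abs_def] gq_def[abs_def] sh_def[abs_def] sq_def[abs_def]
    dhG_eq[OF H_nonzero[OF point]] dqG_eq dhS_eq[OF H_nonzero[OF point]] dqS_eq
  by (auto intro!: continuous_intros continuous_H continuous_Q point simp: H_nonzero[OF point] froude[THEN less_imp_neq, symmetric])

end

sublocale wave_point \<subseteq> weak_system "complex_of_real (\<delta> * k\<^sup>2)" "complex_of_real k" "complex_of_real (c k b)"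
  "complex_of_real (freq c k b)" gh gq sh sq
  using delta k_nonzero[OF point] coefficients_continuous by unfold_locales auto

context wave_point
begin

text \<open>Derivative at \<open>s = 0\<close> of the height \<open>H (k + \<alpha>s) (b + \<beta>s) ((1 + \<alpha>s/k) y + \<gamma>s)\<close>. The factor \<open>1 + \<alpha>s/k\<close>
rescales the wave with wavenumber \<open>k + \<alpha>s\<close> to the variable of the wave with wavenumber \<open>k\<close>. The functions
\<open>c_dir\<close> and \<open>q_dir\<close> are the corresponding derivatives of the speed and of the discharge.\<close>

definition "h_dir \<alpha> \<beta> \<gamma> y = \<alpha> * H_k y + \<beta> * H_b y
   + (\<alpha> * y / k + \<gamma>) * H_y y"
definition "c_dir \<alpha> \<beta> = \<alpha> * Dc (1, 0) (k, b) + \<beta> * Dc (0, 1) (k, b)"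
definition "q_dir \<alpha> \<beta> \<gamma> y = c_dir \<alpha> \<beta> * H k b y + c k b * h_dir \<alpha> \<beta> \<gamma> y - \<beta>"

text \<open>All rescaled and translated profiles solve the travelling wave equation with the same wavenumber \<open>k\<close>;
only the speed and the constant of integration vary with \<open>s\<close>. Differentiation of the equation at \<open>s = 0\<close>
therefore gives the linearized operator on the left, and only the change of speed on the right.\<close>

lemma tangent_solves:
  "solves (\<lambda>y. (of_real (h_dir \<alpha> \<beta> \<gamma> y), of_real (q_dir \<alpha> \<beta> \<gamma> y)))
     (\<lambda>y. of_real (- k * c_dir \<alpha> \<beta>) \<odot> (of_real (H_y y), of_real (c k b * H_y y)))"
proof -
  define ks where "ks s = k + \<alpha> * s" for s
  define bs where "bs s = b + \<beta> * s" for s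
  define \<mu> where "\<mu> s = 1 + \<alpha> * s / k" for s
  define \<phi> where "\<phi> s y = (ks s, bs s, \<mu> s * y + \<gamma> * s)" for s y
  define cs where "cs s = c (ks s) (bs s)" for s
  define h where "h s y = Hf (\<phi> s y)" for s y
  define q where "q s y = cs s * h s y - bs s" for s y
  define c' where "c' s = \<alpha> * Dc (1, 0) (ks s, bs s) + \<beta> * Dc (0, 1) (ks s, bs s)" for s
  define hs where "hs s y = \<alpha> * DH (1, 0, 0) (\<phi> s y) + \<beta> * DH (0, 1, 0) (\<phi> s y)
     + (\<alpha> * y / k + \<gamma>) * DH (0, 0, 1) (\<phi> s y)" for s y
  define hy where "hy s y = \<mu> s * DH (0, 0, 1) (\<phi> s y)" for s y
  define hys where "hys s y = \<alpha> / k * DH (0, 0, 1) (\<phi> s y) +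
     \<mu> s * (\<alpha> * DDH (0, 0, 1) (1, 0, 0) (\<phi> s y) + \<beta> * DDH (0, 0, 1) (0, 1, 0) (\<phi> s y)
     + (\<alpha> * y / k + \<gamma>) * DDH (0, 0, 1) (0, 0, 1) (\<phi> s y))" for s y
  define qs where "qs s y = c' s * h s y + cs s * hs s y - \<beta>" for s y
  define qys where "qys s y = c' s * hy s y + cs s * hys s y" for s y
  have k0: "k \<noteq> 0" by (rule k_nonzero[OF point])
  have "open ((\<lambda>s. (ks s, bs s)) -` \<Omega>)"
    unfolding ks_def bs_def by (intro open_vimage open_Omega continuous_intros)
  moreover have "0 \<in> (\<lambda>s. (ks s, bs s)) -` \<Omega>" using point by (simp add: ks_def bs_def)
  ultimately obtain e where e: "e > 0" "ball 0 e \<subseteq> (\<lambda>s. (ks s, bs s)) -` \<Omega>"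
    by (meson openE)
  define U where "U = ball (0::real) e"
  have U: "open U" "0 \<in> U" using e by (auto simp: U_def)
  have in_Omega: "(ks s, bs s) \<in> \<Omega>" if "s \<in> U" for s using e that by (auto simp: U_def)
  then have in_dom: "\<phi> s y \<in> wave_dom" if "s \<in> U" for s y using that by (simp add: wave_dom_def \<phi>_def)
  have \<mu>_nz: "\<mu> s \<noteq> 0" if "s \<in> U" for s
    using k_nonzero[OF in_Omega[OF that]] k0 by (auto simp: ks_def \<mu>_def field_simps)
  \<comment> \<open>the rescaled profile has wavenumber \<open>k\<close> for every \<open>s\<close>\<close>
  have k_mu: "k * \<mu> s = ks s" for s using k0 by (simp add: ks_def \<mu>_def field_simps)

  have \<phi>_s: "((\<lambda>s. \<phi> s y) has_vector_derivative (\<alpha>, \<beta>, \<alpha> * y / k + \<gamma>)) (at s)" for s y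
  proof -
    have "(ks has_vector_derivative \<alpha>) (at s)" "(bs has_vector_derivative \<beta>) (at s)"
      "((\<lambda>s. \<mu> s * y + \<gamma> * s) has_vector_derivative \<alpha> * y / k + \<gamma>) (at s)"
      unfolding has_real_derivative_iff_has_vector_derivative[symmetric] ks_def[abs_def] bs_def[abs_def] \<mu>_def
      by (auto intro!: derivative_eq_intros simp: k0)
    then show ?thesis unfolding \<phi>_def by (intro has_vector_derivative_Pair)
  qed
  have \<phi>_y: "((\<lambda>y. \<phi> s y) has_vector_derivative (0, 0, \<mu> s)) (at y)" for s y
  proof -
    have "((\<lambda>y. \<mu> s * y + \<gamma> * s) has_vector_derivative \<mu> s) (at y)"
      unfolding has_real_derivative_iff_has_vector_derivative[symmetric]
      by (auto intro!: derivative_eq_intros)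
    then show ?thesis unfolding \<phi>_def by (intro has_vector_derivative_Pair has_vector_derivative_const)
  qed
  have h_s: "((\<lambda>s. h s y) has_real_derivative hs s y) (at s)" if "s \<in> U" for s y
    using DERIV_H_path[OF in_dom[OF that] \<phi>_s] DH_split[OF in_dom[OF that]]
    unfolding h_def hs_def by metis
  have h_y: "(h s has_real_derivative hy s y) (at y)" if "s \<in> U" for s y
    using DERIV_H_path[where p = "\<phi> s" and s = y, OF in_dom[OF that] \<phi>_y]
      DH_split[OF in_dom[OF that], of 0 0 "\<mu> s" y]
    unfolding h_def[abs_def] hy_def by simp
  have hy_s: "((\<lambda>s. hy s y) has_real_derivative hys s y) (at s)" if "s \<in> U" for s y
  proof -
    have "((\<lambda>s. DH (0, 0, 1) (\<phi> s y)) has_real_derivative DDH (0, 0, 1) (\<alpha>, \<beta>, \<alpha> * y / k + \<gamma>) (\<phi> s y)) (at s)"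
      by (rule DERIV_along_path[OF DH_derivative[OF in_dom[OF that]] \<phi>_s])
    moreover have "(\<mu> has_real_derivative \<alpha> / k) (at s)"
      unfolding \<mu>_def[abs_def] by (auto intro!: derivative_eq_intros simp: k0)
    ultimately show ?thesis
      unfolding hy_def hys_def DDH_split[OF in_dom[OF that], symmetric]
      by (auto intro!: derivative_eq_intros)
  qed
  have c_s: "(cs has_real_derivative c' s) (at s)" if "s \<in> U" for s
  proof -
    have "((\<lambda>s. (ks s, bs s)) has_vector_derivative (\<alpha>, \<beta>)) (at s)"
      unfolding ks_def bs_def
      by (intro has_vector_derivative_Pair) (auto intro!: derivative_eq_intros simp: has_real_derivative_iff_has_vector_derivative[symmetric])
    from DERIV_along_path[OF cf_derivative[OF in_Omega[OF that]] this] Dc_split[OF in_Omega[OF that], of \<alpha> \<beta>]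
    show ?thesis by (simp add: cs_def[abs_def] c'_def)
  qed
  have b_s: "(bs has_real_derivative \<beta>) (at s)" for s
    unfolding bs_def[abs_def] by (auto intro!: derivative_eq_intros)
  have q_s: "((\<lambda>s. q s y) has_real_derivative qs s y) (at s)" if "s \<in> U" for s y
    unfolding q_def qs_def by (auto intro!: derivative_eq_intros c_s[OF that] h_s[OF that] b_s)
  have q_y: "(q s has_real_derivative cs s * hy s y) (at y)" if "s \<in> U" for s y
    unfolding q_def[abs_def] by (auto intro!: derivative_eq_intros h_y[OF that])
  have qy_s: "((\<lambda>s. cs s * hy s y) has_real_derivative qys s y) (at s)" if "s \<in> U" for s y
    unfolding qys_def by (auto intro!: derivative_eq_intros c_s[OF that] hy_s[OF that])

  have cont_path: "continuous_on (U \<times> UNIV) (\<lambda>(s, y). f (\<phi> s y))" if "continuous_on wave_dom f" for f :: "_ \<Rightarrow> real"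
  proof -
    have "continuous_on (U \<times> UNIV) (\<lambda>x. f (\<phi> (fst x) (snd x)))"
      by (rule continuous_on_compose2[OF that])
        (auto simp: \<phi>_def ks_def bs_def \<mu>_def divide_inverse k0 wave_dom_def intro!: continuous_intros in_Omega[unfolded ks_def bs_def])
    then show ?thesis by (simp add: case_prod_unfold)
  qed
  have cont_pair: "continuous_on (U \<times> UNIV) (\<lambda>(s, y::real). g s)" if "continuous_on U g" for g :: "real \<Rightarrow> real"
    using continuous_on_compose2[OF that continuous_on_fst[OF continuous_on_id], of "U \<times> UNIV"]
    by (auto simp: case_prod_unfold)
  have cont_c: "continuous_on U cs" using c_s by (meson DERIV_continuous continuous_at_imp_continuous_on)
  have cont_c': "continuous_on U c'"
  proof -
    have "continuous_on U (\<lambda>s. Dc v (ks s, bs s))" for v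
      by (rule continuous_on_compose2[OF Ck_on_continuous[OF Ck_Dc[of 0]]])
        (auto simp: ks_def bs_def intro!: continuous_intros in_Omega[unfolded ks_def bs_def])
    then show ?thesis unfolding c'_def by (intro continuous_intros)
  qed
  have cont_mu: "continuous_on U \<mu>" unfolding \<mu>_def by (auto intro!: continuous_intros simp: k0)
  have cont_bs: "continuous_on U bs" unfolding bs_def by (intro continuous_intros)
  note cont = cont_path[OF Ck_on_continuous[OF smooth_H[of 0]]] cont_path[OF Ck_on_continuous[OF Ck_DH[of 0]]]
    cont_path[OF Ck_on_continuous[OF Ck_DDH[of 0]]] cont_pair[OF cont_c] cont_pair[OF cont_c'] cont_pair[OF cont_mu] cont_pair[OF cont_bs]
  note cont' = cont[unfolded case_prod_unfold]
  have cont_h: "continuous_on (U \<times> UNIV) (\<lambda>x. h (fst x) (snd x))"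
    unfolding h_def using cont'(1) by (simp add: case_prod_unfold)
  have cont_hs: "continuous_on (U \<times> UNIV) (\<lambda>x. hs (fst x) (snd x))"
    unfolding hs_def divide_inverse by (intro continuous_intros cont')
  have cont_hy: "continuous_on (U \<times> UNIV) (\<lambda>x. hy (fst x) (snd x))"
    unfolding hy_def divide_inverse by (intro continuous_intros cont')
  have cont_hys: "continuous_on (U \<times> UNIV) (\<lambda>x. hys (fst x) (snd x))"
    unfolding hys_def divide_inverse by (intro continuous_intros cont')
  have cont_q: "continuous_on (U \<times> UNIV) (\<lambda>x. q (fst x) (snd x))"
    unfolding q_def by (intro continuous_intros cont_h cont')
  have cont_qs: "continuous_on (U \<times> UNIV) (\<lambda>x. qs (fst x) (snd x))"
    unfolding qs_def by (intro continuous_intros cont_h cont_hs cont')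
  have cont_qys: "continuous_on (U \<times> UNIV) (\<lambda>x. qys (fst x) (snd x))"
    unfolding qys_def by (intro continuous_intros cont_hy cont_hys cont')

  have h_nz: "h s y \<noteq> 0" if "s \<in> U" for s y
    using H_nonzero[OF in_Omega[OF that]] by (simp add: h_def \<phi>_def)
  define R where "R s y = \<delta> * k\<^sup>2 * (cs s * hy s y) - k * Gflux F (h s y) (q s y) + k * cs s * q s y" for s y
  have R_y: "(R s has_real_derivative - Ssrc (h s y) (q s y)) (at y)" if "s \<in> U" for s y
  proof -
    let ?z = "\<lambda>y. \<mu> s * y + \<gamma> * s"
    let ?P = "\<lambda>z. \<delta> * (ks s)\<^sup>2 * (cs s * DH (0, 0, 1) (ks s, bs s, z)) - ks s * Gflux F (H (ks s) (bs s) z)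
         (Qprof c H (ks s) (bs s) z) + ks s * cs s * Qprof c H (ks s) (bs s) z"
    have q: "Qprof c H (ks s) (bs s) (?z y) = q s y" for y by (simp add: Qprof_def q_def h_def \<phi>_def cs_def)
    have a1: "(?P has_real_derivative - Ssrc (H (ks s) (bs s) (?z y)) (Qprof c H (ks s) (bs s) (?z y))) (at (?z y))"
      unfolding cs_def by (rule profile_flux[OF in_Omega[OF that]])
    have a2: "(?z has_real_derivative \<mu> s) (at y)" by (auto intro!: derivative_eq_intros)
    from DERIV_chain2[OF a1 a2]
    have "((\<lambda>y. ?P (?z y)) has_real_derivative - Ssrc (h s y) (q s y) * \<mu> s) (at y)"
      by (simp add: q h_def \<phi>_def)
    then have "((\<lambda>y. ?P (?z y) / \<mu> s) has_real_derivative - Ssrc (h s y) (q s y) * \<mu> s / \<mu> s) (at y)"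
      by (rule DERIV_cdivide)
    moreover have "?P (?z y) / \<mu> s = R s y" for y
      unfolding q R_def using \<mu>_nz[OF that]
      by (simp add: h_def \<phi>_def hy_def k_mu[symmetric] field_simps power2_eq_square)
    ultimately show ?thesis using \<mu>_nz[OF that] by simp
  qed
  have at_0: "ks 0 = k" "bs 0 = b" "\<mu> 0 = 1" "\<phi> 0 y = (k, b, y)" "cs 0 = c k b" "h 0 y = H k b y"
    "q 0 y = Qprof c H k b y" "c' 0 = c_dir \<alpha> \<beta>" "hs 0 y = h_dir \<alpha> \<beta> \<gamma> y" "qs 0 y = q_dir \<alpha> \<beta> \<gamma> y"
    "hy 0 y = H_y y" for y
    by (simp_all add: ks_def bs_def \<mu>_def \<phi>_def cs_def h_def q_def c'_def hs_def qs_def hy_def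
        c_dir_def h_dir_def q_dir_def Qprof_def)

  have wd_q: "has_weak_deriv (\<lambda>y. complex_of_real (qs 0 y)) (\<lambda>y. complex_of_real (qys 0 y))"
  proof (rule has_weak_deriv_parameter[OF U, where f = q])
    show "((\<lambda>y. cs s * hy s y) has_integral q s b - q s a) {a..b}" if "s \<in> U" "a \<le> b" for s a b
      using q_y[OF that(1)] by (intro fundamental_theorem_of_calculus that)
        (auto simp: has_real_derivative_iff_has_vector_derivative[symmetric] intro: has_field_derivative_at_within)
  qed (use U q_s qy_s cont_qys in \<open>auto simp: case_prod_unfold\<close>)

  have R_s: "((\<lambda>s. R s y) has_real_derivative \<delta> * k\<^sup>2 * qys s y - k * (dhG F (h s y) (q s y) * hs s y + dqG F (h s y) (q s y) * qs s y)
     + (k * c' s * q s y + k * cs s * qs s y)) (at s)" if "s \<in> U" for s y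
    unfolding R_def
    by (rule DERIV_cong[OF DERIV_add[OF DERIV_diff[OF DERIV_cmult[OF qy_s[OF that]]
            DERIV_cmult[OF DERIV_Gflux[OF h_s[OF that] q_s[OF that] h_nz[OF that]]]]
          DERIV_mult[OF DERIV_cmult[OF c_s[OF that]] q_s[OF that]]]]) simp
  have cont_S: "continuous_on (U \<times> UNIV) (\<lambda>x. dhS (h (fst x) (snd x)) (q (fst x) (snd x)) * hs (fst x) (snd x)
      + dqS (h (fst x) (snd x)) (q (fst x) (snd x)) * qs (fst x) (snd x))"
  proof (rule continuous_on_eq)
    show "continuous_on (U \<times> UNIV) (\<lambda>x. (1 + 2 * (q (fst x) (snd x))\<^sup>2 / (h (fst x) (snd x)) ^ 3) * hs (fst x) (snd x)
      + (- 2 * q (fst x) (snd x) / (h (fst x) (snd x))\<^sup>2) * qs (fst x) (snd x))"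
      by (intro continuous_intros cont_h cont_q cont_hs cont_qs) (use h_nz in auto)
  qed (use h_nz in \<open>auto simp: dhS_eq dqS_eq\<close>)
  have wd_R: "has_weak_deriv (\<lambda>y. complex_of_real (\<delta> * k\<^sup>2 * qys 0 y - k * (dhG F (h 0 y) (q 0 y) * hs 0 y + dqG F (h 0 y) (q 0 y) * qs 0 y)
     + (k * c' 0 * q 0 y + k * cs 0 * qs 0 y)))
     (\<lambda>y. complex_of_real (- (dhS (h 0 y) (q 0 y) * hs 0 y + dqS (h 0 y) (q 0 y) * qs 0 y)))"
  proof (rule has_weak_deriv_parameter[OF U, where f = R and g = "\<lambda>s y. - Ssrc (h s y) (q s y)"
        and g' = "\<lambda>s y. - (dhS (h s y) (q s y) * hs s y + dqS (h s y) (q s y) * qs s y)"])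
    show "((\<lambda>y. - Ssrc (h s y) (q s y)) has_integral R s b - R s a) {a..b}" if "s \<in> U" "a \<le> b" for s a b
      using R_y[OF that(1)] by (intro fundamental_theorem_of_calculus that)
        (auto simp: has_real_derivative_iff_has_vector_derivative[symmetric] intro: has_field_derivative_at_within)
    show "((\<lambda>s. - Ssrc (h s y) (q s y)) has_real_derivative
      - (dhS (h s y) (q s y) * hs s y + dqS (h s y) (q s y) * qs s y)) (at s)" if "s \<in> U" for s y
      by (intro DERIV_minus DERIV_Ssrc[OF h_s q_s] h_nz that)
    show "continuous_on (U \<times> UNIV) (\<lambda>(s, y). - (dhS (h s y) (q s y) * hs s y + dqS (h s y) (q s y) * qs s y))"
      using continuous_on_minus[OF cont_S] by (simp add: case_prod_unfold)
  qed (rule R_s[OF U(2)])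

  have cont_hy0: "continuous_on UNIV (\<lambda>y. H_y y)"
    by (rule continuous_on_compose2[OF Ck_on_continuous[OF Ck_DH[of 0]]])
      (auto intro!: continuous_intros simp: wave_dom_def point)
  have wd_h: "has_weak_deriv (\<lambda>y. complex_of_real (H k b y)) (\<lambda>y. complex_of_real (H_y y))"
    by (intro has_weak_deriv_classical has_vector_derivative_of_real DERIV_H_y[OF point] continuous_intros cont_hy0)
  have one: "has_weak_deriv (\<lambda>y. complex_of_real a) (\<lambda>y. 0)" for a
    by (intro has_weak_deriv_classical) auto
  let ?u = "\<lambda>y. (complex_of_real (h_dir \<alpha> \<beta> \<gamma> y), complex_of_real (q_dir \<alpha> \<beta> \<gamma> y))"
  let ?f = "\<lambda>y. complex_of_real (- k * c_dir \<alpha> \<beta>) \<odot> (complex_of_real (H_y y), complex_of_real (c k b * H_y y))"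
  show ?thesis
  proof (rule solvesI)
    show "has_weak_deriv (\<lambda>y. snd (?u y)) (\<lambda>y. complex_of_real (qys 0 y))"
      using wd_q by (simp add: at_0)
    show "has_weak_deriv (mass_flux ?u) (\<lambda>y. fst (?f y) / complex_of_real k)"
      unfolding mass_flux_def[abs_def]
      by (rule has_weak_deriv_cong[OF has_weak_deriv_add[OF
            has_weak_deriv_cmult[OF wd_h, of "of_real (- c_dir \<alpha> \<beta>)"] one[of \<beta>]]])
         (use k0 in \<open>auto simp: q_dir_def\<close>)
    show "has_weak_deriv (momentum_flux ?u (\<lambda>y. complex_of_real (qys 0 y))) (momentum_source ?u ?f)"
      unfolding momentum_flux_def[abs_def] momentum_source_def[abs_def]
      by (rule has_weak_deriv_cong[OF has_weak_deriv_add[OF wd_R has_weak_deriv_add[OF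
            has_weak_deriv_cmult[OF wd_h, of "of_real (- k * c_dir \<alpha> \<beta> * c k b)"] one[of "k * c_dir \<alpha> \<beta> * b"]]]])
         (auto simp: at_0 gh_def gq_def sh_def sq_def freq_def Qprof_def algebra_simps)
  qed
qed

end

section \<open>Bloch waves as solutions of the linearized system\<close>

lemma negligible_shift:
  assumes "negligible {y::real. \<not> P y}" shows "negligible {y. \<not> P (y + a)}"
proof -
  have "{y. \<not> P (y + a)} = (\<lambda>y. -a + y) ` {y. \<not> P y}"
    by (auto intro!: image_eqI[where x = "_ + a"])
  then show ?thesis using negligible_translation[OF assms, of "-a"] by simp
qed

lemma ae_eq_shift: "f \<doteq> g \<Longrightarrow> (\<lambda>y. f (y + a)) \<doteq> (\<lambda>y. g (y + a))" for f g :: "real \<Rightarrow> 'a"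
  unfolding ae_eq_iff_negligible by (rule negligible_shift)

lemma loc_int_shift:
  assumes "loc_int g" shows "loc_int (\<lambda>y. g (y + a))"
    and "integral {s..t} (\<lambda>y. g (y + a)) = integral {s + a..t + a} g"
proof -
  have sh: "((\<lambda>y. f (y + a)) has_integral I) {s..t}" if "(f has_integral I) {s + a..t + a}"
    for f :: "real \<Rightarrow> 'b::euclidean_space" and I s t
  proof -
    have "((\<lambda>y. f (1 *\<^sub>R y + a)) has_integral (1 / \<bar>1\<bar> ^ DIM(real)) *\<^sub>R I)
        ((\<lambda>y. (1 / 1) *\<^sub>R y + - ((1 / 1) *\<^sub>R a)) ` cbox (s + a) (t + a))"
      by (rule has_integral_affinity) (use that in auto)
    moreover have "(\<lambda>y. y - a) ` {s + a..t + a} = {s..t}"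
      by (simp add: image_minus_const_atLeastAtMost')
    ultimately show ?thesis by simp
  qed
  show "integral {s..t} (\<lambda>y. g (y + a)) = integral {s + a..t + a} g"
    by (intro integral_unique sh integrable_integral loc_int_integrable assms)
  show "loc_int (\<lambda>y. g (y + a))"
    unfolding loc_int_def absolutely_integrable_on_def
    using sh[OF integrable_integral[OF loc_int_integrable[OF assms]]]
      sh[OF integrable_integral[OF loc_int_norm_integrable[OF assms]]] by blast
qed

lemma has_weak_deriv_shift:
  assumes "has_weak_deriv f g" shows "has_weak_deriv (\<lambda>y. f (y + a)) (\<lambda>y. g (y + a))"
proof -
  obtain C where g: "loc_int g" and C: "f \<doteq> (\<lambda>y. C + prim g y)"
    using assms by (auto simp: has_weak_deriv_iff)
  show ?thesis
    unfolding has_weak_deriv_def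
  proof (intro exI[of _ "\<lambda>y. C + prim g (y + a)"] conjI allI impI)
    show "(\<lambda>y. f (y + a)) \<doteq> (\<lambda>y. C + prim g (y + a))" by (rule ae_eq_shift[OF C])
    show "(\<lambda>y. g (y + a)) absolutely_integrable_on {s..t}" for s t
      by (rule loc_intD[OF loc_int_shift(1)[OF g]])
    show "C + prim g (t + a) - (C + prim g (s + a)) = integral {s..t} (\<lambda>y. g (y + a))" if "s \<le> t" for s t
      using prim_diff[OF g, of "s + a" "t + a"] that loc_int_shift(2)[OF g] by simp
  qed
qed

text \<open>The continuous representative of \<open>f\<close> is periodic as well, so its increment over a period, which is
the integral of \<open>g\<close>, vanishes.\<close>

lemma periodic_weak_deriv_mean_zero:
  assumes f: "has_weak_deriv f g" and per: "\<And>y. f (y + 1) = f y"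
  shows "integral {0..1} g = 0"
proof -
  obtain C where g: "loc_int g" and C: "f \<doteq> (\<lambda>y. C + prim g y)"
    using f by (auto simp: has_weak_deriv_iff)
  have cp: "continuous_on UNIV (prim g)" by (rule continuous_on_prim[OF g])
  have "(\<lambda>y. C + prim g (y + 1)) = (\<lambda>y. C + prim g y)"
  proof (rule continuous_ae_eq_imp_eq)
    show "continuous_on UNIV (\<lambda>y. C + prim g (y + 1))"
      by (intro continuous_intros continuous_on_compose2[OF cp]) auto
    show "(\<lambda>y. C + prim g (y + 1)) \<doteq> (\<lambda>y. C + prim g y)"
      using ae_eq_shift[OF C, of 1] C unfolding per by eventually_elim simp
  qed (intro continuous_intros cp)
  then have "C + prim g (0 + 1) = C + prim g 0" by (rule fun_cong)
  then show ?thesis using prim_diff[OF g, of 0 1] by simp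
qed

lemma has_vector_derivative_cis: "((\<lambda>y. cis (l * y)) has_vector_derivative \<i> * of_real l * cis (l * y)) (at y)"
proof -
  have "((\<lambda>y. exp (\<i> * of_real l * of_real y)) has_vector_derivative \<i> * of_real l * exp (\<i> * of_real l * of_real y)) (at y)"
    by (rule has_vector_derivative_real_field) (auto intro!: derivative_eq_intros)
  then show ?thesis by (simp add: cis_conv_exp mult.assoc)
qed

lemma has_weak_deriv_cis:
  assumes "has_weak_deriv f g"
  shows "has_weak_deriv (\<lambda>y. cis (l * y) * f y) (\<lambda>y. \<i> * of_real l * cis (l * y) * f y + cis (l * y) * g y)"
  by (rule has_weak_deriv_mult[OF has_vector_derivative_cis _ assms]) (intro continuous_intros)

context wave_point
begin

abbreviation "Uy \<equiv> dyU c H k b"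
abbreviation "Uk \<equiv> dkU c H k b"
abbreviation "Ub \<equiv> dbU c H k b"
abbreviation "T \<equiv> bloch \<delta> F c H k b"

lemma DERIV_Q_y: "(k', b') \<in> \<Omega> \<Longrightarrow>
    (Qprof c H k' b' has_real_derivative c k' b' * DH (0, 0, 1) (k', b', y)) (at y)"
  unfolding Qprof_def[abs_def] by (auto intro!: derivative_eq_intros DERIV_H_y)

lemma d1_c: "d1 c k b = Dc (1, 0) (k, b)" and d2_c: "d2 c k b = Dc (0, 1) (k, b)"
  unfolding d1_def d2_def using DERIV_c_k[OF point] DERIV_c_b[OF point] by (auto intro: DERIV_imp_deriv)

lemma dyU_eq: "Uy y = (of_real (H_y y), of_real (c k b * H_y y))"
  unfolding dyU_def DERIV_imp_deriv[OF DERIV_H_y[OF point]] DERIV_imp_deriv[OF DERIV_Q_y[OF point]] ..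

lemma dkU_eq: "Uk y = (of_real (H_k y),
    of_real (d1 c k b * H k b y + c k b * H_k y))"
proof -
  have "((\<lambda>k'. Qprof c H k' b y) has_real_derivative Dc (1, 0) (k, b) * H k b y + c k b * H_k y) (at k)"
    unfolding Qprof_def by (auto intro!: derivative_eq_intros DERIV_H_k[OF point] DERIV_c_k[OF point])
  then show ?thesis unfolding dkU_def d1_c
    by (simp add: d1_def DERIV_imp_deriv[OF DERIV_H_k[OF point]] DERIV_imp_deriv)
qed

lemma dbU_eq: "Ub y = (of_real (H_b y),
    of_real (d2 c k b * H k b y + c k b * H_b y - 1))"
proof -
  have "((\<lambda>b'. Qprof c H k b' y) has_real_derivative Dc (0, 1) (k, b) * H k b y + c k b * H_b y - 1) (at b)"
    unfolding Qprof_def by (auto intro!: derivative_eq_intros DERIV_H_b[OF point] DERIV_c_b[OF point])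
  then show ?thesis unfolding dbU_def d2_c
    by (simp add: d2_def DERIV_imp_deriv[OF DERIV_H_b[OF point]] DERIV_imp_deriv)
qed

lemma solves_dyU: "solves (Uy) (\<lambda>_. 0)"
  by (rule solves_cong[OF tangent_solves[of 0 0 1]])
     (auto simp: dyU_eq h_dir_def q_dir_def c_dir_def)

lemma solves_dbU: "solves (Ub) (\<lambda>y. of_real (- k * d2 c k b) \<odot> Uy y)"
  by (rule solves_cong[OF tangent_solves[of 0 1 0]])
     (auto simp: dbU_eq dyU_eq h_dir_def q_dir_def c_dir_def d2_c)

lemma solves_dkU: "solves (\<lambda>y. Uk y + of_real (y / k) \<odot> Uy y)
    (\<lambda>y. of_real (- k * d1 c k b) \<odot> Uy y)"
  by (rule solves_cong[OF tangent_solves[of 1 0 0]])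
     (auto simp: dkU_eq dyU_eq h_dir_def q_dir_def c_dir_def d1_c cmul_def algebra_simps)

lemma DH_periodic: "DH v (k, b, y + 1) = DH v (k, b, y)"
proof -
  have 1: "((\<lambda>x. x + (0, 0, 1)) has_derivative (\<lambda>x. x)) (at (k, b, y))"
    by (auto intro!: derivative_eq_intros)
  have 2: "(Hf has_derivative (\<lambda>v. DH v (k, b, y + 1))) (at ((k, b, y) + (0, 0, 1)))"
    using Hf_derivative[of "(k, b, y + 1)"] point by (simp add: wave_dom_def)
  have "((\<lambda>x. Hf (x + (0, 0, 1))) has_derivative (\<lambda>v. DH v (k, b, y + 1))) (at (k, b, y))"
    using diff_chain_at[OF 1 2] by (simp add: o_def)
  then have "(Hf has_derivative (\<lambda>v. DH v (k, b, y + 1))) (at (k, b, y))"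
    by (rule has_derivative_transform_within_open[OF _ open_dom])
      (use point H_periodic in \<open>auto simp: wave_dom_def\<close>)
  moreover have "(Hf has_derivative (\<lambda>v. DH v (k, b, y))) (at (k, b, y))"
    by (rule Hf_derivative) (simp add: wave_dom_def point)
  ultimately show ?thesis using has_derivative_unique by metis
qed

lemma continuous_DH: "continuous_on UNIV (\<lambda>y. DH v (k, b, y))"
  by (rule continuous_on_compose2[OF Ck_on_continuous[OF Ck_DH[of 0]]])
    (auto intro!: continuous_intros simp: wave_dom_def point)

lemma tangent_L2per: "Uy \<in> L2per" "Uk \<in> L2per" "Ub \<in> L2per"
  by (auto intro!: continuous_periodic_L2per continuous_intros continuous_DH continuous_H point
      simp: dyU_eq[abs_def] dkU_eq[abs_def] dbU_eq[abs_def] DH_periodic H_periodic[OF point])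

lemma Q_periodic: "Qprof c H k b (y + 1) = Qprof c H k b y"
  by (simp add: Qprof_def H_periodic[OF point])

lemma coefficients_periodic:
  "gh (y + 1) = gh y" "gq (y + 1) = gq y" "sh (y + 1) = sh y" "sq (y + 1) = sq y"
  by (simp_all add: gh_def gq_def sh_def sq_def Q_periodic H_periodic[OF point])

lemma flux_coefficients_C1:
  obtains gh' gq' where "\<And>y. (gh has_vector_derivative gh' y) (at y)" "\<And>y. (gq has_vector_derivative gq' y) (at y)"
    "continuous_on UNIV gh'" "continuous_on UNIV gq'" "\<And>y. gh' (y + 1) = gh' y" "\<And>y. gq' (y + 1) = gq' y"
proof -
  let ?h = "H k b" and ?q = "Qprof c H k b" and ?d = "\<lambda>y. H_y y"
  have nz: "?h y \<noteq> 0" for y by (rule H_nonzero[OF point])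
  define dgh where "dgh y = - (2 * ?q y * (c k b * ?d y) / (?h y)\<^sup>2 - 2 * (?q y)\<^sup>2 * ?d y / (?h y) ^ 3) + ?d y / F\<^sup>2" for y
  define dgq where "dgq y = 2 * (c k b * ?d y) / ?h y - 2 * ?q y * ?d y / (?h y)\<^sup>2" for y
  have F0: "F \<noteq> 0" using froude by simp
  have 1: "((\<lambda>y. - (?q y)\<^sup>2 / (?h y)\<^sup>2 + ?h y / F\<^sup>2) has_real_derivative dgh y) (at y)" for y
    using nz[of y] F0 unfolding dgh_def
    by (auto intro!: derivative_eq_intros DERIV_H_y[OF point] DERIV_Q_y[OF point]
        simp: field_simps eval_nat_numeral)
  have 2: "((\<lambda>y. 2 * ?q y / ?h y) has_real_derivative dgq y) (at y)" for y
    using nz[of y] unfolding dgq_def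
    by (auto intro!: derivative_eq_intros DERIV_H_y[OF point] DERIV_Q_y[OF point]
        simp: field_simps eval_nat_numeral)
  show ?thesis
  proof
    show "(gh has_vector_derivative of_real (dgh y)) (at y)" for y
      unfolding gh_def[abs_def] dhG_eq[OF nz] by (rule has_vector_derivative_of_real[OF 1])
    show "(gq has_vector_derivative of_real (dgq y)) (at y)" for y
      unfolding gq_def[abs_def] dqG_eq by (rule has_vector_derivative_of_real[OF 2])
    show "continuous_on UNIV (\<lambda>y. complex_of_real (dgh y))" "continuous_on UNIV (\<lambda>y. complex_of_real (dgq y))"
      unfolding dgh_def dgq_def using nz F0
      by (auto intro!: continuous_intros continuous_DH continuous_H continuous_Q point)
  qed (simp_all add: dgh_def dgq_def DH_periodic H_periodic[OF point] Q_periodic)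
qed

text \<open>Conjugation with \<open>e\<^bsup>ily\<^esup>\<close> is how the Bloch operator is defined. What has to be shown is that all weak
derivatives exist, which follows from the product rule.\<close>

lemma bloch_imp_solves:
  assumes B: "T l U V"
  shows "solves (\<lambda>y. cis (l * y) \<odot> U y) (\<lambda>y. cis (l * y) \<odot> V y)"
proof -
  obtain gh' gq' where g: "\<And>y. (gh has_vector_derivative gh' y) (at y)" "\<And>y. (gq has_vector_derivative gq' y) (at y)"
    "continuous_on UNIV gh'" "continuous_on UNIV gq'" by (rule flux_coefficients_C1) blast
  define u1 where "u1 y = cis (l * y) * fst (U y)" for y
  define u2 where "u2 y = cis (l * y) * snd (U y)" for y
  have "\<exists>h'. has_weak_deriv (\<lambda>y. fst (U y)) h'" "\<exists>q' q''. has_weak_deriv (\<lambda>y. snd (U y)) q' \<and> has_weak_deriv q' q''"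
    using B by (auto simp: bloch_def H1per_def H2per_def)
  then obtain h' q' q'' where w: "has_weak_deriv (\<lambda>y. fst (U y)) h'" "has_weak_deriv (\<lambda>y. snd (U y)) q'" "has_weak_deriv q' q''"
    by blast
  note w1 = has_weak_deriv_cis[OF w(1), of l, folded u1_def[abs_def]]
    and w2 = has_weak_deriv_cis[OF w(2), of l, folded u2_def[abs_def]]
  have w2': "has_weak_deriv (wderiv u2) (wderiv (wderiv u2))"
  proof (rule has_weak_deriv_wderiv)
    have "has_weak_deriv (\<lambda>y. \<i> * of_real l * u2 y + cis (l * y) * q' y)
        (\<lambda>y. \<i> * of_real l * (\<i> * of_real l * cis (l * y) * snd (U y) + cis (l * y) * q' y)
         + (\<i> * of_real l * cis (l * y) * q' y + cis (l * y) * q'' y))" (is "has_weak_deriv _ ?r")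
      by (intro has_weak_deriv_add has_weak_deriv_cmult w2 has_weak_deriv_cis w(3))
    then show "has_weak_deriv (wderiv u2) ?r"
      by (rule has_weak_deriv_cong) (use has_weak_deriv_wderiv(2)[OF w2] in \<open>auto elim!: eventually_mono simp: u2_def mult_ac\<close>)
  qed
  let ?\<sigma> = "complex_of_real (c k b)" and ?k = "complex_of_real k" and ?\<omega> = "complex_of_real (freq c k b)"
  have wp: "has_weak_deriv (\<lambda>y. ?\<sigma> * u1 y - u2 y) (wderiv (\<lambda>y. ?\<sigma> * u1 y - u2 y))"
    by (rule has_weak_deriv_wderiv(1)[OF has_weak_deriv_diff[OF has_weak_deriv_cmult[OF w1] w2]])
  have wgh: "has_weak_deriv (\<lambda>y. gh y * u1 y) (wderiv (\<lambda>y. gh y * u1 y))"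
    by (rule has_weak_deriv_wderiv(1)[OF has_weak_deriv_mult[OF g(1,3) w1]])
  have wgq: "has_weak_deriv (\<lambda>y. gq y * u2 y) (wderiv (\<lambda>y. gq y * u2 y))"
    by (rule has_weak_deriv_wderiv(1)[OF has_weak_deriv_mult[OF g(2,4) w2]])
  have wu2: "has_weak_deriv u2 (wderiv u2)" by (rule has_weak_deriv_wderiv(1)[OF w2])
  let ?u = "\<lambda>y. cis (l * y) \<odot> U y" and ?f = "\<lambda>y. cis (l * y) \<odot> V y"
  have V: "?f \<doteq> calA \<delta> F c H k b ?u"
  proof -
    have "V \<doteq> (\<lambda>y. cis (- l * y) \<odot> calA \<delta> F c H k b (\<lambda>z. cis (l * z) \<odot> U z) y)"
      using B by (simp add: bloch_def)
    then show ?thesis by eventually_elim (simp add: cmul_cmul cis_mult)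
  qed
  show ?thesis
  proof (rule solvesI)
    show "has_weak_deriv (mass_flux ?u) (\<lambda>y. fst (?f y) / ?k)"
      unfolding mass_flux_def[abs_def]
    proof (rule has_weak_deriv_cong[OF wp])
      show "wderiv (\<lambda>y. ?\<sigma> * u1 y - u2 y) \<doteq> (\<lambda>y. fst (?f y) / ?k)"
        using V by eventually_elim (simp add: calA_def u1_def[abs_def] u2_def[abs_def] k_nonzero[OF point])
    qed (simp add: u1_def u2_def)
    show "has_weak_deriv (\<lambda>y. snd (?u y)) (wderiv u2)"
      using wu2 by (simp add: u2_def[abs_def])
    show "has_weak_deriv (momentum_flux ?u (wderiv u2)) (momentum_source ?u ?f)"
      unfolding momentum_flux_def[abs_def] momentum_source_def[abs_def]
    proof (rule has_weak_deriv_cong[OF has_weak_deriv_diff[OF has_weak_deriv_diff[OF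
          has_weak_deriv_cmult[OF w2', of "complex_of_real (\<delta> * k\<^sup>2)"]
          has_weak_deriv_cmult[OF has_weak_deriv_add[OF wgh wgq], of ?k]]
          has_weak_deriv_cmult[OF wu2, of ?\<omega>]]])
      show "(\<lambda>y. complex_of_real (\<delta> * k\<^sup>2) * wderiv (wderiv u2) y
          - ?k * (wderiv (\<lambda>y. gh y * u1 y) y + wderiv (\<lambda>y. gq y * u2 y) y) - ?\<omega> * wderiv u2 y)
        \<doteq> (\<lambda>y. snd (?f y) - sh y * fst (?u y) - sq y * snd (?u y))"
        using V
      proof eventually_elim
        case (elim y)
        have "snd (?f y) = snd (calA \<delta> F c H k b ?u y)" using elim by simp
        also have "\<dots> = - ?k * wderiv (\<lambda>y. gh y * u1 y) y + sh y * u1 y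
          + (complex_of_real (\<delta> * k\<^sup>2) * wderiv (wderiv u2) y - ?k * wderiv (\<lambda>y. gq y * u2 y) y + sq y * u2 y)
          - ?\<omega> * wderiv u2 y"
          by (simp add: calA_def dh_calG_def dq_calG_def u1_def[abs_def] u2_def[abs_def] gh_def[abs_def] gq_def[abs_def] sh_def sq_def)
        finally show ?case by (simp add: u1_def u2_def algebra_simps)
      qed
    qed (simp add: u1_def u2_def)
  qed
qed

text \<open>A wave of speed zero would have constant discharge and solve a scalar first-order equation, whose
  only periodic solutions are constant: the height would be \<open>b\<^bsup>2/3\<^esup>\<close> at its maximum and at its minimum.\<close>

lemma speed_nonzero: "c k b \<noteq> 0"
proof
  assume c0: "c k b = 0"
  let ?h = "H k b" and ?d = "\<lambda>y. H_y y"
  have crit: "(?h y) ^ 3 = b\<^sup>2" if "?d y = 0" for y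
  proof -
    have Q: "Qprof c H k b z = - b" for z by (simp add: Qprof_def c0)
    have "((\<lambda>y. - k * Gflux F (?h y) (- b)) has_real_derivative - Ssrc (?h y) (- b)) (at y)"
      using profile_flux[OF point] by (simp add: c0 Q)
    moreover have "((\<lambda>y. - k * Gflux F (?h y) (- b)) has_real_derivative - k * (dhG F (?h y) (- b) * ?d y + dqG F (?h y) (- b) * 0)) (at y)"
      by (intro DERIV_cmult DERIV_Gflux DERIV_H_y[OF point] DERIV_const H_nonzero[OF point])
    ultimately have "Ssrc (?h y) (- b) = 0" using DERIV_unique that by fastforce
    then show ?thesis using H_nonzero[OF point, of y] by (simp add: Ssrc_def field_simps eval_nat_numeral)
  qed
  have cont: "continuous_on {0..1} ?h" by (rule continuous_on_subset[OF continuous_H[OF point]]) simp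
  obtain x where x: "x \<in> {0..1}" "\<And>y. y \<in> {0..1} \<Longrightarrow> ?h y \<le> ?h x"
    using continuous_attains_sup[OF _ _ cont] by auto
  obtain z where z: "z \<in> {0..1}" "\<And>y. y \<in> {0..1} \<Longrightarrow> ?h z \<le> ?h y"
    using continuous_attains_inf[OF _ _ cont] by auto
  have reduce: "\<exists>y'\<in>{0..1}. ?h y = ?h y'" for y
  proof
    show "frac y \<in> {0..1}" using frac_lt_1[of y] by (simp add: less_imp_le)
    show "?h y = ?h (frac y)"
      using periodic_int_shift[of ?h "frac y" "\<lfloor>y\<rfloor>", OF H_periodic[OF point]] by (simp add: frac_def)
  qed
  have max: "?h y \<le> ?h x" and min: "?h z \<le> ?h y" for y
    using reduce[of y] x(2) z(2) by auto
  have "?d x = 0"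
    by (rule DERIV_local_max[OF DERIV_H_y[OF point], of 1]) (use max in auto)
  moreover have "?d z = 0"
    by (rule DERIV_local_min[OF DERIV_H_y[OF point], of 1]) (use min in auto)
  ultimately have "(?h x) ^ 3 = (?h z) ^ 3" using crit by simp
  then have "root 3 ((?h x) ^ 3) = root 3 ((?h z) ^ 3)" by simp
  then have "?h x = ?h z" by (simp add: odd_real_root_power_cancel)
  then have "?h y = ?h x" for y using max[of y] min[of y] by simp
  then have "?h constant_on UNIV" by (auto simp: constant_on_def)
  then show False using profile[OF point] by (simp add: periodic_profile_def)
qed

text \<open>Regularity. The momentum flux has a continuous representative \<open>r0\<close>, which is periodic because the other
terms are; solving it for the derivative of the second component \<open>q\<close> shows that this derivative is periodic
and square integrable. The mass flux \<open>c h - q\<close> has a square integrable derivative, and as \<open>c \<noteq> 0\<close> so does \<open>h\<close>.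
The momentum flux then gives the second derivative of \<open>q\<close>.\<close>

lemma solves_imp_bloch_0:
  assumes S: "solves U V" and U: "U \<in> L2per" and V: "V \<in> L2per"
  shows "T 0 U V"
proof -
  obtain gh' gq' where g: "\<And>y. (gh has_vector_derivative gh' y) (at y)" "\<And>y. (gq has_vector_derivative gq' y) (at y)"
    "continuous_on UNIV gh'" "continuous_on UNIV gq'" "\<And>y. gh' (y + 1) = gh' y" "\<And>y. gq' (y + 1) = gq' y"
    by (rule flux_coefficients_C1) blast
  define h where "h y = fst (U y)" for y
  define q where "q y = snd (U y)" for y
  let ?d = "complex_of_real (\<delta> * k\<^sup>2)" and ?\<sigma> = "complex_of_real (c k b)" and ?k = "complex_of_real k"
    and ?\<omega> = "complex_of_real (freq c k b)"
  define B where "B y = ?k * (gh y * h y + gq y * q y) + ?\<omega> * q y" for y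
  define s where "s y = snd (V y) - sh y * h y - sq y * q y" for y
  have L: "h \<in> L2per" "q \<in> L2per" "(\<lambda>y. fst (V y)) \<in> L2per" "(\<lambda>y. snd (V y)) \<in> L2per"
    using U V by (auto simp: L2per_vfun_iff h_def[abs_def] q_def[abs_def])
  note L2 = L2per_add L2per_diff L2per_cmult L2per_mult[OF _ cont_gh coefficients_periodic(1)]
    L2per_mult[OF _ cont_gq coefficients_periodic(2)] L2per_mult[OF _ cont_sh coefficients_periodic(3)]
    L2per_mult[OF _ cont_sq coefficients_periodic(4)] L2per_mult[OF _ g(3,5)] L2per_mult[OF _ g(4,6)] L
  obtain q' where p: "has_weak_deriv (\<lambda>y. ?\<sigma> * h y - q y) (\<lambda>y. fst (V y) / ?k)"
    and q: "has_weak_deriv q q'" and r: "has_weak_deriv (\<lambda>y. ?d * q' y - B y) s"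
    using S unfolding solves_def system_defs[abs_def] h_def[abs_def] q_def[abs_def] B_def s_def[abs_def] by (auto simp: diff_diff_eq)
  obtain K where s: "loc_int s" and K: "(\<lambda>y. ?d * q' y - B y) \<doteq> (\<lambda>y. K + prim s y)"
    using r by (auto simp: has_weak_deriv_iff)
  define r0 where "r0 y = K + prim s y" for y
  have r0_cont: "continuous_on UNIV r0"
    unfolding r0_def[abs_def] by (intro continuous_intros continuous_on_prim s)
  have B_per: "B (y + 1) = B y" for y
    using L2perD(1)[OF L(1), of y] L2perD(1)[OF L(2), of y] by (simp add: B_def coefficients_periodic)
  have "q' \<doteq> (\<lambda>y. q' (y + 1))"
    using has_weak_deriv_unique[OF q] has_weak_deriv_shift[OF q, of 1] by (simp add: L2perD(1)[OF L(2)])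
  then have "(\<lambda>y. r0 (y + 1)) \<doteq> r0"
    using K ae_eq_shift[OF K, of 1] unfolding r0_def B_per by eventually_elim simp
  then have "(\<lambda>y. r0 (y + 1)) = r0"
    by (intro continuous_ae_eq_imp_eq r0_cont continuous_on_compose2[OF r0_cont] continuous_intros) auto
  then have r0_per: "r0 (y + 1) = r0 y" for y by (rule fun_cong)
  have r0_L2: "r0 \<in> L2per" by (rule continuous_periodic_L2per[OF r0_cont r0_per])
  have r0_wd: "has_weak_deriv r0 s"
    by (rule has_weak_deriv_cong[OF r]) (use K in \<open>auto simp: r0_def[abs_def]\<close>)
  define p0 where "p0 y = inverse ?d * (r0 y + B y)" for y
  have p0_L2: "p0 \<in> L2per" unfolding p0_def[abs_def] B_def by (intro L2 r0_L2)
  have d0: "?d \<noteq> 0" by (rule d_nz)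
  have "q' \<doteq> p0"
    using K
  proof eventually_elim
    case (elim y)
    then have "?d * q' y = r0 y + B y" by (simp add: r0_def algebra_simps)
    then have "inverse ?d * (?d * q' y) = p0 y" by (simp add: p0_def)
    then show ?case by (simp only: mult.assoc[symmetric] left_inverse[OF d0] mult_1)
  qed
  then have q_p0: "has_weak_deriv q p0" by (intro has_weak_deriv_cong[OF q]) auto
  have V1: "(\<lambda>y. fst (V y) / ?k) \<in> L2per" 
    using L2per_cmult[OF L(3), of "inverse ?k"] by (simp add: divide_inverse mult.commute)
  define h' where "h' y = inverse ?\<sigma> * (fst (V y) / ?k + p0 y)" for y
  have h'_L2: "h' \<in> L2per" unfolding h'_def[abs_def] by (intro L2 V1 p0_L2)
  have h_wd: "has_weak_deriv h h'"
    by (rule has_weak_deriv_cong[OF has_weak_deriv_cmult[OF has_weak_deriv_add[OF p q_p0], of "inverse ?\<sigma>"]])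
       (use speed_nonzero in \<open>auto simp: h'_def\<close>)
  define Bh where "Bh y = gh' y * h y + gh y * h' y" for y
  define Bq where "Bq y = gq' y * q y + gq y * p0 y" for y
  have Bh: "has_weak_deriv (\<lambda>y. gh y * h y) Bh" unfolding Bh_def[abs_def] by (rule has_weak_deriv_mult[OF g(1,3) h_wd])
  have Bq: "has_weak_deriv (\<lambda>y. gq y * q y) Bq" unfolding Bq_def[abs_def] by (rule has_weak_deriv_mult[OF g(2,4) q_p0])
  define p1 where "p1 y = inverse ?d * (s y + (?k * (Bh y + Bq y) + ?\<omega> * p0 y))" for y
  have p1: "has_weak_deriv p0 p1"
    unfolding p0_def[abs_def] p1_def[abs_def] B_def
    by (intro has_weak_deriv_cmult has_weak_deriv_add r0_wd Bh Bq q_p0[unfolded p0_def[abs_def] B_def])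
  have p1_L2: "p1 \<in> L2per"
    unfolding p1_def[abs_def] Bh_def Bq_def s_def by (intro L2 p0_L2 h'_L2)
  have "p0 \<in> H1per" using p0_L2 p1 p1_L2 by (auto simp: H1per_def)
  then have q_H2: "q \<in> H2per" using L(2) q_p0 by (auto simp: H2per_def)
  have h_H1: "h \<in> H1per" using L(1) h_wd h'_L2 by (auto simp: H1per_def)
  have wq: "wderiv q \<doteq> p0" by (rule has_weak_deriv_wderiv(2)[OF q_p0])
  have wwq: "wderiv (wderiv q) \<doteq> p1"
    by (rule has_weak_deriv_wderiv(2)[OF has_weak_deriv_cong[OF p1 ae_eq_sym[OF wq]]]) simp
  have "V \<doteq> calA \<delta> F c H k b U"
    using wq wwq has_weak_deriv_wderiv(2)[OF p] has_weak_deriv_wderiv(2)[OF Bh] has_weak_deriv_wderiv(2)[OF Bq]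
  proof eventually_elim
    case (elim y)
    have "snd (calA \<delta> F c H k b U y) = (- ?k * wderiv (\<lambda>y. gh y * h y) y + sh y * h y)
       + (?d * wderiv (wderiv q) y - ?k * wderiv (\<lambda>y. gq y * q y) y + sq y * q y) - ?\<omega> * wderiv q y"
      by (simp add: calA_def dh_calG_def dq_calG_def h_def[abs_def] q_def[abs_def] gh_def[abs_def] gq_def[abs_def] sh_def sq_def)
    also have "\<dots> = ?d * p1 y - (?k * (Bh y + Bq y) + ?\<omega> * p0 y) + sh y * h y + sq y * q y"
      by (simp only: elim) (simp add: algebra_simps)
    also have "?d * p1 y = s y + (?k * (Bh y + Bq y) + ?\<omega> * p0 y)"
      using d0 unfolding p1_def by (simp only: mult.assoc[symmetric] right_inverse[OF d0]) simp
    finally have 2: "snd (calA \<delta> F c H k b U y) = snd (V y)" by (simp add: s_def)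
    have "fst (calA \<delta> F c H k b U y) = ?k * wderiv (\<lambda>y. ?\<sigma> * h y - q y) y"
      by (simp add: calA_def h_def[abs_def] q_def[abs_def])
    also have "\<dots> = fst (V y)" using elim(3) k_nonzero[OF point] by simp
    finally show ?case using 2 by (simp add: prod_eq_iff)
  qed
  with h_H1 q_H2 V show ?thesis by (simp add: bloch_def h_def[abs_def] q_def[abs_def])
qed

text \<open>The mean over a period of the mass equation \<open>k (\<partial>\<^sub>y + il) (c h - q) = V\<^sub>1\<close>.\<close>

lemma bloch_mean_identity:
  assumes B: "T l U V"
  shows "integral {0..1} (\<lambda>y. fst (V y)) = \<i> * of_real l * of_real k * integral {0..1} (\<lambda>y. of_real (c k b) * fst (U y) - snd (U y))"
proof -
  let ?p = "\<lambda>y. of_real (c k b) * fst (U y) - snd (U y)"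
  have L: "(\<lambda>y. fst (U y)) \<in> L2per" "(\<lambda>y. snd (U y)) \<in> L2per" "(\<lambda>y. fst (V y)) \<in> L2per"
    using B by (auto simp: bloch_def H1per_def H2per_def L2per_vfun_iff[of V])
  then have p: "?p \<in> L2per" by (intro L2per_diff L2per_cmult)
  from bloch_imp_solves[OF B]
  have "has_weak_deriv (\<lambda>y. cis (l * y) * ?p y) (\<lambda>y. cis (l * y) * (fst (V y) / of_real k))"
    unfolding solves_def mass_flux_def[abs_def] by (auto simp: algebra_simps)
  note w = has_weak_deriv_cis[OF this, of "-l"]
  have cancel: "cis (- l * y) * (cis (l * y) * z) = z" for y z
    by (simp add: cis_mult flip: mult.assoc)
  from w have "has_weak_deriv ?p (\<lambda>y. inverse (of_real k) * fst (V y) - \<i> * of_real l * ?p y)"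
    by (simp only: mult.assoc cancel) (simp add: divide_inverse algebra_simps)
  from periodic_weak_deriv_mean_zero[OF this L2perD(1)[OF p]]
  have "integral {0..1} (\<lambda>y. inverse (of_real k) * fst (V y)) - integral {0..1} (\<lambda>y. \<i> * of_real l * ?p y) = 0"
    using integral_diff[OF loc_int_integrable loc_int_integrable, of "\<lambda>y. inverse (of_real k) * fst (V y)" "\<lambda>y. \<i> * of_real l * ?p y" 0 1]
      L2per_loc_int[OF L2per_cmult[OF p]] L2per_loc_int[OF L2per_cmult[OF L(3)]] by simp
  then have "inverse (of_real k) * integral {0..1} (\<lambda>y. fst (V y)) = \<i> * of_real l * integral {0..1} ?p"
    by (simp only: integral_mult_right right_minus_eq)
  then have "of_real k * (inverse (of_real k) * integral {0..1} (\<lambda>y. fst (V y))) = of_real k * (\<i> * of_real l * integral {0..1} ?p)"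
    by (rule arg_cong)
  then show ?thesis
    using k_nonzero[OF point] by (simp only: mult.assoc[symmetric]) (simp add: mult_ac)
qed

lemma DERIV_mean_k: "((\<lambda>k'. mean H k' b) has_real_derivative integral {0..1} (\<lambda>y. H_k y)) (at k)"
  unfolding mean_def
proof (rule DERIV_integral_parameter)
  show "open ((\<lambda>k'. (k', b)) -` \<Omega>)" by (intro open_vimage open_Omega continuous_intros)
  show "continuous_on ((\<lambda>k'. (k', b)) -` \<Omega> \<times> UNIV) (\<lambda>(k', y). DH (1, 0, 0) (k', b, y))"
    unfolding case_prod_unfold
    by (rule continuous_on_compose2[OF Ck_on_continuous[OF Ck_DH[of 0]]]) (auto intro!: continuous_intros simp: wave_dom_def)
qed (use point in \<open>auto intro: DERIV_H_k loc_int_integrable loc_int_continuous continuous_H\<close>)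

lemma DERIV_mean_b: "((\<lambda>b'. mean H k b') has_real_derivative integral {0..1} (\<lambda>y. H_b y)) (at b)"
  unfolding mean_def
proof (rule DERIV_integral_parameter)
  show "open ((\<lambda>b'. (k, b')) -` \<Omega>)" by (intro open_vimage open_Omega continuous_intros)
  show "continuous_on ((\<lambda>b'. (k, b')) -` \<Omega> \<times> UNIV) (\<lambda>(b', y). DH (0, 1, 0) (k, b', y))"
    unfolding case_prod_unfold
    by (rule continuous_on_compose2[OF Ck_on_continuous[OF Ck_DH[of 0]]]) (auto intro!: continuous_intros simp: wave_dom_def)
qed (use point in \<open>auto intro: DERIV_H_b loc_int_integrable loc_int_continuous continuous_H\<close>)

lemma d1_mean: "d1 (mean H) k b = integral {0..1} (\<lambda>y. H_k y)"
  and d2_mean: "d2 (mean H) k b = integral {0..1} (\<lambda>y. H_b y)"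
  unfolding d1_def d2_def using DERIV_mean_k DERIV_mean_b by (auto intro: DERIV_imp_deriv)

lemma integral_of_real_continuous:
  fixes f :: "real \<Rightarrow> real"
  assumes "continuous_on UNIV f"
  shows "integral {0..1} (\<lambda>y. complex_of_real (f y)) = of_real (integral {0..1} f)"
  using integral_linear[of f "{0..1}" complex_of_real]
    loc_int_integrable[OF loc_int_continuous[OF assms], of 0 1]
  by (simp add: o_def bounded_linear_of_real)

lemma mean_tangents:
  shows "integral {0..1} (\<lambda>y. fst (Uy y)) = 0"
    and "integral {0..1} (\<lambda>y. fst (Uk y)) = of_real (d1 (mean H) k b)"
    and "integral {0..1} (\<lambda>y. fst (Ub y)) = of_real (d2 (mean H) k b)"
proof -
  have "((\<lambda>y. H_y y) has_integral H k b 1 - H k b 0) {0..1}"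
    using DERIV_H_y[OF point] by (intro fundamental_theorem_of_calculus)
      (auto simp: has_real_derivative_iff_has_vector_derivative[symmetric] intro: has_field_derivative_at_within)
  then have "integral {0..1} (\<lambda>y. H_y y) = 0"
    using H_periodic[OF point, of 0] by (simp add: integral_unique)
  then show "integral {0..1} (\<lambda>y. fst (Uy y)) = 0"
    by (simp add: dyU_eq integral_of_real_continuous[OF continuous_DH])
qed (simp_all add: dkU_eq dbU_eq d1_mean d2_mean integral_of_real_continuous[OF continuous_DH])

lemma flux_tangents:
  shows "of_real (c k b) * fst (Uy y) - snd (Uy y) = 0"
    and "of_real (c k b) * fst (Uk y) - snd (Uk y) = of_real (- d1 c k b * H k b y)"
    and "of_real (c k b) * fst (Ub y) - snd (Ub y) = of_real (1 - d2 c k b * H k b y)"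
  by (simp_all add: dyU_eq dkU_eq dbU_eq)

end

section \<open>Dual bases of the critical eigenspaces\<close>

lemma sum_12: "(\<Sum>k\<in>{1,2::nat}. f k) = f 1 + f 2"
  by simp

lemma ball_12: "(\<forall>j\<in>{1,2::nat}. P j) \<longleftrightarrow> P 1 \<and> P 2"
  by auto

lemma L2inner_integrable:
  assumes "Z \<in> L2per" "V \<in> L2per"
  shows "(\<lambda>y. cnj (fst (Z y)) * fst (V y) + cnj (snd (Z y)) * snd (V y)) integrable_on {0..1}"
proof -
  have prod: "(\<lambda>y. cnj (f y) * g y) integrable_on {0..1}" if f: "f \<in> L2per" and g: "g \<in> L2per" for f g :: "real \<Rightarrow> complex"
  proof -
    have "(\<lambda>y. cnj (f y) * g y) absolutely_integrable_on {0..1}"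
    proof (rule measurable_bounded_by_integrable_imp_absolutely_integrable)
      have "(\<lambda>y. cnj (f y)) \<in> borel_measurable lebesgue"
        by (rule borel_measurable_continuous_on[OF _ L2perD(2)[OF f]]) (intro continuous_intros)
      then show "(\<lambda>y. cnj (f y) * g y) \<in> borel_measurable (lebesgue_on {0..1})"
        by (intro measurable_restrict_space1 borel_measurable_times L2perD(2)[OF g])
      show "(\<lambda>y. (norm (f y))\<^sup>2 + (norm (g y))\<^sup>2) integrable_on {0..1}"
        by (intro integrable_add L2perD f g)
      show "norm (cnj (f y) * g y) \<le> (norm (f y))\<^sup>2 + (norm (g y))\<^sup>2" for y
      proof -
        have "2 * (norm (f y) * norm (g y)) \<le> (norm (f y))\<^sup>2 + (norm (g y))\<^sup>2"
          using sum_squares_bound[of "norm (f y)" "norm (g y)"] by simp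
        moreover have "0 \<le> norm (f y) * norm (g y)" by simp
        ultimately show ?thesis unfolding norm_mult complex_mod_cnj by linarith
      qed
    qed auto
    then show ?thesis by (simp add: absolutely_integrable_on_def)
  qed
  show ?thesis
    using assms by (intro integrable_add prod) (auto simp: L2per_vfun_iff)
qed

lemma L2inner_cong: "Z \<doteq> Z' \<Longrightarrow> V \<doteq> V' \<Longrightarrow> L2inner Z V = L2inner Z' V'"
  unfolding L2inner_def by (rule integral_ae_cong) (auto elim: eventually_elim2)

lemma L2inner_add_right:
  assumes "Z \<in> L2per" "V \<in> L2per" "W \<in> L2per"
  shows "L2inner Z (\<lambda>y. V y + W y) = L2inner Z V + L2inner Z W"
  using integral_add[OF L2inner_integrable[OF assms(1,2)] L2inner_integrable[OF assms(1,3)]]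
  unfolding L2inner_def by (simp add: algebra_simps)

lemma L2inner_add_left:
  assumes "Z \<in> L2per" "V \<in> L2per" "Y \<in> L2per"
  shows "L2inner (\<lambda>y. Z y + Y y) V = L2inner Z V + L2inner Y V"
  using integral_add[OF L2inner_integrable[OF assms(1,2)] L2inner_integrable[OF assms(3,2)]]
  unfolding L2inner_def by (simp add: algebra_simps)

lemma L2inner_cmul_right: "L2inner Z (\<lambda>y. a \<odot> V y) = a * L2inner Z V"
  unfolding L2inner_def by (subst integral_mult_right[symmetric]) (simp add: algebra_simps)

lemma L2inner_cmul_left: "L2inner (\<lambda>y. a \<odot> Z y) V = cnj a * L2inner Z V"
  unfolding L2inner_def by (subst integral_mult_right[symmetric]) (simp add: algebra_simps)

lemma L2inner_combination:
  assumes "Z1 \<in> L2per" "Z2 \<in> L2per" "V1 \<in> L2per" "V2 \<in> L2per"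
  shows "L2inner (\<lambda>y. a1 \<odot> Z1 y + a2 \<odot> Z2 y) (\<lambda>y. b1 \<odot> V1 y + b2 \<odot> V2 y) =
    cnj a1 * b1 * L2inner Z1 V1 + cnj a1 * b2 * L2inner Z1 V2 + cnj a2 * b1 * L2inner Z2 V1 + cnj a2 * b2 * L2inner Z2 V2"
  using assms
  by (simp add: L2inner_add_left L2inner_add_right L2inner_cmul_left L2inner_cmul_right L2per_add L2per_cmul algebra_simps)

lemma L2inner_first_coordinate: "L2inner (\<lambda>_. (1, 0)) V = integral {0..1} (\<lambda>y. fst (V y))"
  by (simp add: L2inner_def)

lemma L2_span2_subset:
  assumes "\<And>y. w 1 y = p11 \<odot> u 1 y + p12 \<odot> u 2 y" "\<And>y. w 2 y = p21 \<odot> u 1 y + p22 \<odot> u 2 y"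
  shows "L2_span2 w \<subseteq> L2_span2 u"
proof
  fix U assume "U \<in> L2_span2 w"
  then obtain a :: "nat \<Rightarrow> complex" where U: "U \<in> L2per" "U \<doteq> (\<lambda>y. a 1 \<odot> w 1 y + a 2 \<odot> w 2 y)"
    by (auto simp: L2_span2_def)
  have "U \<doteq> (\<lambda>y. (a 1 * p11 + a 2 * p21) \<odot> u 1 y + (a 1 * p12 + a 2 * p22) \<odot> u 2 y)"
    using U(2) unfolding assms by eventually_elim (simp add: cmul_add_right cmul_add_left cmul_cmul)
  then show "U \<in> L2_span2 u"
    unfolding L2_span2_def sum_12 using U(1)
    by (intro CollectI conjI exI[of _ "\<lambda>k. if k = 1 then a 1 * p11 + a 2 * p21 else a 1 * p12 + a 2 * p22"]) auto
qed

lemma L2_span2_change: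
  assumes w: "\<And>y. w 1 y = p11 \<odot> u 1 y + p12 \<odot> u 2 y" "\<And>y. w 2 y = p21 \<odot> u 1 y + p22 \<odot> u 2 y"
    and det: "p11 * p22 - p12 * p21 \<noteq> 0"
  shows "L2_span2 w = L2_span2 u"
proof
  show "L2_span2 w \<subseteq> L2_span2 u" by (rule L2_span2_subset[OF w])
  let ?D = "p11 * p22 - p12 * p21"
  have coef: "p22 / ?D * p11 + - p12 / ?D * p21 = 1" "- p21 / ?D * p12 + p11 / ?D * p22 = 1"
    using det by (simp_all add: divide_simps)
  have "u 1 y = (p22 / ?D) \<odot> w 1 y + (- p12 / ?D) \<odot> w 2 y" for y
  proof -
    have "(p22 / ?D) \<odot> w 1 y + (- p12 / ?D) \<odot> w 2 y =
        (p22 / ?D * p11 + - p12 / ?D * p21) \<odot> u 1 y + (p22 / ?D * p12 + - p12 / ?D * p22) \<odot> u 2 y"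
      unfolding w by (simp add: prod_eq_iff algebra_simps)
    then show ?thesis unfolding coef by simp
  qed
  moreover have "u 2 y = (- p21 / ?D) \<odot> w 1 y + (p11 / ?D) \<odot> w 2 y" for y
  proof -
    have "(- p21 / ?D) \<odot> w 1 y + (p11 / ?D) \<odot> w 2 y =
        (- p21 / ?D * p11 + p11 / ?D * p21) \<odot> u 1 y + (- p21 / ?D * p12 + p11 / ?D * p22) \<odot> u 2 y"
      unfolding w by (simp add: prod_eq_iff algebra_simps)
    then show ?thesis unfolding coef by simp
  qed
  ultimately show "L2_span2 u \<subseteq> L2_span2 w" by (rule L2_span2_subset)
qed

lemma cnj_poly_of_real: "cnj (poly p (of_real l)) = poly (map_poly cnj p) (of_real l)"
  by (induction p) (auto simp: map_poly_pCons)

text \<open>The matrix with rows \<open>(p11, z s)\<close> and \<open>(p21, p22)\<close> has constant determinant, so its inverse is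
polynomial and the dual basis, which is transformed by the conjugate transpose of the inverse, remains
analytic. The factor \<open>z\<close> in the upper right corner together with \<open>p22 0 = 1\<close> preserves the values required
at \<open>l = 0\<close> and the orders of the coordinates of the eigenfunctions in \<open>l\<close>.\<close>

lemma basis_change:
  notes [simp del] = One_nat_def
  fixes p11 s p21 p22 :: "complex poly" and D :: complex
  assumes det: "\<And>z. poly p11 z * poly p22 z - z * poly s z * poly p21 z = D" and D: "D \<noteq> 0"
    and p22: "poly p22 0 = 1"
    and bases: "critical_bases T lam \<Phi> v vt"
    and coords: "eigenfunction_coordinates v vt w wt \<beta> \<beta>t"
  defines "v' \<equiv> \<lambda>j l y. if j = 1 then poly p11 (of_real l) \<odot> v 1 l y + (of_real l * poly s (of_real l)) \<odot> v 2 l y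
      else poly p21 (of_real l) \<odot> v 1 l y + poly p22 (of_real l) \<odot> v 2 l y"
  shows "\<exists>vt' \<beta>' \<beta>t'. critical_bases T lam \<Phi> v' vt' \<and> eigenfunction_coordinates v' vt' w wt \<beta>' \<beta>t'"
proof -
  define q where "q p l = poly p (complex_of_real l)" for p and l :: real
  have q_cmult: "q (smult a p) l = a * q p l" and q_var: "q (pCons 0 p) l = of_real l * q p l" for a p l
    by (simp_all add: q_def)
  have dl: "q p11 l * q p22 l - of_real l * q s l * q p21 l = D" for l using det by (simp add: q_def)
  define vt' where "vt' j l y = (if j = 1 then cnj (q p22 l / D) \<odot> vt 1 l y + cnj (- q p21 l / D) \<odot> vt 2 l y
      else cnj (- (of_real l * q s l) / D) \<odot> vt 1 l y + cnj (q p11 l / D) \<odot> vt 2 l y)" for j :: nat and l y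
  define \<beta>' where "\<beta>' j k l = (if k = 1 then \<beta> j 1 l * (q p22 l / D) + \<beta> j 2 l * (- q p21 l / D)
      else \<beta> j 1 l * (- (of_real l * q s l) / D) + \<beta> j 2 l * (q p11 l / D))" for j k :: nat and l
  define \<beta>t' where "\<beta>t' j k l = (if k = 1 then \<beta>t j 1 l * cnj (q p11 l) + \<beta>t j 2 l * cnj (of_real l * q s l)
      else \<beta>t j 1 l * cnj (q p21 l) + \<beta>t j 2 l * cnj (q p22 l))" for j k :: nat and l
  have v'1: "v' 1 l y = q p11 l \<odot> v 1 l y + (of_real l * q s l) \<odot> v 2 l y"
    and v'2: "v' 2 l y = q p21 l \<odot> v 1 l y + q p22 l \<odot> v 2 l y" for l y
    by (simp_all add: v'_def q_def)
  have vt'1: "vt' 1 l y = cnj (q p22 l / D) \<odot> vt 1 l y + cnj (- q p21 l / D) \<odot> vt 2 l y"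
    and vt'2: "vt' 2 l y = cnj (- (of_real l * q s l) / D) \<odot> vt 1 l y + cnj (q p11 l / D) \<odot> vt 2 l y" for l y
    by (simp_all add: vt'_def)
  have an: "L2_analytic_near_0 (v k)" "L2_analytic_near_0 (vt k)" if "k \<in> {1,2}" for k
    using bases that unfolding critical_bases_def by blast+
  have span: "\<forall>\<^sub>F l in nhds 0.
        total_eigenspace (T l) {lam 1 l, lam 2 l} = L2_span2 (\<lambda>k. v k l) \<and>
        total_eigenspace (adjoint_op (T l)) {cnj (lam 1 l), cnj (lam 2 l)} = L2_span2 (\<lambda>k. vt k l) \<and>
        (\<forall>j\<in>{1,2}. \<forall>k\<in>{1,2}. L2inner (vt j l) (v k l) = (if j = k then 1 else 0))"
    using bases unfolding critical_bases_def by blast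
  have vt20: "vt 2 0 \<doteq> (\<lambda>_. (1, 0))" and v10: "\<exists>a. a \<noteq> 0 \<and> v 1 0 \<doteq> (\<lambda>y. a \<odot> \<Phi> y)"
    using bases unfolding critical_bases_def by blast+
  have L2: "\<forall>\<^sub>F l in nhds 0. v k l \<in> L2per \<and> vt k l \<in> L2per" if "k \<in> {1,2}" for k
    using an[OF that] unfolding L2_analytic_near_0_def by (auto elim: eventually_elim2)
  have p110: "q p11 0 = D" using dl[of 0] p22 by (simp add: q_def)
  have "critical_bases T lam \<Phi> v' vt'"
    unfolding critical_bases_def ball_12
  proof (intro conjI)
    have "L2_analytic_near_0 (\<lambda>l y. q p11 l \<odot> v 1 l y + q (pCons 0 s) l \<odot> v 2 l y)"
      unfolding q_def by (intro L2_analytic_add L2_analytic_poly_mult an) auto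
    then show "L2_analytic_near_0 (v' 1)" unfolding v'1[abs_def] q_var .
    show "L2_analytic_near_0 (v' 2)"
      unfolding v'2[abs_def] q_def by (intro L2_analytic_add L2_analytic_poly_mult an) auto
    have "L2_analytic_near_0 (\<lambda>l y. cnj (q (smult (1 / D) p22) l) \<odot> vt 1 l y + cnj (q (smult (- 1 / D) p21) l) \<odot> vt 2 l y)"
      unfolding q_def cnj_poly_of_real by (intro L2_analytic_add L2_analytic_poly_mult an) auto
    then show "L2_analytic_near_0 (vt' 1)" unfolding vt'1[abs_def] q_cmult by simp
    have "L2_analytic_near_0 (\<lambda>l y. cnj (q (smult (- 1 / D) (pCons 0 s)) l) \<odot> vt 1 l y + cnj (q (smult (1 / D) p11) l) \<odot> vt 2 l y)"
      unfolding q_def cnj_poly_of_real by (intro L2_analytic_add L2_analytic_poly_mult an) auto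
    then show "L2_analytic_near_0 (vt' 2)" unfolding vt'2[abs_def] q_cmult q_var by simp
    show "\<forall>\<^sub>F l in nhds 0.
        total_eigenspace (T l) {lam 1 l, lam 2 l} = L2_span2 (\<lambda>k. v' k l) \<and>
        total_eigenspace (adjoint_op (T l)) {cnj (lam 1 l), cnj (lam 2 l)} = L2_span2 (\<lambda>k. vt' k l) \<and>
        (L2inner (vt' 1 l) (v' 1 l) = (if (1::nat) = 1 then 1 else 0) \<and> L2inner (vt' 1 l) (v' 2 l) = (if (1::nat) = 2 then 1 else 0)) \<and>
        (L2inner (vt' 2 l) (v' 1 l) = (if (2::nat) = 1 then 1 else 0) \<and> L2inner (vt' 2 l) (v' 2 l) = (if (2::nat) = 2 then 1 else 0))"
      using span L2[of 1, simplified] L2[of 2, simplified]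
    proof eventually_elim
      case (elim l)
      let ?a = "q p11 l" and ?b = "of_real l * q s l" and ?c = "q p21 l" and ?d = "q p22 l"
      have D': "?a * ?d - ?b * ?c = D" using dl[of l] by simp
      have L: "v 1 l \<in> L2per" "v 2 l \<in> L2per" "vt 1 l \<in> L2per" "vt 2 l \<in> L2per"
        using elim by auto
      have b: "L2inner (vt 1 l) (v 1 l) = 1" "L2inner (vt 1 l) (v 2 l) = 0"
        "L2inner (vt 2 l) (v 1 l) = 0" "L2inner (vt 2 l) (v 2 l) = 1"
        using elim(1) by auto
      have s1: "L2_span2 (\<lambda>k. v' k l) = L2_span2 (\<lambda>k. v k l)"
        by (rule L2_span2_change[where w = "\<lambda>k. v' k l" and u = "\<lambda>k. v k l", OF v'1 v'2])
           (simp add: D' D)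
      have "cnj (?d / D) * cnj (?a / D) - cnj (- ?c / D) * cnj (- ?b / D) = cnj ((?a * ?d - ?b * ?c) / (D * D))"
        by (simp add: diff_divide_distrib mult_ac)
      then have s2: "L2_span2 (\<lambda>k. vt' k l) = L2_span2 (\<lambda>k. vt k l)"
        using D unfolding D'
        by (intro L2_span2_change[where w = "\<lambda>k. vt' k l" and u = "\<lambda>k. vt k l", OF vt'1 vt'2]) simp
      have ip: "L2inner (vt' 1 l) (v' 1 l) = (?a * ?d - ?b * ?c) / D"
         "L2inner (vt' 1 l) (v' 2 l) = 0" "L2inner (vt' 2 l) (v' 1 l) = 0"
         "L2inner (vt' 2 l) (v' 2 l) = (?a * ?d - ?b * ?c) / D"
        unfolding v'1[abs_def] v'2[abs_def] vt'1[abs_def] vt'2[abs_def] L2inner_combination[OF L(3,4,1,2)] b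
        by (simp_all add: diff_divide_distrib mult_ac)
      show ?case using s1 s2 elim(1) ip D by (simp add: D')
    qed
    show "vt' 2 0 \<doteq> (\<lambda>_. (1, 0))"
      using vt20 by eventually_elim (use p110 D in \<open>simp add: vt'2\<close>)
    obtain a where a: "a \<noteq> 0" "v 1 0 \<doteq> (\<lambda>y. a \<odot> \<Phi> y)" using v10 by blast
    have "v' 1 0 \<doteq> (\<lambda>y. (D * a) \<odot> \<Phi> y)"
      using a(2) by eventually_elim (use p110 in \<open>simp add: v'1 cmul_cmul\<close>)
    then show "\<exists>a. a \<noteq> 0 \<and> v' 1 0 \<doteq> (\<lambda>y. a \<odot> \<Phi> y)" using a(1) D by (intro exI[of _ "D * a"]) auto
  qed
  moreover have "eigenfunction_coordinates v' vt' w wt \<beta>' \<beta>t'"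
  proof -
    have c1: "\<forall>\<^sub>F l in at 0. \<forall>j\<in>{1,2}.
        w j l \<doteq> (\<lambda>y. \<Sum>k\<in>{1,2}. \<beta> j k l \<odot> v k l y) \<and>
        wt j l \<doteq> (\<lambda>y. \<Sum>k\<in>{1,2}. \<beta>t j k l \<odot> vt k l y)"
      and c2: "\<And>j. j \<in> {1,2} \<Longrightarrow>
        analytic_ext_0 (\<lambda>l. of_real l * \<beta> j 1 l) \<and> analytic_ext_0 (\<beta> j 2) \<and>
        analytic_ext_0 (\<lambda>l. \<beta>t j 1 l / of_real l) \<and> analytic_ext_0 (\<beta>t j 2)"
      using coords unfolding eigenfunction_coordinates_def by blast+
    have ev0: "\<forall>\<^sub>F l in at (0::real). l \<noteq> 0" by (rule eventually_neq_at_within)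
    have an': "analytic_ext_0 (\<lambda>l. of_real l * \<beta>' j 1 l)" "analytic_ext_0 (\<beta>' j 2)"
      "analytic_ext_0 (\<lambda>l. \<beta>t' j 1 l / of_real l)" "analytic_ext_0 (\<beta>t' j 2)" if "j \<in> {1,2}" for j
    proof -
      have A: "analytic_ext_0 (\<lambda>l. of_real l * \<beta> j 1 l)" "analytic_ext_0 (\<beta> j 2)"
        "analytic_ext_0 (\<lambda>l. \<beta>t j 1 l / of_real l)" "analytic_ext_0 (\<beta>t j 2)" using c2[OF that] by auto
      note pm = analytic_ext_0_add[OF analytic_ext_0_poly_mult analytic_ext_0_poly_mult]
      show "analytic_ext_0 (\<lambda>l. of_real l * \<beta>' j 1 l)"
        by (rule analytic_ext_0_cong[OF pm[OF A(1,2), of "smult (1 / D) p22" "smult (- 1 / D) (pCons 0 p21)"]])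
           (simp add: \<beta>'_def q_def algebra_simps)
      show "analytic_ext_0 (\<beta>' j 2)"
        by (rule analytic_ext_0_cong[OF pm[OF A(1,2), of "smult (- 1 / D) s" "smult (1 / D) p11"]])
           (simp add: \<beta>'_def q_def algebra_simps)
      have e1: "a * (x / L) + c * y = (x * a + y * (L * c)) / L"
        and e2: "L * a * (x / L) + c * y = x * a + y * c" if "L \<noteq> 0" for a c x y L :: complex
        using that by (simp_all add: add_divide_distrib mult_ac)
      show "analytic_ext_0 (\<lambda>l. \<beta>t' j 1 l / of_real l)"
      proof (rule analytic_ext_0_cong[OF pm[OF A(3,4), of "map_poly cnj p11" "map_poly cnj s"]])
        show "\<forall>\<^sub>F l in at 0. poly (map_poly cnj p11) (of_real l) * (\<beta>t j 1 l / of_real l)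
            + poly (map_poly cnj s) (of_real l) * \<beta>t j 2 l = \<beta>t' j 1 l / of_real l"
          using ev0 by eventually_elim (simp only: \<beta>t'_def q_def cnj_poly_of_real complex_cnj_mult
              complex_cnj_complex_of_real simp_thms if_True e1 of_real_eq_0_iff)
      qed
      show "analytic_ext_0 (\<beta>t' j 2)"
      proof (rule analytic_ext_0_cong[OF pm[OF A(3,4), of "pCons 0 (map_poly cnj p21)" "map_poly cnj p22"]])
        show "\<forall>\<^sub>F l in at 0. poly (pCons 0 (map_poly cnj p21)) (of_real l) * (\<beta>t j 1 l / of_real l)
            + poly (map_poly cnj p22) (of_real l) * \<beta>t j 2 l = \<beta>t' j 2 l"
          using ev0
        proof eventually_elim
          case (elim l)
          have "\<beta>t' j 2 l = \<beta>t j 1 l * poly (map_poly cnj p21) (of_real l) + \<beta>t j 2 l * poly (map_poly cnj p22) (of_real l)"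
            unfolding \<beta>t'_def q_def cnj_poly_of_real by simp
          then show ?case using elim by (simp only: poly_pCons add_0 e2 of_real_eq_0_iff not_False_eq_True)
        qed
      qed
    qed
    have "\<forall>\<^sub>F l in at 0. \<forall>j\<in>{1,2}.
        w j l \<doteq> (\<lambda>y. \<Sum>k\<in>{1,2}. \<beta>' j k l \<odot> v' k l y) \<and>
        wt j l \<doteq> (\<lambda>y. \<Sum>k\<in>{1,2}. \<beta>t' j k l \<odot> vt' k l y)"
      using c1
    proof eventually_elim
      case (elim l)
      let ?a = "q p11 l" and ?b = "of_real l * q s l" and ?c = "q p21 l" and ?d = "q p22 l"
      have D': "?a * ?d - ?b * ?c = D" using dl[of l] by simp
      have r: "?d / D * ?a - ?c / D * ?b = 1" "?a / D * ?d - ?b / D * ?c = 1"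
        using D' D by (simp_all add: diff_divide_distrib[symmetric] mult_ac)
      have rc: "cnj (?a) * cnj (?d / D) - cnj ?b * cnj (?c / D) = 1"
      proof -
        have "cnj (?a) * cnj (?d / D) - cnj ?b * cnj (?c / D) = cnj ((?a * ?d - ?b * ?c) / D)"
          by (simp add: diff_divide_distrib)
        then show ?thesis using D by (simp add: D')
      qed
      show ?case
      proof (intro ballI conjI)
        fix j :: nat assume j: "j \<in> {1,2}"
        have "\<beta>' j 1 l \<odot> v' 1 l y + \<beta>' j 2 l \<odot> v' 2 l y =
            (?d / D * ?a - ?c / D * ?b) \<odot> (\<beta> j 1 l \<odot> v 1 l y) + (?a / D * ?d - ?b / D * ?c) \<odot> (\<beta> j 2 l \<odot> v 2 l y)" for y
          unfolding v'1 v'2 by (simp add: \<beta>'_def prod_eq_iff algebra_simps)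
        then have "\<beta>' j 1 l \<odot> v' 1 l y + \<beta>' j 2 l \<odot> v' 2 l y = \<beta> j 1 l \<odot> v 1 l y + \<beta> j 2 l \<odot> v 2 l y" for y
          unfolding r by simp
        then show "w j l \<doteq> (\<lambda>y. \<Sum>k\<in>{1,2}. \<beta>' j k l \<odot> v' k l y)"
          using elim j unfolding sum_12 by auto
        have "\<beta>t' j 1 l \<odot> vt' 1 l y + \<beta>t' j 2 l \<odot> vt' 2 l y =
            (cnj (?a) * cnj (?d / D) - cnj ?b * cnj (?c / D)) \<odot> (\<beta>t j 1 l \<odot> vt 1 l y + \<beta>t j 2 l \<odot> vt 2 l y)" for y
          unfolding vt'1 vt'2 by (simp add: \<beta>t'_def prod_eq_iff algebra_simps)
        then have "\<beta>t' j 1 l \<odot> vt' 1 l y + \<beta>t' j 2 l \<odot> vt' 2 l y = \<beta>t j 1 l \<odot> vt 1 l y + \<beta>t j 2 l \<odot> vt 2 l y" for y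
          unfolding rc by simp
        then show "wt j l \<doteq> (\<lambda>y. \<Sum>k\<in>{1,2}. \<beta>t' j k l \<odot> vt' k l y)"
          using elim j unfolding sum_12 by auto
      qed
    qed
    with an' show ?thesis unfolding eigenfunction_coordinates_def by blast
  qed
  ultimately show ?thesis by blast
qed

section \<open>Limits of conjugated expansions\<close>

lemma scal_exp2_tendsto: assumes "scal_exp2 g g0 g1" shows "(g \<longlongrightarrow> g0) (at 0)"
proof -
  obtain C where C: "\<forall>\<^sub>F l in at 0. norm (g l - g0) \<le> C * \<bar>l\<bar> ^ 1"
    using scal_exp2_order_1[OF assms] by (auto simp: scal_order_def)
  have "((\<lambda>l. C * \<bar>l\<bar> ^ 1) \<longlongrightarrow> C * \<bar>0\<bar> ^ 1) (at (0::real))" by (intro tendsto_intros)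
  then have "((\<lambda>l. g l - g0) \<longlongrightarrow> 0) (at 0)" using C by (intro Lim_null_comparison[OF C]) simp
  then show ?thesis by (rule LIM_zero_cancel)
qed

lemma scal_order_poly: "scal_order 0 (\<lambda>l. poly p (of_real l))"
proof (induction p)
  case (pCons a p)
  from scal_order_add[OF scal_order_const[of a] scal_order_mono[OF scal_order_mult[OF scal_order_var pCons(2)], of 0]]
  show ?case by simp
qed (use scal_order_const[of 0] in simp)

lemma scal_exp2_poly: "scal_exp2 (\<lambda>l. poly p (of_real l)) (coeff p 0) (coeff p 1)"
proof -
  obtain a q where p: "p = pCons a q" by (cases p)
  obtain b r where q: "q = pCons b r" by (cases q)
  have "scal_order 2 (\<lambda>l. of_real l * (of_real l * poly r (of_real l)))"
    using scal_order_mult[OF scal_order_var scal_order_mult[OF scal_order_var scal_order_poly[of r]]]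
    by (simp add: eval_nat_numeral)
  then show ?thesis by (simp add: scal_exp2_def p q algebra_simps)
qed

lemma cis_first_order_bound: "norm (cis x - 1 - \<i> * of_real x) \<le> x\<^sup>2"
  using Taylor_exp[of "\<i> * of_real x" 1] by (simp add: cis_conv_exp norm_mult diff_diff_eq power2_eq_square)

lemma loc_L1_tendsto_mult_uniform:
  assumes f: "loc_L1_tendsto f f0 F" and a: "\<And>n. continuous_on UNIV (a n)" "continuous_on UNIV a0"
    and unif: "\<And>s t. \<exists>e. (e \<longlongrightarrow> 0) F \<and> (\<forall>\<^sub>F n in F. \<forall>y\<in>{s..t}. norm (a n y - a0 y) \<le> e n)"
  shows "loc_L1_tendsto (\<lambda>n y. a n y * f n y) (\<lambda>y. a0 y * f0 y) F"
proof -
  note fD = loc_L1_tendstoD[OF f]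
  have "loc_L1_tendsto (\<lambda>n y. (a n y - a0 y) * f n y) (\<lambda>y. 0) F"
  proof (rule loc_L1_tendsto_bound)
    show "loc_int (\<lambda>y::real. 0::complex)" by (intro loc_int_continuous) auto
    show "\<forall>\<^sub>F n in F. loc_int (\<lambda>y. (a n y - a0 y) * f n y)"
      using fD(2) by eventually_elim (intro loc_int_mult continuous_intros a)
    fix s t :: real
    obtain e where e: "(e \<longlongrightarrow> 0) F" "\<forall>\<^sub>F n in F. \<forall>y\<in>{s..t}. norm (a n y - a0 y) \<le> e n"
      using unif by blast
    let ?I = "\<lambda>f. integral {s..t} (\<lambda>y. norm (f y))"
    have "\<forall>\<^sub>F n in F. ?I (\<lambda>y. (a n y - a0 y) * f n y - 0) \<le> \<bar>e n\<bar> * (?I (\<lambda>y. f n y - f0 y) + ?I f0)"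
      using e(2) fD(2)
    proof eventually_elim
      case (elim n)
      have d: "loc_int (\<lambda>y. f n y - f0 y)" by (rule loc_int_diff[OF elim(2) fD(1)])
      have "?I (\<lambda>y. (a n y - a0 y) * f n y - 0) \<le> integral {s..t} (\<lambda>y. \<bar>e n\<bar> * (norm (f n y - f0 y) + norm (f0 y)))"
      proof (rule integral_le)
        show "(\<lambda>y. norm ((a n y - a0 y) * f n y - 0)) integrable_on {s..t}"
          using elim by (simp only: diff_zero) (intro loc_int_norm_integrable loc_int_mult continuous_intros a)
        show "(\<lambda>y. \<bar>e n\<bar> * (norm (f n y - f0 y) + norm (f0 y))) integrable_on {s..t}"
          by (intro integrable_on_mult_right integrable_add loc_int_norm_integrable d fD(1))
        fix y assume y: "y \<in> {s..t}"
        have "norm (a n y - a0 y) \<le> \<bar>e n\<bar>" using elim(1) y by fastforce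
        moreover have "norm (f n y) \<le> norm (f n y - f0 y) + norm (f0 y)"
          using norm_triangle_ineq[of "f n y - f0 y" "f0 y"] by simp
        ultimately show "norm ((a n y - a0 y) * f n y - 0) \<le> \<bar>e n\<bar> * (norm (f n y - f0 y) + norm (f0 y))"
          by (simp add: norm_mult mult_mono)
      qed
      also have "\<dots> = \<bar>e n\<bar> * (?I (\<lambda>y. f n y - f0 y) + ?I f0)"
        by (subst integral_mult_right, subst integral_add) (auto intro: loc_int_norm_integrable d fD(1))
      finally show ?case .
    qed
    moreover have "((\<lambda>n. \<bar>e n\<bar> * (?I (\<lambda>y. f n y - f0 y) + ?I f0)) \<longlongrightarrow> 0 * (0 + ?I f0)) F"
      using tendsto_rabs[OF e(1)] by (intro tendsto_intros fD(3)) simp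
    ultimately show "\<exists>e. (e \<longlongrightarrow> 0) F \<and> (\<forall>\<^sub>F n in F. ?I (\<lambda>y. (a n y - a0 y) * f n y - 0) \<le> e n)"
      by (intro exI[of _ "\<lambda>n. \<bar>e n\<bar> * (?I (\<lambda>y. f n y - f0 y) + ?I f0)"]) simp
  qed
  from loc_L1_tendsto_add[OF this loc_L1_tendsto_mult[OF f a(2)]]
  show ?thesis by (simp add: algebra_simps)
qed

lemma cis_scaled_limit: "\<exists>e. (e \<longlongrightarrow> 0) (at 0) \<and> (\<forall>\<^sub>F l in at 0. \<forall>y\<in>{s..t}. norm (cis (l * y) - 1) \<le> e l)"
proof (intro exI conjI always_eventually allI ballI)
  let ?R = "max \<bar>s\<bar> \<bar>t\<bar>"
  have "((\<lambda>l. \<bar>l\<bar> * ?R + (\<bar>l\<bar> * ?R)\<^sup>2) \<longlongrightarrow> \<bar>0\<bar> * ?R + (\<bar>0\<bar> * ?R)\<^sup>2) (at (0::real))" by (intro tendsto_intros)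
  then show "((\<lambda>l. \<bar>l\<bar> * ?R + (\<bar>l\<bar> * ?R)\<^sup>2) \<longlongrightarrow> 0) (at (0::real))" by simp
  fix l y :: real assume "y \<in> {s..t}"
  then have y: "\<bar>y\<bar> \<le> ?R" by auto
  have "norm (cis (l * y) - 1) \<le> norm (cis (l * y) - 1 - \<i> * of_real (l * y)) + norm (\<i> * of_real (l * y))"
    using norm_triangle_ineq[of "cis (l * y) - 1 - \<i> * of_real (l * y)" "\<i> * of_real (l * y)"] by simp
  also have "\<dots> \<le> \<bar>l * y\<bar>\<^sup>2 + \<bar>l * y\<bar>"
    using cis_first_order_bound[of "l * y"] by (simp only: power2_abs) (simp add: norm_mult abs_mult)
  also have "\<bar>l * y\<bar> \<le> \<bar>l\<bar> * ?R"
    using y by (simp add: abs_mult mult_left_mono)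
  then have "\<bar>l * y\<bar>\<^sup>2 + \<bar>l * y\<bar> \<le> (\<bar>l\<bar> * ?R)\<^sup>2 + \<bar>l\<bar> * ?R"
    by (intro add_mono power_mono) auto
  finally show "norm (cis (l * y) - 1) \<le> \<bar>l\<bar> * ?R + (\<bar>l\<bar> * ?R)\<^sup>2" by simp
qed

lemma cis_difference_quotient_limit:
  "\<exists>e. (e \<longlongrightarrow> 0) (at 0) \<and> (\<forall>\<^sub>F l in at 0. \<forall>y\<in>{s..t}. norm ((cis (l * y) - 1) / of_real l - \<i> * of_real y) \<le> e l)"
proof (intro exI conjI)
  let ?R = "max \<bar>s\<bar> \<bar>t\<bar>"
  have "((\<lambda>l. \<bar>l\<bar> * ?R\<^sup>2) \<longlongrightarrow> \<bar>0\<bar> * ?R\<^sup>2) (at (0::real))" by (intro tendsto_intros)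
  then show "((\<lambda>l. \<bar>l\<bar> * ?R\<^sup>2) \<longlongrightarrow> 0) (at (0::real))" by simp
  have "\<forall>\<^sub>F l in at (0::real). l \<noteq> 0" by (rule eventually_neq_at_within)
  then show "\<forall>\<^sub>F l in at 0. \<forall>y\<in>{s..t}. norm ((cis (l * y) - 1) / of_real l - \<i> * of_real y) \<le> \<bar>l\<bar> * ?R\<^sup>2"
  proof eventually_elim
    case (elim l)
    show ?case
    proof
      fix y assume "y \<in> {s..t}"
      then have "\<bar>y\<bar> \<le> \<bar>?R\<bar>" by auto
      then have y: "y\<^sup>2 \<le> ?R\<^sup>2" by (rule abs_le_square_iff[THEN iffD1])
      have "(cis (l * y) - 1) / of_real l - \<i> * of_real y = (cis (l * y) - 1 - \<i> * of_real (l * y)) / of_real l"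
        using elim by (simp add: field_simps)
      then have "norm ((cis (l * y) - 1) / of_real l - \<i> * of_real y) = norm (cis (l * y) - 1 - \<i> * of_real (l * y)) / \<bar>l\<bar>"
        by (simp add: norm_divide)
      also have "\<dots> \<le> (l * y)\<^sup>2 / \<bar>l\<bar>" by (intro divide_right_mono cis_first_order_bound) auto
      also have "\<dots> = \<bar>l\<bar> * y\<^sup>2"
      proof -
        have "(l * y)\<^sup>2 = \<bar>l\<bar> * (\<bar>l\<bar> * y\<^sup>2)" by (simp add: power_mult_distrib power2_eq_square)
        then show ?thesis using elim by simp
      qed
      also have "\<dots> \<le> \<bar>l\<bar> * ?R\<^sup>2" using y by (intro mult_left_mono) auto
      finally show "norm ((cis (l * y) - 1) / of_real l - \<i> * of_real y) \<le> \<bar>l\<bar> * ?R\<^sup>2" .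
    qed
  qed
qed

lemma L2_exp2_quotient_limit:
  assumes "L2_exp2 W W0 W1"
  shows "loc_L1_tendsto (\<lambda>l y. fst ((1 / of_real l) \<odot> (W l y - W0 y))) (\<lambda>y. fst (W1 y)) (at 0)"
    and "loc_L1_tendsto (\<lambda>l y. snd ((1 / of_real l) \<odot> (W l y - W0 y))) (\<lambda>y. snd (W1 y)) (at 0)"
proof -
  let ?Q = "\<lambda>l y. (1 / of_real l) \<odot> (W l y - W0 y)"
  have W1: "W1 \<in> L2per" using assms by (simp add: L2_exp2_def)
  have "L2_order (Suc 0) (\<lambda>l y. (1 / of_real l) \<odot> (W l y - (W0 y + of_real l \<odot> W1 y)))"
    using assms by (intro L2_order_divide) (simp add: L2_exp2_def eval_nat_numeral)
  moreover have "L2_order 0 (\<lambda>l y. ?Q l y)"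
    using L2_exp2_order_1[OF assms] by (intro L2_order_divide) simp
  then have Q: "\<forall>\<^sub>F l in at 0. ?Q l \<in> L2per" by (auto simp: L2_order_def elim: eventually_mono)
  moreover have "\<forall>\<^sub>F l in at (0::real). l \<noteq> 0" by (rule eventually_neq_at_within)
  ultimately have R: "L2_order (Suc 0) (\<lambda>l y. ?Q l y - W1 y)"
  proof (elim L2_order_cong)
    show "\<forall>\<^sub>F l in at 0. (\<lambda>y. (1 / of_real l) \<odot> (W l y - (W0 y + of_real l \<odot> W1 y))) \<doteq> (\<lambda>y. ?Q l y - W1 y)
        \<and> (\<lambda>y. ?Q l y - W1 y) \<in> L2per"
      using Q \<open>\<forall>\<^sub>F l in at (0::real). l \<noteq> 0\<close>
    proof eventually_elim
      case (elim l)
      have "(1 / of_real l) \<odot> (W l y - (W0 y + of_real l \<odot> W1 y)) = ?Q l y - W1 y" for y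
        using elim(2) by (simp add: prod_eq_iff algebra_simps)
      with elim(1) W1 show ?case by (simp add: L2per_diff)
    qed
  qed
  have lim: "((\<lambda>l. L2norm (\<lambda>y. ?Q l y - W1 y)) \<longlongrightarrow> 0) (at 0)" by (rule L2_order_tendsto[OF R])
  have D: "\<forall>\<^sub>F l in at 0. (\<lambda>y. ?Q l y - W1 y) \<in> L2per" using R by (auto simp: L2_order_def elim: eventually_mono)
  show "loc_L1_tendsto (\<lambda>l y. fst (?Q l y)) (\<lambda>y. fst (W1 y)) (at 0)"
  proof (rule L2per_limit_loc_L1)
    show "\<forall>\<^sub>F l in at 0. (\<lambda>y. fst (?Q l y)) \<in> L2per" using Q by eventually_elim (simp only: L2per_vfun_iff)
    show "(\<lambda>y. fst (W1 y)) \<in> L2per" using W1 by (simp only: L2per_vfun_iff)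
    show "((\<lambda>l. L2norm (\<lambda>y. fst (?Q l y) - fst (W1 y))) \<longlongrightarrow> 0) (at 0)"
    proof (rule tendsto_sandwich[OF _ _ tendsto_const lim])
      show "\<forall>\<^sub>F l in at 0. L2norm (\<lambda>y. fst (?Q l y) - fst (W1 y)) \<le> L2norm (\<lambda>y. ?Q l y - W1 y)"
        using D by eventually_elim (use L2norm_component_le(1) in fastforce)
    qed simp
  qed
  show "loc_L1_tendsto (\<lambda>l y. snd (?Q l y)) (\<lambda>y. snd (W1 y)) (at 0)"
  proof (rule L2per_limit_loc_L1)
    show "\<forall>\<^sub>F l in at 0. (\<lambda>y. snd (?Q l y)) \<in> L2per" using Q by eventually_elim (simp only: L2per_vfun_iff)
    show "(\<lambda>y. snd (W1 y)) \<in> L2per" using W1 by (simp only: L2per_vfun_iff)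
    show "((\<lambda>l. L2norm (\<lambda>y. snd (?Q l y) - snd (W1 y))) \<longlongrightarrow> 0) (at 0)"
    proof (rule tendsto_sandwich[OF _ _ tendsto_const lim])
      show "\<forall>\<^sub>F l in at 0. L2norm (\<lambda>y. snd (?Q l y) - snd (W1 y)) \<le> L2norm (\<lambda>y. ?Q l y - W1 y)"
        using D by eventually_elim (use L2norm_component_le(2) in fastforce)
    qed simp
  qed
qed

text \<open>The term \<open>iy f\<^sub>0\<close> is the derivative of \<open>e\<^bsup>ily\<^esup> f\<^sub>0\<close> at \<open>l = 0\<close>; it grows in \<open>y\<close>, but uniformly on bounded
intervals the difference quotients of the exponential converge.\<close>

lemma conjugated_quotient_limit:
  assumes q: "loc_L1_tendsto (\<lambda>l y. (f l y - f0 y) / of_real l) f1 (at 0)" and f0: "loc_int f0"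
  shows "loc_L1_tendsto (\<lambda>l y. (cis (l * y) * f l y - f0 y) / of_real l) (\<lambda>y. f1 y + \<i> * of_real y * f0 y) (at 0)"
proof -
  have "loc_L1_tendsto (\<lambda>l y. cis (l * y) * ((f l y - f0 y) / of_real l)) (\<lambda>y. 1 * f1 y) (at 0)"
    by (rule loc_L1_tendsto_mult_uniform[OF q]) (auto intro!: continuous_intros cis_scaled_limit)
  moreover have "loc_L1_tendsto (\<lambda>l y. (cis (l * y) - 1) / of_real l * f0 y) (\<lambda>y. \<i> * of_real y * f0 y) (at 0)"
  proof (rule loc_L1_tendsto_mult_uniform)
    show "loc_L1_tendsto (\<lambda>l. f0) f0 (at 0)" using f0 by (simp add: loc_L1_tendsto_def)
    show "continuous_on UNIV (\<lambda>y. (cis (l * y) - 1) / of_real l)" for l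
      unfolding divide_inverse by (intro continuous_intros)
  qed (auto intro!: continuous_intros cis_difference_quotient_limit)
  ultimately have "loc_L1_tendsto (\<lambda>l y. cis (l * y) * ((f l y - f0 y) / of_real l) + (cis (l * y) - 1) / of_real l * f0 y)
      (\<lambda>y. 1 * f1 y + \<i> * of_real y * f0 y) (at 0)" by (rule loc_L1_tendsto_add)
  then show ?thesis
    by (rule loc_L1_tendsto_cong) (auto simp: diff_divide_distrib algebra_simps)
qed

section \<open>The linearized Whitham system\<close>

context wave_point
begin

lemma whitham_coefficients:
  "d1 (freq c) k b = - c k b - k * d1 c k b" "d2 (freq c) k b = - k * d2 c k b"
  "d1 (wflux c H) k b = d1 c k b * mean H k b + c k b * d1 (mean H) k b"
  "d2 (wflux c H) k b = d2 c k b * mean H k b + c k b * d2 (mean H) k b - 1"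
proof -
  note ck = DERIV_c_k[OF point, folded d1_c] and cb = DERIV_c_b[OF point, folded d2_c]
  note Mk = DERIV_mean_k[folded d1_mean] and Mb = DERIV_mean_b[folded d2_mean]
  have "((\<lambda>x. freq c x b) has_real_derivative - c k b - k * d1 c k b) (at k)"
    unfolding freq_def by (auto intro!: derivative_eq_intros ck)
  then show "d1 (freq c) k b = - c k b - k * d1 c k b"
    unfolding d1_def[of "freq c"] by (rule DERIV_imp_deriv)
  have "((\<lambda>x. freq c k x) has_real_derivative - k * d2 c k b) (at b)"
    unfolding freq_def by (auto intro!: derivative_eq_intros cb)
  then show "d2 (freq c) k b = - k * d2 c k b"
    unfolding d2_def[of "freq c"] by (rule DERIV_imp_deriv)
  have "((\<lambda>x. wflux c H x b) has_real_derivative d1 c k b * mean H k b + c k b * d1 (mean H) k b) (at k)"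
    unfolding wflux_def by (auto intro!: derivative_eq_intros ck Mk)
  then show "d1 (wflux c H) k b = d1 c k b * mean H k b + c k b * d1 (mean H) k b"
    unfolding d1_def[of "wflux c H"] by (rule DERIV_imp_deriv)
  have "((\<lambda>x. wflux c H k x) has_real_derivative d2 c k b * mean H k b + c k b * d2 (mean H) k b - 1) (at b)"
    unfolding wflux_def by (auto intro!: derivative_eq_intros cb Mb)
  then show "d2 (wflux c H) k b = d2 c k b * mean H k b + c k b * d2 (mean H) k b - 1"
    unfolding d2_def[of "wflux c H"] by (rule DERIV_imp_deriv)
qed

text \<open>The Whitham system is homogeneous of first order, so a solution of the order-zero equations gives a
mode with eigenvalue exactly \<open>k\<nu>\<lambda>\<^sup>0\<close> at every frequency \<open>\<nu>\<close>, not only to leading order.\<close>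

lemma whitham_order_zero_imp_mode:
  assumes "whitham_order_zero c H k b lam0 K0 B0"
  shows "whitham_mode c H k b \<nu> (of_real k * \<nu> * lam0) K0 B0"
proof -
  define kk ss ck cb M Mk Mb where "kk = complex_of_real k" and "ss = complex_of_real (c k b)"
    and "ck = complex_of_real (d1 c k b)" and "cb = complex_of_real (d2 c k b)"
    and "M = complex_of_real (mean H k b)" and "Mk = complex_of_real (d1 (mean H) k b)"
    and "Mb = complex_of_real (d2 (mean H) k b)"
  note defs = this
  have k0: "kk \<noteq> 0" using k_nonzero[OF point] by (simp add: defs)
  have e1: "lam0 * K0 + kk * (ck * K0 + cb * B0) = 0"
    and e2: "lam0 * ((Mk - M / kk) * K0 + Mb * B0) - B0 = 0"
    using assms by (simp_all add: whitham_order_zero_def defs)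
  have "kk * \<nu> * (lam0 * K0 + kk * (ck * K0 + cb * B0)) =
      (kk * \<nu> * lam0 + - kk * ss * \<nu>) * K0 - kk * \<nu> * ((- ss - kk * ck) * K0 + - kk * cb * B0)"
    by (simp add: algebra_simps)
  moreover have "kk * \<nu> * (lam0 * ((Mk - M / kk) * K0 + Mb * B0) - B0) + \<nu> * M * (lam0 * K0 + kk * (ck * K0 + cb * B0)) =
      (kk * \<nu> * lam0 + - kk * ss * \<nu>) * (Mk * K0 + Mb * B0) + kk * \<nu> * ((ck * M + ss * Mk) * K0 + (cb * M + ss * Mb - 1) * B0)"
    using k0 by (simp add: field_simps)
  ultimately show ?thesis
    unfolding whitham_mode_def whitham_coefficients e1 e2
    by (simp add: defs freq_def)
qed

lemma whitham_order_zero_imp_leading_term: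
  assumes "whitham_order_zero c H k b lam0 K0 B0" "(K0, B0) \<noteq> (0, 0)"
  shows "whitham_leading_term c H k b lam0 K0 B0"
  unfolding whitham_leading_term_def
proof (intro conjI exI)
  show "\<forall>\<^sub>F l in at (0::real). (K0, B0) \<noteq> (0, 0) \<and>
      whitham_mode c H k b (\<i> * of_real l) (of_real k * (\<i> * of_real l) * lam0) K0 B0"
    using assms(2) whitham_order_zero_imp_mode[OF assms(1)] by (intro always_eventually) blast
qed (use assms in \<open>simp_all add: mult.assoc\<close>)

end

section \<open>Expansion of the critical eigenfunctions\<close>

lemma loc_L1_tendsto_scal:
  assumes "loc_L1_tendsto f f0 F" "(a \<longlongrightarrow> a0) F"
  shows "loc_L1_tendsto (\<lambda>n y. a n * f n y) (\<lambda>y. a0 * f0 y) F"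
proof (rule loc_L1_tendsto_mult_uniform[OF assms(1)])
  have "((\<lambda>n. norm (a n - a0)) \<longlongrightarrow> 0) F"
    using tendsto_norm[OF LIM_zero[OF assms(2)]] by simp
  then show "\<exists>e. (e \<longlongrightarrow> 0) F \<and> (\<forall>\<^sub>F n in F. \<forall>y\<in>{s..t}. norm (a n - a0) \<le> e n)" for s t :: real
    by (intro exI[of _ "\<lambda>n. norm (a n - a0)"]) auto
qed auto

lemma scal_exp2_divide_tendsto:
  assumes "scal_exp2 g 0 g1" shows "((\<lambda>l. g l / of_real l) \<longlongrightarrow> g1) (at 0)"
proof -
  obtain C where C: "\<forall>\<^sub>F l in at 0. norm (g l - (0 + of_real l * g1)) \<le> C * \<bar>l\<bar> ^ 2"
    using assms unfolding scal_exp2_def scal_order_def by blast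
  have "\<forall>\<^sub>F l in at (0::real). l \<noteq> 0" by (rule eventually_neq_at_within)
  with C have "\<forall>\<^sub>F l in at 0. norm (g l / of_real l - g1) \<le> C * \<bar>l\<bar>"
  proof eventually_elim
    case (elim l)
    have "g l / of_real l - g1 = (g l - (0 + of_real l * g1)) / of_real l"
      using elim(2) by (simp add: field_simps)
    then have "norm (g l / of_real l - g1) = norm (g l - (0 + of_real l * g1)) / \<bar>l\<bar>"
      by (simp add: norm_divide)
    also have "\<dots> \<le> C * \<bar>l\<bar> ^ 2 / \<bar>l\<bar>" using elim by (intro divide_right_mono) auto
    also have "\<dots> = C * \<bar>l\<bar>" using elim(2) by (simp add: divide_eq_eq power2_eq_square)
    finally show ?case .
  qed
  then have ev: "\<forall>\<^sub>F l in at 0. norm (g l / of_real l - g1) \<le> C * \<bar>l\<bar>" .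
  have "((\<lambda>l. C * \<bar>l\<bar>) \<longlongrightarrow> C * \<bar>0\<bar>) (at (0::real))" by (intro tendsto_intros)
  then have "((\<lambda>l. C * \<bar>l\<bar>) \<longlongrightarrow> 0) (at (0::real))" by simp
  from Lim_null_comparison[OF ev this] show ?thesis by (rule LIM_zero_cancel)
qed

locale bloch_spectrum = wave_point +
  fixes lam :: "nat \<Rightarrow> real \<Rightarrow> complex" and v vt w wt :: "nat \<Rightarrow> real \<Rightarrow> vfun"
    and \<beta> \<beta>t :: "nat \<Rightarrow> nat \<Rightarrow> real \<Rightarrow> complex"
  assumes c_b: "d2 c k b \<noteq> 0" and M_b: "d2 (mean H) k b \<noteq> 0"
    and zero: "zero_eigenspace (T 0) Uy"
    and eigenvalues: "critical_eigenvalues T lam"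
    and bases: "critical_bases T lam Uy v vt"
    and duals: "dual_eigenfunctions T lam w wt"
    and coords: "eigenfunction_coordinates v vt w wt \<beta> \<beta>t"
begin

\<comment> \<open>keeps the first index of families indexed by \<open>{1, 2}\<close> in the form \<open>1\<close>\<close>
declare One_nat_def [simp del]

lemma k_ne_0: "k \<noteq> 0" by (rule k_nonzero[OF point])

lemma kernel: "U \<in> L2per \<Longrightarrow> T 0 U (\<lambda>_. 0) \<Longrightarrow> \<exists>a. U \<doteq> (\<lambda>y. a \<odot> Uy y)"
proof -
  assume U: "U \<in> L2per" and B: "T 0 U (\<lambda>_. 0)"
  have "U \<in> ker_pow (T 0) 0 1"
    unfolding One_nat_def ker_pow.simps using B by (auto simp: bloch_def intro!: exI[of _ "\<lambda>_. 0"])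
  then show "\<exists>a. U \<doteq> (\<lambda>y. a \<odot> Uy y)" using zero by (simp add: zero_eigenspace_def)
qed

lemma eigenfunction_equation:
  assumes "j \<in> {1,2}"
  shows "\<forall>\<^sub>F l in at 0. w j l \<in> L2per \<and> (\<exists>V. T l (w j l) V \<and> V \<doteq> (\<lambda>y. lam j l \<odot> w j l y))"
proof -
  have "\<forall>\<^sub>F l in at 0. eigenfunction (T l) (lam j l) (w j l)"
    using duals assms unfolding dual_eigenfunctions_def by (auto elim: eventually_mono)
  then show ?thesis
  proof eventually_elim
    case (elim l)
    then obtain V where V: "T l (w j l) V" "(\<lambda>y. V y - lam j l \<odot> w j l y) \<doteq> (\<lambda>_. 0)"
      by (auto simp: eigenfunction_def One_nat_def)
    have "V \<doteq> (\<lambda>y. lam j l \<odot> w j l y)" using V(2) by eventually_elim simp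
    moreover have "w j l \<in> L2per"
      using V(1) by (auto simp: bloch_def H1per_def H2per_def L2per_vfun_iff[of "w j l"])
    ultimately show ?case using V(1) by blast
  qed
qed

lemma bases_0:
  shows "v 1 0 \<in> L2per" "v 2 0 \<in> L2per" "vt 1 0 \<in> L2per" "vt 2 0 \<in> L2per"
    and "L2inner (vt 1 0) (v 1 0) = 1" "L2inner (vt 2 0) (v 2 0) = 1" "L2inner (vt 2 0) (v 1 0) = 0"
    and "total_eigenspace (T 0) {lam 1 0, lam 2 0} = L2_span2 (\<lambda>k. v k 0)"
    and "vt 2 0 \<doteq> (\<lambda>_. (1, 0))" and "\<exists>a. a \<noteq> 0 \<and> v 1 0 \<doteq> (\<lambda>y. a \<odot> Uy y)"
proof -
  have ev: "\<forall>\<^sub>F l in nhds 0.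
        total_eigenspace (T l) {lam 1 l, lam 2 l} = L2_span2 (\<lambda>k. v k l) \<and>
        total_eigenspace (adjoint_op (T l)) {cnj (lam 1 l), cnj (lam 2 l)} = L2_span2 (\<lambda>k. vt k l) \<and>
        (\<forall>j\<in>{1,2}. \<forall>k\<in>{1,2}. L2inner (vt j l) (v k l) = (if j = k then 1 else 0))"
    using bases unfolding critical_bases_def by blast
  from eventually_nhds_x_imp_x[OF ev]
  show "L2inner (vt 1 0) (v 1 0) = 1" "L2inner (vt 2 0) (v 2 0) = 1" "L2inner (vt 2 0) (v 1 0) = 0"
    "total_eigenspace (T 0) {lam 1 0, lam 2 0} = L2_span2 (\<lambda>k. v k 0)" by auto
  have "L2_analytic_near_0 (v 1)" "L2_analytic_near_0 (v 2)" "L2_analytic_near_0 (vt 1)" "L2_analytic_near_0 (vt 2)"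
    using bases unfolding critical_bases_def by blast+
  then show "v 1 0 \<in> L2per" "v 2 0 \<in> L2per" "vt 1 0 \<in> L2per" "vt 2 0 \<in> L2per"
    using L2_analytic_exp2 by blast+
  show "vt 2 0 \<doteq> (\<lambda>_. (1, 0))" "\<exists>a. a \<noteq> 0 \<and> v 1 0 \<doteq> (\<lambda>y. a \<odot> Uy y)"
    using bases unfolding critical_bases_def by blast+
qed

lemma bases_expansion: "\<exists>a1. L2_exp2 (v 1) (v 1 0) a1" "\<exists>a2. L2_exp2 (v 2) (v 2 0) a2"
  using bases L2_analytic_exp2 unfolding critical_bases_def by blast+

lemma vt2_0_pairing: "L2inner (vt 2 0) V = integral {0..1} (\<lambda>y. fst (V y))"
  using L2inner_cong[OF bases_0(9), of V V] by (simp add: L2inner_first_coordinate)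

lemma duality:
  "\<forall>\<^sub>F l in at 0. \<forall>j\<in>{1,2}. \<forall>m\<in>{1,2}. cnj (\<beta>t j 1 l) * \<beta> m 1 l + cnj (\<beta>t j 2 l) * \<beta> m 2 l = (if j = m then 1 else 0)"
proof -
  have 1: "\<forall>\<^sub>F l in at 0. \<forall>j\<in>{1,2}. w j l \<doteq> (\<lambda>y. \<beta> j 1 l \<odot> v 1 l y + \<beta> j 2 l \<odot> v 2 l y) \<and>
        wt j l \<doteq> (\<lambda>y. \<beta>t j 1 l \<odot> vt 1 l y + \<beta>t j 2 l \<odot> vt 2 l y)"
    using coords unfolding eigenfunction_coordinates_def sum_12 by blast
  have 2: "\<forall>\<^sub>F l in at 0. \<forall>j\<in>{1,2}. \<forall>m\<in>{1,2}. L2inner (wt j l) (w m l) = (if j = m then 1 else 0)"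
    using duals unfolding dual_eigenfunctions_def by (auto elim: eventually_mono)
  have "\<forall>\<^sub>F l in nhds 0. \<forall>j\<in>{1,2}. \<forall>k\<in>{1,2}. L2inner (vt j l) (v k l) = (if j = k then 1 else 0)"
    using bases unfolding critical_bases_def by (auto elim: eventually_mono)
  then have 3: "\<forall>\<^sub>F l in at 0. \<forall>j\<in>{1,2}. \<forall>k\<in>{1,2}. L2inner (vt j l) (v k l) = (if j = k then 1 else 0)"
    by (simp add: eventually_at_filter eventually_mono)
  have "\<forall>\<^sub>F l in nhds 0. \<forall>k\<in>{1,2}. v k l \<in> L2per \<and> vt k l \<in> L2per"
  proof -
    have "L2_analytic_near_0 (v 1)" "L2_analytic_near_0 (v 2)" "L2_analytic_near_0 (vt 1)" "L2_analytic_near_0 (vt 2)"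
      using bases unfolding critical_bases_def by blast+
    then have "\<forall>\<^sub>F l in nhds 0. v 1 l \<in> L2per" "\<forall>\<^sub>F l in nhds 0. v 2 l \<in> L2per"
      "\<forall>\<^sub>F l in nhds 0. vt 1 l \<in> L2per" "\<forall>\<^sub>F l in nhds 0. vt 2 l \<in> L2per"
      unfolding L2_analytic_near_0_def by (auto elim: eventually_mono)
    then show ?thesis by eventually_elim auto
  qed
  then have 4: "\<forall>\<^sub>F l in at 0. \<forall>k\<in>{1,2}. v k l \<in> L2per \<and> vt k l \<in> L2per"
    by (simp add: eventually_at_filter eventually_mono)
  show ?thesis
    using 1 2 3 4
  proof eventually_elim
    case (elim l)
    have L: "vt 1 l \<in> L2per" "vt 2 l \<in> L2per" "v 1 l \<in> L2per" "v 2 l \<in> L2per" using elim(4) by auto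
    have b: "L2inner (vt 1 l) (v 1 l) = 1" "L2inner (vt 1 l) (v 2 l) = 0"
        "L2inner (vt 2 l) (v 1 l) = 0" "L2inner (vt 2 l) (v 2 l) = 1" using elim(3) by auto
    show ?case
    proof (intro ballI)
      fix j m :: nat assume jm: "j \<in> {1,2}" "m \<in> {1,2}"
      have "L2inner (wt j l) (w m l) = L2inner (\<lambda>y. \<beta>t j 1 l \<odot> vt 1 l y + \<beta>t j 2 l \<odot> vt 2 l y)
          (\<lambda>y. \<beta> m 1 l \<odot> v 1 l y + \<beta> m 2 l \<odot> v 2 l y)"
        using elim(1) jm by (intro L2inner_cong) blast+
      also have "\<dots> = cnj (\<beta>t j 1 l) * \<beta> m 1 l + cnj (\<beta>t j 2 l) * \<beta> m 2 l"
        unfolding L2inner_combination[OF L] b by simp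
      finally have *: "L2inner (wt j l) (w m l) = cnj (\<beta>t j 1 l) * \<beta> m 1 l + cnj (\<beta>t j 2 l) * \<beta> m 2 l" .
      show "cnj (\<beta>t j 1 l) * \<beta> m 1 l + cnj (\<beta>t j 2 l) * \<beta> m 2 l = (if j = m then 1 else 0)"
        unfolding *[symmetric] using elim(2) jm by blast
    qed
  qed
qed

text \<open>The eigenvalue equation is divided by \<open>l\<close> after subtraction of \<open>A W\<^sub>0 = 0\<close> and passes to the limit
because the operator is closed.\<close>

lemma first_order_equation:
  assumes j: "j \<in> {1,2}" and lam1: "scal_exp2 (lam j) 0 \<rho>"
    and W: "L2_exp2 (\<lambda>l y. of_real l \<odot> w j l y) (\<lambda>y. \<mu> \<odot> Uy y) W1"
  shows "solves (\<lambda>y. W1 y + (\<i> * of_real y) \<odot> \<mu> \<odot> Uy y) (\<lambda>y. \<rho> \<odot> \<mu> \<odot> Uy y)"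
proof -
  let ?Z = "\<lambda>y. \<mu> \<odot> Uy y" and ?W = "\<lambda>l y. of_real l \<odot> w j l y"
  define X where "X l y = (1 / of_real l) \<odot> (cis (l * y) \<odot> ?W l y - ?Z y)" for l y
  define G where "G l y = (1 / of_real l) \<odot> (cis (l * y) \<odot> lam j l \<odot> ?W l y)" for l y
  have W0_L2: "?Z \<in> L2per" by (intro L2per_cmul tangent_L2per)
  have sys0: "solves ?Z (\<lambda>_. 0)" using solves_cmul[OF solves_dyU, of \<mu>] by simp
  have ev: "\<forall>\<^sub>F l in at 0. solves (X l) (G l)"
    using eigenfunction_equation[OF j]
  proof eventually_elim
    case (elim l)
    then obtain V where V: "T l (w j l) V" "V \<doteq> (\<lambda>y. lam j l \<odot> w j l y)" by blast
    have "solves (\<lambda>y. cis (l * y) \<odot> w j l y) (\<lambda>y. cis (l * y) \<odot> lam j l \<odot> w j l y)"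
      by (rule solves_cong[OF bloch_imp_solves[OF V(1)]]) (use V(2) in \<open>auto elim: eventually_mono\<close>)
    then have "solves (\<lambda>y. (1 / of_real l) \<odot> (of_real l \<odot> cis (l * y) \<odot> w j l y - ?Z y))
        (\<lambda>y. (1 / of_real l) \<odot> (of_real l \<odot> cis (l * y) \<odot> lam j l \<odot> w j l y - 0))"
      by (intro solves_cmul solves_diff sys0)
    then show ?case by (rule solves_cong) (simp_all add: X_def G_def cmul_cmul mult_ac)
  qed
  note Q = L2_exp2_quotient_limit[OF W]
  have l1: "loc_int (\<lambda>y. fst (?Z y))" and l2: "loc_int (\<lambda>y. snd (?Z y))"
    using W0_L2[unfolded L2per_vfun_iff] L2per_loc_int by blast+
  have q1: "loc_L1_tendsto (\<lambda>l y. (fst (?W l y) - fst (?Z y)) / of_real l) (\<lambda>y. fst (W1 y)) (at 0)"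
    and q2: "loc_L1_tendsto (\<lambda>l y. (snd (?W l y) - snd (?Z y)) / of_real l) (\<lambda>y. snd (W1 y)) (at 0)"
    using Q by simp_all
  note c1 = conjugated_quotient_limit[OF q1 l1] and c2 = conjugated_quotient_limit[OF q2 l2]
  have r: "((\<lambda>l. lam j l / of_real l) \<longlongrightarrow> \<rho>) (at 0)" by (rule scal_exp2_divide_tendsto[OF lam1])
  have id: "((\<lambda>l. complex_of_real l) \<longlongrightarrow> 0) (at 0)"
    using tendsto_of_real[OF tendsto_ident_at, of 0 UNIV] by simp
  have nz: "\<forall>\<^sub>F l in at (0::real). l \<noteq> 0" by (rule eventually_neq_at_within)
  have g: "loc_L1_tendsto (\<lambda>l y. (lam j l / of_real l) * (of_real l * ((cis (l * y) * f l y - f0 y) / of_real l) + f0 y))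
      (\<lambda>y. \<rho> * (0 * f1 y + f0 y)) (at 0)"
    if "loc_L1_tendsto (\<lambda>l y. (cis (l * y) * f l y - f0 y) / of_real l) f1 (at 0)" "loc_int f0" for f f0 f1
    using that(2) by (intro loc_L1_tendsto_scal loc_L1_tendsto_add that(1) r id) (simp add: loc_L1_tendsto_def)
  show ?thesis
  proof (rule solves_limit[OF ev])
    show "loc_L1_tendsto (\<lambda>l y. fst (X l y)) (\<lambda>y. fst (W1 y + (\<i> * of_real y) \<odot> \<mu> \<odot> Uy y)) (at 0)"
      using c1 by (simp add: X_def mult.assoc)
    show "loc_L1_tendsto (\<lambda>l y. snd (X l y)) (\<lambda>y. snd (W1 y + (\<i> * of_real y) \<odot> \<mu> \<odot> Uy y)) (at 0)"
      using c2 by (simp add: X_def mult.assoc)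
    show "loc_L1_tendsto (\<lambda>l y. fst (G l y)) (\<lambda>y. fst (\<rho> \<odot> \<mu> \<odot> Uy y)) (at 0)"
      by (rule loc_L1_tendsto_cong[OF g[OF c1 l1]]) (use nz in \<open>auto elim!: eventually_mono simp: G_def field_simps\<close>)
    show "loc_L1_tendsto (\<lambda>l y. snd (G l y)) (\<lambda>y. snd (\<rho> \<odot> \<mu> \<odot> Uy y)) (at 0)"
      by (rule loc_L1_tendsto_cong[OF g[OF c2 l2]]) (use nz in \<open>auto elim!: eventually_mono simp: G_def field_simps\<close>)
  qed simp
qed

text \<open>The mass equation integrated over a period reads \<open>\<lambda> \<integral>h = ilk \<integral>(c h - q)\<close>. The functional on either side
vanishes on \<open>U'\<close>, so both integrals have a limit for \<open>w\<^sub>j\<close> itself although \<open>w\<^sub>j\<close> is of order \<open>1/l\<close>.\<close>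

lemma mean_flux_limit:
  assumes j: "j \<in> {1,2}" and lam1: "scal_exp2 (lam j) 0 \<rho>"
    and W: "L2_exp2 (\<lambda>l y. of_real l \<odot> w j l y) (\<lambda>y. \<mu> \<odot> Uy y) W1"
  shows "\<rho> * integral {0..1} (\<lambda>y. fst (W1 y)) =
     \<i> * of_real k * integral {0..1} (\<lambda>y. of_real (c k b) * fst (W1 y) - snd (W1 y))"
proof -
  let ?Z = "\<lambda>y. \<mu> \<odot> Uy y" and ?W = "\<lambda>l y. of_real l \<odot> w j l y"
  let ?Q = "\<lambda>l y. (1 / of_real l) \<odot> (?W l y - ?Z y)"
  let ?p = "\<lambda>u. of_real (c k b) * fst u - snd u"
  note Q = L2_exp2_quotient_limit[OF W]
  have nz: "\<forall>\<^sub>F l in at (0::real). l \<noteq> 0" by (rule eventually_neq_at_within)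
  have lim1: "((\<lambda>l. integral {0..1} (\<lambda>y. fst (?Q l y))) \<longlongrightarrow> integral {0..1} (\<lambda>y. fst (W1 y))) (at 0)"
    by (rule loc_L1_tendsto_integral[OF Q(1)])
  have lim2: "((\<lambda>l. integral {0..1} (\<lambda>y. ?p (?Q l y))) \<longlongrightarrow> integral {0..1} (\<lambda>y. ?p (W1 y))) (at 0)"
    by (intro loc_L1_tendsto_integral loc_L1_tendsto_diff loc_L1_tendsto_cmult Q)
  have eq: "\<forall>\<^sub>F l in at 0. (lam j l / of_real l) * integral {0..1} (\<lambda>y. fst (?Q l y)) =
      \<i> * of_real k * integral {0..1} (\<lambda>y. ?p (?Q l y))"
    using eigenfunction_equation[OF j] nz
  proof eventually_elim
    case (elim l)
    then obtain V where V: "T l (w j l) V" "V \<doteq> (\<lambda>y. lam j l \<odot> w j l y)" by blast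
    have L: "(\<lambda>y. fst (w j l y)) \<in> L2per" using elim(1) by (simp only: L2per_vfun_iff)
    have L0: "(\<lambda>y. fst (Uy y)) \<in> L2per" using tangent_L2per(1) by (simp only: L2per_vfun_iff)
    have e: "(\<lambda>y. fst (?Q l y)) = (\<lambda>y. fst (w j l y) - (\<mu> / of_real l) * fst (Uy y))"
      using elim(2) by (simp add: fun_eq_iff field_simps)
    have "integral {0..1} (\<lambda>y. fst (?Q l y)) = integral {0..1} (\<lambda>y. fst (w j l y)) - integral {0..1} (\<lambda>y. (\<mu> / of_real l) * fst (Uy y))"
      unfolding e by (rule integral_diff[OF loc_int_integrable[OF L2per_loc_int[OF L]]
            loc_int_integrable[OF L2per_loc_int[OF L2per_cmult[OF L0]]]])
    also have "\<dots> = integral {0..1} (\<lambda>y. fst (w j l y))"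
      unfolding integral_mult_right mean_tangents(1) by simp
    finally have i1: "integral {0..1} (\<lambda>y. fst (?Q l y)) = integral {0..1} (\<lambda>y. fst (w j l y))" .
    have i2: "(\<lambda>y. ?p (?Q l y)) = (\<lambda>y. ?p (w j l y))"
    proof
      fix y
      have "?p (?Q l y) = (1 / of_real l) * (of_real l * ?p (w j l y) - \<mu> * ?p (Uy y))" by (simp add: algebra_simps)
      also have "?p (Uy y) = 0" by (rule flux_tangents(1))
      finally show "?p (?Q l y) = ?p (w j l y)" using elim(2) by simp
    qed
    have "(\<lambda>y. fst (V y)) \<doteq> (\<lambda>y. lam j l * fst (w j l y))" using V(2) by eventually_elim simp
    from integral_ae_cong[OF this] bloch_mean_identity[OF V(1)]
    have "lam j l * integral {0..1} (\<lambda>y. fst (w j l y)) = \<i> * of_real l * of_real k * integral {0..1} (\<lambda>y. ?p (w j l y))"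
      by simp
    then show ?case unfolding i1 i2 using elim(2) by (simp add: field_simps)
  qed
  have "((\<lambda>l. (lam j l / of_real l) * integral {0..1} (\<lambda>y. fst (?Q l y))) \<longlongrightarrow> \<rho> * integral {0..1} (\<lambda>y. fst (W1 y))) (at 0)"
    by (intro tendsto_mult lim1 scal_exp2_divide_tendsto lam1)
  moreover have "((\<lambda>l. (lam j l / of_real l) * integral {0..1} (\<lambda>y. fst (?Q l y))) \<longlongrightarrow> \<i> * of_real k * integral {0..1} (\<lambda>y. ?p (W1 y))) (at 0)"
    by (rule Lim_transform_eventually[OF tendsto_mult[OF tendsto_const lim2]]) (use eq in \<open>auto elim: eventually_mono\<close>)
  ultimately show ?thesis by (intro tendsto_unique) auto
qed

lemma integral_fst_combination:
  "integral {0..1} (\<lambda>y. fst (x \<odot> Uk y + z \<odot> Ub y + t \<odot> Uy y)) = x * of_real (d1 (mean H) k b) + z * of_real (d2 (mean H) k b)"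
  using L2inner_add_right[of "\<lambda>_. (1, 0)" "\<lambda>y. x \<odot> Uk y + z \<odot> Ub y" "\<lambda>y. t \<odot> Uy y"]
    L2inner_add_right[of "\<lambda>_. (1, 0)" "\<lambda>y. x \<odot> Uk y" "\<lambda>y. z \<odot> Ub y"]
  by (simp only: L2per_add L2per_cmul tangent_L2per L2inner_cmul_right L2inner_first_coordinate mean_tangents
      continuous_periodic_L2per[OF continuous_on_const] simp_thms) simp

lemma integral_flux_combination:
  "integral {0..1} (\<lambda>y. of_real (c k b) * fst (x \<odot> Uk y + z \<odot> Ub y + t \<odot> Uy y) - snd (x \<odot> Uk y + z \<odot> Ub y + t \<odot> Uy y))
    = z - (x * of_real (d1 c k b) + z * of_real (d2 c k b)) * of_real (mean H k b)"
proof -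
  let ?p = "\<lambda>u. of_real (c k b) * fst u - snd u"
  have "?p (x \<odot> Uk y + z \<odot> Ub y + t \<odot> Uy y) = x * ?p (Uk y) + z * ?p (Ub y) + t * ?p (Uy y)" for y
    by (simp add: algebra_simps)
  also have "\<dots> y = z + (- (x * of_real (d1 c k b) + z * of_real (d2 c k b))) * of_real (H k b y)" for y
    unfolding flux_tangents by (simp add: algebra_simps)
  finally have e: "(\<lambda>y. ?p (x \<odot> Uk y + z \<odot> Ub y + t \<odot> Uy y)) =
      (\<lambda>y. z + (- (x * of_real (d1 c k b) + z * of_real (d2 c k b))) * complex_of_real (H k b y))" by blast
  have cH: "continuous_on UNIV (\<lambda>y. complex_of_real (H k b y))"
    by (intro continuous_intros continuous_H point)
  have "integral {0..1} (\<lambda>y. z + r * complex_of_real (H k b y)) = z + r * of_real (mean H k b)" for r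
  proof -
    have "integral {0..1} (\<lambda>y. z + r * complex_of_real (H k b y)) =
        integral {0..1} (\<lambda>y::real. z) + integral {0..1} (\<lambda>y. r * complex_of_real (H k b y))"
      by (rule integral_add) (intro loc_int_integrable loc_int_cmult loc_int_continuous cH continuous_intros)+
    then show ?thesis
      by (simp add: integral_of_real_continuous[OF continuous_H[OF point]] mean_def)
  qed
  then show ?thesis unfolding e by (simp only:) (simp add: algebra_simps)
qed

text \<open>The number \<open>k0\<close> is read off from \<open>W\<^sub>0\<close>, and \<open>b0\<close> is the solution of the first Whitham equation. The
equation for \<open>W\<^sub>1\<close> leaves its component along \<open>U'\<close> undetermined, and this component defines \<open>k1\<close>.\<close>

lemma eigenfunction_expansion:
  assumes j: "j \<in> {1,2}"
  shows "\<exists>k0 k1 b0 lam0. scal_exp2 (lam j) 0 (of_real k * \<i> * lam0) \<and>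
    L2_exp2 (\<lambda>l y. of_real l \<odot> w j l y) (\<lambda>y. (k0 / (\<i> * of_real k)) \<odot> Uy y)
      (\<lambda>y. k0 \<odot> Uk y + b0 \<odot> Ub y + (k1 / of_real k) \<odot> Uy y) \<and>
    whitham_order_zero c H k b lam0 k0 b0 \<and> (k0, b0) \<noteq> (0, 0)"
proof -
  define kk ck cb where "kk = complex_of_real k" and "ck = complex_of_real (d1 c k b)" and "cb = complex_of_real (d2 c k b)"
  note kdefs = this
  have kk0: "kk \<noteq> 0" and cb0: "cb \<noteq> 0" using k_ne_0 c_b by (auto simp: kdefs)
  have an: "analytic_near_0 (lam j)" "lam j 0 = 0"
    using eigenvalues j by (auto simp: critical_eigenvalues_def)
  obtain \<rho> where lam1: "scal_exp2 (lam j) 0 \<rho>" using analytic_near_0_scal_exp2[OF an(1)] an(2) by auto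
  define lam0 where "lam0 = \<rho> / (kk * \<i>)"
  have \<rho>: "\<rho> = kk * \<i> * lam0" using kk0 by (simp add: lam0_def)
  have coordsj: "analytic_ext_0 (\<lambda>l. of_real l * \<beta> j 1 l)" "analytic_ext_0 (\<beta> j 2)"
     "analytic_ext_0 (\<lambda>l. \<beta>t j 1 l / of_real l)" "analytic_ext_0 (\<beta>t j 2)"
    and wj: "\<forall>\<^sub>F l in at 0. w j l \<doteq> (\<lambda>y. \<beta> j 1 l \<odot> v 1 l y + \<beta> j 2 l \<odot> v 2 l y)"
    using coords j unfolding eigenfunction_coordinates_def sum_12 by (blast, blast, blast, blast, auto elim: eventually_mono)
  obtain g0 g1 where g: "scal_exp2 (\<lambda>l. of_real l * \<beta> j 1 l) g0 g1"
    using analytic_ext_0_scal_exp2[OF coordsj(1)] by blast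
  obtain \<beta>20 \<beta>21 where \<beta>2: "scal_exp2 (\<beta> j 2) \<beta>20 \<beta>21" using analytic_ext_0_scal_exp2[OF coordsj(2)] by blast
  obtain B0 B1 where B: "scal_exp2 (\<lambda>l. \<beta>t j 1 l / of_real l) B0 B1" using analytic_ext_0_scal_exp2[OF coordsj(3)] by blast
  obtain C0 C1 where C: "scal_exp2 (\<beta>t j 2) C0 C1" using analytic_ext_0_scal_exp2[OF coordsj(4)] by blast
  obtain a1 where a1: "L2_exp2 (v 1) (v 1 0) a1" using bases_expansion(1) by blast
  obtain a2 where a2: "L2_exp2 (v 2) (v 2 0) a2" using bases_expansion(2) by blast
  obtain a where a: "a \<noteq> 0" "v 1 0 \<doteq> (\<lambda>y. a \<odot> Uy y)" using bases_0(10) by blast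
  have L: "v 1 0 \<in> L2per" "v 2 0 \<in> L2per" "a1 \<in> L2per" "a2 \<in> L2per"
    using bases_0 a1 a2 by (auto simp: L2_exp2_def)
  define \<mu> where "\<mu> = g0 * a"
  define W1 where "W1 y = (g0 \<odot> a1 y + g1 \<odot> v 1 0 y) + (0 \<odot> a2 y + \<beta>20 \<odot> v 2 0 y)" for y
  have W1_L2: "W1 \<in> L2per" unfolding W1_def[abs_def] by (intro L2per_add L2per_cmul L)
  have W: "L2_exp2 (\<lambda>l y. of_real l \<odot> w j l y) (\<lambda>y. \<mu> \<odot> Uy y) W1"
  proof (rule L2_exp2_cong[OF L2_exp2_add[OF L2_exp2_mult[OF g a1] L2_exp2_mult[OF scal_exp2_var_mult[OF \<beta>2] a2]]])
    show "\<forall>\<^sub>F l in at 0. (\<lambda>y. (of_real l * \<beta> j 1 l) \<odot> v 1 l y + (of_real l * \<beta> j 2 l) \<odot> v 2 l y) \<doteq>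
         (\<lambda>y. of_real l \<odot> w j l y) \<and> (\<lambda>y. of_real l \<odot> w j l y) \<in> L2per"
      using wj eigenfunction_equation[OF j]
    proof eventually_elim
      case (elim l)
      have "(\<lambda>y. (of_real l * \<beta> j 1 l) \<odot> v 1 l y + (of_real l * \<beta> j 2 l) \<odot> v 2 l y) \<doteq> (\<lambda>y. of_real l \<odot> w j l y)"
        using elim(1) by eventually_elim (simp add: cmul_add_right cmul_cmul)
      with elim(2) show ?case by (blast intro: L2per_cmul)
    qed
    show "(\<lambda>y. g0 \<odot> v 1 0 y + 0 \<odot> v 2 0 y) \<doteq> (\<lambda>y. \<mu> \<odot> Uy y)"
      using a(2) by eventually_elim (simp add: \<mu>_def cmul_cmul)
  qed (use W1_L2 in \<open>auto simp: W1_def L2per_cmul tangent_L2per\<close>)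
  define K0 where "K0 = \<i> * kk * \<mu>"
  define b0 where "b0 = - K0 * (lam0 + kk * ck) / (kk * cb)"
  have \<mu>: "\<mu> = K0 / (\<i> * kk)" using kk0 by (simp add: K0_def)
  have e1: "lam0 * K0 + kk * (ck * K0 + cb * b0) = 0"
  proof -
    have "kk * (cb * b0) = - K0 * (lam0 + kk * ck)" using kk0 cb0 by (simp add: b0_def)
    then show ?thesis by (simp add: algebra_simps)
  qed
  \<comment> \<open>Subtracting the tangent directions leaves an element of the kernel at \<open>l = 0\<close>.\<close>
  define D where "D y = W1 y - (K0 \<odot> Uk y + b0 \<odot> Ub y)" for y
  have D_L2: "D \<in> L2per" unfolding D_def[abs_def] by (intro L2per_diff L2per_add L2per_cmul W1_L2 tangent_L2per)
  have "solves (\<lambda>y. W1 y + (\<i> * of_real y) \<odot> \<mu> \<odot> Uy y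
        - (K0 \<odot> (Uk y + of_real (y / k) \<odot> Uy y) + b0 \<odot> Ub y))
      (\<lambda>y. \<rho> \<odot> \<mu> \<odot> Uy y - (K0 \<odot> of_real (- k * d1 c k b) \<odot> Uy y + b0 \<odot> of_real (- k * d2 c k b) \<odot> Uy y))"
    by (intro solves_diff solves_add solves_cmul first_order_equation[OF j lam1 W] solves_dkU solves_dbU)
  moreover have "W1 y + (\<i> * of_real y) \<odot> \<mu> \<odot> Uy y
        - (K0 \<odot> (Uk y + of_real (y / k) \<odot> Uy y) + b0 \<odot> Ub y) = D y" for y
  proof -
    have "\<i> * of_real y * \<mu> = K0 * of_real (y / k)"
      unfolding \<mu> using kk0 by (simp add: field_simps) (simp add: kdefs)
    then show ?thesis by (simp add: D_def cmul_cmul cmul_add_right)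
  qed
  moreover have "\<rho> \<odot> \<mu> \<odot> Uy y - (K0 \<odot> of_real (- k * d1 c k b) \<odot> Uy y + b0 \<odot> of_real (- k * d2 c k b) \<odot> Uy y) = 0" for y
  proof -
    have "\<rho> * \<mu> = K0 * lam0" unfolding \<mu> \<rho> using kk0 by simp
    moreover have "K0 * of_real (- k * d1 c k b) + b0 * of_real (- k * d2 c k b) = - kk * (ck * K0 + cb * b0)"
      by (simp add: kdefs algebra_simps)
    moreover have "kk * (ck * K0 + cb * b0) = - (K0 * lam0)" using e1 by (simp add: eq_neg_iff_add_eq_0 mult.commute add.commute)
    ultimately have "\<rho> * \<mu> - (K0 * of_real (- k * d1 c k b) + b0 * of_real (- k * d2 c k b)) = 0" by simp
    then show ?thesis by (simp only: cmul_cmul flip: cmul_add_left cmul_diff_left) simp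
  qed
  ultimately have "solves D (\<lambda>_. 0)" by simp
  then have "T 0 D (\<lambda>_. 0)" by (intro solves_imp_bloch_0 D_L2) auto
  from kernel[OF D_L2 this] obtain t where t: "D \<doteq> (\<lambda>y. t \<odot> Uy y)" by blast
  have W1_eq: "W1 \<doteq> (\<lambda>y. K0 \<odot> Uk y + b0 \<odot> Ub y + t \<odot> Uy y)"
    using t by eventually_elim (simp add: D_def algebra_simps)
  have e2: "lam0 * (of_real (d1 (mean H) k b - mean H k b / k) * K0 + of_real (d2 (mean H) k b) * b0) - b0 = 0"
  proof -
    define M Mk Mb where "M = complex_of_real (mean H k b)" and "Mk = complex_of_real (d1 (mean H) k b)"
      and "Mb = complex_of_real (d2 (mean H) k b)"
    note Mdefs = this
    have fst_eq: "(\<lambda>y. fst (W1 y)) \<doteq> (\<lambda>y. fst (K0 \<odot> Uk y + b0 \<odot> Ub y + t \<odot> Uy y))"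
      and p_eq: "(\<lambda>y. of_real (c k b) * fst (W1 y) - snd (W1 y)) \<doteq>
        (\<lambda>y. of_real (c k b) * fst (K0 \<odot> Uk y + b0 \<odot> Ub y + t \<odot> Uy y) - snd (K0 \<odot> Uk y + b0 \<odot> Ub y + t \<odot> Uy y))"
      using W1_eq by (eventually_elim, simp only:)+
    from mean_flux_limit[OF j lam1 W]
    have "\<rho> * (K0 * Mk + b0 * Mb) = \<i> * kk * (b0 - (K0 * ck + b0 * cb) * M)"
      unfolding integral_ae_cong[OF fst_eq] integral_ae_cong[OF p_eq] integral_fst_combination integral_flux_combination
      by (simp add: Mdefs kdefs)
    then have "(\<i> * kk) * (lam0 * (K0 * Mk + b0 * Mb)) = (\<i> * kk) * (b0 - (K0 * ck + b0 * cb) * M)"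
      unfolding \<rho> by (simp add: mult_ac)
    then have s: "lam0 * (K0 * Mk + b0 * Mb) = b0 - (K0 * ck + b0 * cb) * M"
      using kk0 by simp
    have "kk * (lam0 * ((Mk - M / kk) * K0 + Mb * b0) - b0) =
        kk * (lam0 * (K0 * Mk + b0 * Mb) - (b0 - (K0 * ck + b0 * cb) * M)) - M * (lam0 * K0 + kk * (ck * K0 + cb * b0))"
      using kk0 by (simp add: field_simps)
    also have "\<dots> = 0" unfolding s e1 by simp
    finally show ?thesis using kk0 by (simp add: Mdefs kdefs)
  qed
  have "(K0, b0) \<noteq> (0, 0)"
  proof
    assume "(K0, b0) = (0, 0)"
    then have K00: "K0 = 0" and b00: "b0 = 0" by auto
    then have g00: "g0 = 0" using kk0 a(1) by (auto simp: K0_def \<mu>_def)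
    \<comment> \<open>Then \<open>l w\<^sub>j\<close> would be a multiple of the translation mode up to \<open>O(l\<^sup>2)\<close>.\<close>
    have "L2inner (vt 2 0) W1 = L2inner (vt 2 0) (\<lambda>y. t \<odot> Uy y)"
      by (rule L2inner_cong) (use W1_eq K00 b00 in \<open>auto elim: eventually_mono\<close>)
    also have "\<dots> = t * L2inner (vt 2 0) Uy" by (rule L2inner_cmul_right)
    also have "\<dots> = 0" by (simp add: vt2_0_pairing mean_tangents)
    finally have 1: "L2inner (vt 2 0) W1 = 0" .
    have "W1 = (\<lambda>y. g1 \<odot> v 1 0 y + \<beta>20 \<odot> v 2 0 y)" by (simp add: W1_def[abs_def] g00)
    then have "L2inner (vt 2 0) W1 = \<beta>20"
      by (simp add: L2inner_add_right L2inner_cmul_right L2per_cmul bases_0)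
    with 1 have \<beta>200: "\<beta>20 = 0" by simp
    have "((\<lambda>l. cnj (\<beta>t j 1 l / of_real l) * (of_real l * \<beta> j 1 l) + cnj (\<beta>t j 2 l) * \<beta> j 2 l) \<longlongrightarrow>
        cnj B0 * g0 + cnj C0 * \<beta>20) (at 0)"
      by (intro tendsto_intros scal_exp2_tendsto[OF B] scal_exp2_tendsto[OF g] scal_exp2_tendsto[OF C] scal_exp2_tendsto[OF \<beta>2])
    moreover have "\<forall>\<^sub>F l in at 0. cnj (\<beta>t j 1 l / of_real l) * (of_real l * \<beta> j 1 l) + cnj (\<beta>t j 2 l) * \<beta> j 2 l = 1"
      using duality eventually_neq_at_within[of 0 0 UNIV]
    proof eventually_elim
      case (elim l)
      have "cnj (\<beta>t j 1 l) * \<beta> j 1 l + cnj (\<beta>t j 2 l) * \<beta> j 2 l = 1" using elim(1) j by auto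
      then show ?case using elim(2) by simp
    qed
    ultimately have "((\<lambda>l::real. 1) \<longlongrightarrow> cnj B0 * g0 + cnj C0 * \<beta>20) (at 0)"
      by (rule Lim_transform_eventually)
    then show False by (simp add: g00 \<beta>200 tendsto_const_iff)
  qed
  moreover have "whitham_order_zero c H k b lam0 K0 b0"
    using e1 e2 by (simp add: whitham_order_zero_def kdefs)
  moreover have "L2_exp2 (\<lambda>l y. of_real l \<odot> w j l y) (\<lambda>y. (K0 / (\<i> * of_real k)) \<odot> Uy y)
      (\<lambda>y. K0 \<odot> Uk y + b0 \<odot> Ub y + (t * of_real k / of_real k) \<odot> Uy y)"
  proof (rule L2_exp2_cong[OF W])
    show "\<forall>\<^sub>F l in at 0. (\<lambda>y. of_real l \<odot> w j l y) \<doteq> (\<lambda>y. of_real l \<odot> w j l y) \<and> (\<lambda>y. of_real l \<odot> w j l y) \<in> L2per"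
      using eigenfunction_equation[OF j] by eventually_elim (auto intro: L2per_cmul)
    show "W1 \<doteq> (\<lambda>y. K0 \<odot> Uk y + b0 \<odot> Ub y + (t * of_real k / of_real k) \<odot> Uy y)"
      using W1_eq k_ne_0 by simp
    show "(\<lambda>y. \<mu> \<odot> Uy y) \<doteq> (\<lambda>y. (K0 / (\<i> * of_real k)) \<odot> Uy y)" by (simp add: \<mu> kdefs)
  qed (intro L2per_add L2per_cmul tangent_L2per)+
  moreover have "scal_exp2 (lam j) 0 (of_real k * \<i> * lam0)" using lam1 by (simp add: \<rho> kdefs)
  ultimately show ?thesis by blast
qed

text \<open>Expanding \<open>(k0 + il k1)/(il)\<close> times the modulated translation reproduces \<open>W\<^sub>0/l + W\<^sub>1\<close> up to the term
\<open>il k1 \<partial>\<^sub>kU\<close>, which is of the order of the remainder.\<close>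

lemma eigenfunction_remainder:
  assumes "L2_exp2 (\<lambda>l y. of_real l \<odot> w j l y) (\<lambda>y. (k0 / (\<i> * of_real k)) \<odot> Uy y)
      (\<lambda>y. k0 \<odot> Uk y + b0 \<odot> Ub y + (k1 / of_real k) \<odot> Uy y)"
  shows "bigo_L2 (\<lambda>l y. w j l y -
               ((1 / (\<i> * of_real l) * (k0 + \<i> * of_real l * k1)) \<odot> modulated_translation c H k b l y
                + b0 \<odot> Ub y)) (\<lambda>l. l)"
proof -
  let ?R = "\<lambda>l y. of_real l \<odot> w j l y - ((k0 / (\<i> * of_real k)) \<odot> Uy y
      + of_real l \<odot> (k0 \<odot> Uk y + b0 \<odot> Ub y + (k1 / of_real k) \<odot> Uy y))"
  let ?S = "\<lambda>l y. w j l y - ((1 / (\<i> * of_real l) * (k0 + \<i> * of_real l * k1)) \<odot> modulated_translation c H k b l y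
                + b0 \<odot> Ub y)"
  have "L2_order 1 (\<lambda>l y. (1 / of_real l) \<odot> ?R l y)"
    using assms by (intro L2_order_divide) (simp add: L2_exp2_def One_nat_def eval_nat_numeral)
  moreover have "L2_order 1 (\<lambda>l y. of_real l \<odot> ((- \<i> * k1) \<odot> Uk y))"
    using L2_order_scal[OF scal_order_var L2_order_const[OF L2per_cmul[OF tangent_L2per(2), of "- \<i> * k1"]]] by simp
  ultimately have ord: "L2_order 1 (\<lambda>l y. (1 / of_real l) \<odot> ?R l y + of_real l \<odot> ((- \<i> * k1) \<odot> Uk y))"
    by (rule L2_order_add)
  have "L2_order 1 ?S"
  proof (rule L2_order_cong[OF ord])
    have "\<forall>\<^sub>F l in at 0. (\<lambda>y. (1 / of_real l) \<odot> ?R l y + of_real l \<odot> ((- \<i> * k1) \<odot> Uk y)) \<in> L2per"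
      using ord unfolding L2_order_def by (auto elim: eventually_mono)
    moreover have "\<forall>\<^sub>F l in at (0::real). l \<noteq> 0" by (rule eventually_neq_at_within)
    ultimately show "\<forall>\<^sub>F l in at 0. (\<lambda>y. (1 / of_real l) \<odot> ?R l y + of_real l \<odot> ((- \<i> * k1) \<odot> Uk y)) \<doteq> ?S l \<and> ?S l \<in> L2per"
    proof eventually_elim
      case (elim l)
      have pt: "(1 / of_real l) \<odot> ?R l y + of_real l \<odot> ((- \<i> * k1) \<odot> Uk y) = ?S l y" for y
        using elim(2) k_ne_0
        by (simp add: prod_eq_iff modulated_translation_def field_simps)
      then have E: "(\<lambda>y. (1 / of_real l) \<odot> ?R l y + of_real l \<odot> ((- \<i> * k1) \<odot> Uk y)) = ?S l" by (rule ext)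
      show ?case using elim(1) unfolding E by (intro conjI AE_I2 pt)
    qed
  qed
  from L2_order_bigo[OF this] show ?thesis by simp
qed

end

section \<open>Adapted bases\<close>

text \<open>A one-sided inverse of a square matrix is two-sided.\<close>

lemma dual_matrix_transpose:
  fixes p q r s a b c d :: complex
  assumes "p * a + q * b = 1" "p * c + q * d = 0" "r * a + s * b = 0" "r * c + s * d = 1"
  shows "p * a + r * c = 1" "p * b + r * d = 0"
proof -
  define \<Delta> where "\<Delta> = a * d - b * c"
  have p\<Delta>: "p * \<Delta> = d"
  proof -
    have "p * \<Delta> = (p * a + q * b) * d - b * (p * c + q * d)" by (simp add: \<Delta>_def algebra_simps)
    then show ?thesis using assms by simp
  qed
  have r\<Delta>: "r * \<Delta> = - b"
  proof -
    have "r * \<Delta> = (r * a + s * b) * d - b * (r * c + s * d)" by (simp add: \<Delta>_def algebra_simps)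
    then show ?thesis using assms by simp
  qed
  have "(p * s - q * r) * \<Delta> = (p * a + q * b) * (r * c + s * d) - (p * c + q * d) * (r * a + s * b)"
    by (simp add: \<Delta>_def algebra_simps)
  then have "\<Delta> \<noteq> 0" using assms by auto
  have "(p * a + r * c) * \<Delta> = a * (p * \<Delta>) + c * (r * \<Delta>)" by (simp add: algebra_simps)
  also have "\<dots> = 1 * \<Delta>" unfolding p\<Delta> r\<Delta> by (simp add: \<Delta>_def mult.commute)
  finally show "p * a + r * c = 1" using \<open>\<Delta> \<noteq> 0\<close> by (rule mult_right_cancel[THEN iffD1, rotated])
  have "(p * b + r * d) * \<Delta> = b * (p * \<Delta>) + d * (r * \<Delta>)" by (simp add: algebra_simps)
  then show "p * b + r * d = 0" using \<open>\<Delta> \<noteq> 0\<close> unfolding p\<Delta> r\<Delta> by simp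
qed

context bloch_spectrum
begin

lemma lam_0: "lam 1 0 = 0" "lam 2 0 = 0"
  using eigenvalues by (auto simp: critical_eigenvalues_def)

text \<open>As \<open>A \<partial>\<^sub>bU\<close> is a multiple of \<open>U'\<close>, the function \<open>\<partial>\<^sub>bU\<close> lies in the generalized kernel, which \<open>v\<^sub>1\<close> and
\<open>v\<^sub>2\<close> span at \<open>l = 0\<close>. Pairing with \<open>(1, 0)\<close> gives its coordinate along \<open>v\<^sub>2\<close>.\<close>

lemma v2_0:
  "\<exists>C. v 2 0 \<doteq> (\<lambda>y. of_real (1 / d2 (mean H) k b) \<odot> Ub y + C \<odot> Uy y)"
proof -
  let ?V = "\<lambda>y. of_real (- k * d2 c k b) \<odot> Uy y"
  have V: "?V \<in> L2per" by (intro L2per_cmul tangent_L2per)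
  have "T 0 Ub ?V" by (intro solves_imp_bloch_0 solves_dbU tangent_L2per V)
  moreover have "?V \<in> ker_pow (T 0) 0 1"
  proof -
    have "ker_pow (T 0) 0 1 = {U \<in> L2per. \<exists>a. U \<doteq> (\<lambda>y. a \<odot> Uy y)}"
      using zero unfolding zero_eigenspace_def by blast
    then show ?thesis using V by (simp only:) blast
  qed
  ultimately have "Ub \<in> ker_pow (T 0) 0 (Suc 1)"
    unfolding ker_pow.simps(2)[of _ _ 1] by (intro CollectI exI[of _ ?V]) simp
  then have "Ub \<in> total_eigenspace (T 0) {lam 1 0, lam 2 0}"
    unfolding total_eigenspace_def lam_0 using tangent_L2per(3)
    by (intro CollectI conjI exI[of _ "\<lambda>_. Ub"] exI[of _ "Suc 1"]) auto
  then have "Ub \<in> L2_span2 (\<lambda>k. v k 0)" unfolding bases_0(8) .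
  then obtain x :: "nat \<Rightarrow> complex" where x: "Ub \<doteq> (\<lambda>y. x 1 \<odot> v 1 0 y + x 2 \<odot> v 2 0 y)"
    unfolding L2_span2_def sum_12 by blast
  have "of_real (d2 (mean H) k b) = L2inner (vt 2 0) Ub" unfolding vt2_0_pairing mean_tangents ..
  also have "\<dots> = L2inner (vt 2 0) (\<lambda>y. x 1 \<odot> v 1 0 y + x 2 \<odot> v 2 0 y)"
    by (rule L2inner_cong) (use x in auto)
  also have "\<dots> = x 2"
    by (simp add: L2inner_add_right L2inner_cmul_right L2per_cmul bases_0)
  finally have x2: "x 2 = of_real (d2 (mean H) k b)" ..
  obtain a where a: "v 1 0 \<doteq> (\<lambda>y. a \<odot> Uy y)" using bases_0(10) by blast
  have "v 2 0 \<doteq> (\<lambda>y. of_real (1 / d2 (mean H) k b) \<odot> Ub y + (- x 1 * a / x 2) \<odot> Uy y)"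
    using x a
  proof eventually_elim
    case (elim y)
    have "of_real (1 / d2 (mean H) k b) \<odot> Ub y = (1 / x 2) \<odot> (x 1 \<odot> a \<odot> Uy y + x 2 \<odot> v 2 0 y)"
      using elim by (simp add: x2)
    also have "\<dots> = (x 1 * a / x 2) \<odot> Uy y + v 2 0 y"
      using M_b by (simp add: x2 cmul_add_right cmul_cmul)
    finally have e: "of_real (1 / d2 (mean H) k b) \<odot> Ub y = (x 1 * a / x 2) \<odot> Uy y + v 2 0 y" .
    show ?case unfolding e by (simp add: prod_eq_iff)
  qed
  then show ?thesis by blast
qed

text \<open>By duality \<open>v\<^sub>1 = \<Sum>\<^sub>j cnj (\<beta>t j 1) w\<^sub>j = \<Sum>\<^sub>j cnj (\<beta>t j 1 / l) (l w\<^sub>j)\<close>, where \<open>\<beta>t j 1 / l\<close> is analytic. The ratio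
of the coefficients of \<open>U'\<close> and \<open>l \<partial>\<^sub>kU\<close> is the same for both \<open>l w\<^sub>j\<close> and is inherited by \<open>v\<^sub>1\<close>.\<close>

lemma v1_expansion:
  "\<exists>X A B. X \<noteq> 0 \<and> L2_exp2 (v 1) (\<lambda>y. (X / (\<i> * of_real k)) \<odot> Uy y) (\<lambda>y. X \<odot> Uk y + B \<odot> Ub y + A \<odot> Uy y)"
proof -
  have W: "\<exists>k0 k1 b0. L2_exp2 (\<lambda>l y. of_real l \<odot> w j l y) (\<lambda>y. (k0 / (\<i> * of_real k)) \<odot> Uy y)
      (\<lambda>y. k0 \<odot> Uk y + b0 \<odot> Ub y + (k1 / of_real k) \<odot> Uy y)" if "j \<in> {1,2}" for j
    using eigenfunction_expansion[OF that] by blast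
  obtain k01 k11 b01 where
    W1: "L2_exp2 (\<lambda>l y. of_real l \<odot> w 1 l y) (\<lambda>y. (k01 / (\<i> * of_real k)) \<odot> Uy y)
      (\<lambda>y. k01 \<odot> Uk y + b01 \<odot> Ub y + (k11 / of_real k) \<odot> Uy y)"
    using W[of 1] by blast
  obtain k02 k12 b02 where
    W2: "L2_exp2 (\<lambda>l y. of_real l \<odot> w 2 l y) (\<lambda>y. (k02 / (\<i> * of_real k)) \<odot> Uy y)
      (\<lambda>y. k02 \<odot> Uk y + b02 \<odot> Ub y + (k12 / of_real k) \<odot> Uy y)"
    using W[of 2] by blast
  have B: "\<exists>B0 B1. scal_exp2 (\<lambda>l. \<beta>t j 1 l / of_real l) B0 B1" if "j \<in> {1,2}" for j
    using coords that analytic_ext_0_scal_exp2 unfolding eigenfunction_coordinates_def by blast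
  obtain B10 B11 where B1: "scal_exp2 (\<lambda>l. \<beta>t 1 1 l / of_real l) B10 B11" using B[of 1] by blast
  obtain B20 B21 where B2: "scal_exp2 (\<lambda>l. \<beta>t 2 1 l / of_real l) B20 B21" using B[of 2] by blast
  note E = L2_exp2_add[OF L2_exp2_mult[OF scal_exp2_cnj[OF B1] W1] L2_exp2_mult[OF scal_exp2_cnj[OF B2] W2]]
  have wj: "\<forall>\<^sub>F l in at 0. \<forall>j\<in>{1,2}. w j l \<doteq> (\<lambda>y. \<beta> j 1 l \<odot> v 1 l y + \<beta> j 2 l \<odot> v 2 l y)"
    using coords unfolding eigenfunction_coordinates_def sum_12 by (auto elim: eventually_mono)
  define X where "X = cnj B10 * k01 + cnj B20 * k02"
  define B where "B = cnj B10 * b01 + cnj B20 * b02"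
  define A where "A = cnj B10 * (k11 / of_real k) + cnj B11 * (k01 / (\<i> * of_real k))
     + (cnj B20 * (k12 / of_real k) + cnj B21 * (k02 / (\<i> * of_real k)))"
  have nz: "\<forall>\<^sub>F l in at (0::real). l \<noteq> 0" by (rule eventually_neq_at_within)
  have v1_L2: "\<forall>\<^sub>F l in at 0. v 1 l \<in> L2per"
  proof -
    have "L2_analytic_near_0 (v 1)" using bases unfolding critical_bases_def by blast
    then have "\<forall>\<^sub>F l in nhds 0. v 1 l \<in> L2per" unfolding L2_analytic_near_0_def by (auto elim: eventually_mono)
    then show ?thesis by (simp add: eventually_at_filter eventually_mono)
  qed
  have exp: "L2_exp2 (v 1) (\<lambda>y. (X / (\<i> * of_real k)) \<odot> Uy y) (\<lambda>y. X \<odot> Uk y + B \<odot> Ub y + A \<odot> Uy y)"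
  proof (rule L2_exp2_cong[OF E])
    show "\<forall>\<^sub>F l in at 0. (\<lambda>y. cnj (\<beta>t 1 1 l / of_real l) \<odot> of_real l \<odot> w 1 l y + cnj (\<beta>t 2 1 l / of_real l) \<odot> of_real l \<odot> w 2 l y)
         \<doteq> v 1 l \<and> v 1 l \<in> L2per"
      using wj duality nz v1_L2
    proof eventually_elim
      case (elim l)
      let ?p = "cnj (\<beta>t 1 1 l)" and ?r = "cnj (\<beta>t 2 1 l)"
      have w1: "w 1 l \<doteq> (\<lambda>y. \<beta> 1 1 l \<odot> v 1 l y + \<beta> 1 2 l \<odot> v 2 l y)"
        and w2: "w 2 l \<doteq> (\<lambda>y. \<beta> 2 1 l \<odot> v 1 l y + \<beta> 2 2 l \<odot> v 2 l y)" using elim(1) by auto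
      have d: "?p * \<beta> 1 1 l + ?r * \<beta> 2 1 l = 1" "?p * \<beta> 1 2 l + ?r * \<beta> 2 2 l = 0"
        using dual_matrix_transpose[of ?p "\<beta> 1 1 l" "cnj (\<beta>t 1 2 l)" "\<beta> 1 2 l" "\<beta> 2 1 l" "\<beta> 2 2 l" ?r "cnj (\<beta>t 2 2 l)"]
          elim(2) by auto
      have "(\<lambda>y. cnj (\<beta>t 1 1 l / of_real l) \<odot> of_real l \<odot> w 1 l y + cnj (\<beta>t 2 1 l / of_real l) \<odot> of_real l \<odot> w 2 l y) \<doteq> v 1 l"
        using w1 w2
      proof eventually_elim
        case (elim y)
        have "cnj (\<beta>t 1 1 l / of_real l) \<odot> of_real l \<odot> w 1 l y + cnj (\<beta>t 2 1 l / of_real l) \<odot> of_real l \<odot> w 2 l y = ?p \<odot> w 1 l y + ?r \<odot> w 2 l y"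
          using \<open>l \<noteq> 0\<close> by (simp add: cmul_cmul)
        also have "\<dots> = (?p * \<beta> 1 1 l + ?r * \<beta> 2 1 l) \<odot> v 1 l y + (?p * \<beta> 1 2 l + ?r * \<beta> 2 2 l) \<odot> v 2 l y"
          unfolding elim by (simp add: cmul_add_right cmul_add_left cmul_cmul)
        finally show ?case unfolding d by simp
      qed
      then show ?case using elim(4) by blast
    qed
    show "(\<lambda>y. cnj B10 \<odot> (k01 / (\<i> * of_real k)) \<odot> Uy y + cnj B20 \<odot> (k02 / (\<i> * of_real k)) \<odot> Uy y) \<doteq>
        (\<lambda>y. (X / (\<i> * of_real k)) \<odot> Uy y)"
      by (simp add: X_def cmul_cmul add_divide_distrib cmul_add_left)
    show "(\<lambda>y. cnj B10 \<odot> (k01 \<odot> Uk y + b01 \<odot> Ub y + (k11 / of_real k) \<odot> Uy y) + cnj B11 \<odot> (k01 / (\<i> * of_real k)) \<odot> Uy y +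
             (cnj B20 \<odot> (k02 \<odot> Uk y + b02 \<odot> Ub y + (k12 / of_real k) \<odot> Uy y) + cnj B21 \<odot> (k02 / (\<i> * of_real k)) \<odot> Uy y)) \<doteq>
        (\<lambda>y. X \<odot> Uk y + B \<odot> Ub y + A \<odot> Uy y)"
      by (intro AE_I2) (simp add: X_def A_def B_def cmul_add_left cmul_add_right cmul_cmul)
  qed (intro L2per_add L2per_cmul tangent_L2per)+
  have "X \<noteq> 0"
  proof
    assume X: "X = 0"
    obtain a1 where "L2_exp2 (v 1) (v 1 0) a1" using bases_expansion(1) by blast
    from L2_exp2_unique[OF this exp] have "v 1 0 \<doteq> (\<lambda>y. 0)" by (simp add: X)
    then have "L2inner (vt 1 0) (v 1 0) = L2inner (vt 1 0) (\<lambda>y. 0)" by (intro L2inner_cong) auto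
    then show False using bases_0(5) by (simp add: L2inner_def)
  qed
  with exp show ?thesis by blast
qed

text \<open>The constants are chosen so that the first row of the base change cancels the components of the
  \<open>O(l)\<close>-term of \<open>v\<^sub>1\<close> along \<open>\<partial>\<^sub>bU\<close> and \<open>U'\<close>. The scaling \<open>1 + p\<^sub>1 l\<close> of the first vector is
  completed to a polynomial matrix of determinant one, so that its inverse is polynomial too.\<close>

lemma adapted_bases:
  "\<exists>v' vt' \<beta>' \<beta>t'. critical_bases T lam Uy v' vt' \<and> eigenfunction_coordinates v' vt' w wt \<beta>' \<beta>t' \<and>
     bigo_L2 (\<lambda>l y. v' 1 l y - modulated_translation c H k b l y) (\<lambda>l. l\<^sup>2) \<and>
     bigo_L2 (\<lambda>l y. v' 2 l y - of_real (1 / d2 (mean H) k b) \<odot> Ub y) (\<lambda>l. l)"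
proof -
  obtain X A B where X: "X \<noteq> 0" and E1: "L2_exp2 (v 1) (\<lambda>y. (X / (\<i> * of_real k)) \<odot> Uy y) (\<lambda>y. X \<odot> Uk y + B \<odot> Ub y + A \<odot> Uy y)"
    using v1_expansion by blast
  obtain a2 where E2: "L2_exp2 (v 2) (v 2 0) a2" using bases_expansion(2) by blast
  have a2: "a2 \<in> L2per" using E2 by (simp add: L2_exp2_def)
  define m where "m = complex_of_real (d2 (mean H) k b)"
  have m0: "m \<noteq> 0" using M_b by (simp add: m_def)
  obtain C where C: "v 2 0 \<doteq> (\<lambda>y. (1 / m) \<odot> Ub y + C \<odot> Uy y)"
    using v2_0 by (auto simp: m_def)
  define p0 where "p0 = \<i> / X"
  define s where "s = - p0 * B * m"
  define p1 where "p1 = - of_real k * (p0 * A + s * C)"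
  define R where "R = of_real k * C"
  have p00: "p0 \<noteq> 0" using X by (simp add: p0_def)
  \<comment> \<open>with \<open>x = p\<^sub>1 l\<close>, the product of the matrices with rows \<open>(1, 0), (-R, 1)\<close>, with rows
    \<open>(1 + x, x\<^sup>2), (x, 1 - x + x\<^sup>2)\<close> and with rows \<open>(p\<^sub>0, s l), (0, 1)\<close>\<close>
  let ?p11 = "[:p0, p1 * p0:]" and ?s = "[:s, p1 * s + p1\<^sup>2:]"
  let ?p21 = "[:- R * p0, p1 * p0 - R * (p1 * p0):]"
    and ?p22 = "[:1, - p1 - R * s, p1 * s + p1\<^sup>2 - R * (p1 * s + p1\<^sup>2):]"
  define v' where "v' j l y = (if j = (1::nat) then poly ?p11 (of_real l) \<odot> v 1 l y + (of_real l * poly ?s (of_real l)) \<odot> v 2 l y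
      else poly ?p21 (of_real l) \<odot> v 1 l y + poly ?p22 (of_real l) \<odot> v 2 l y)" for j l y
  have "\<exists>vt' \<beta>' \<beta>t'. critical_bases T lam Uy v' vt' \<and> eigenfunction_coordinates v' vt' w wt \<beta>' \<beta>t'"
    unfolding v'_def[abs_def]
  proof (rule basis_change[OF _ p00 _ bases coords])
    show "poly ?p11 z * poly ?p22 z - z * poly ?s z * poly ?p21 z = p0" for z
      by (simp add: algebra_simps power2_eq_square)
  qed simp
  then obtain vt' \<beta>' \<beta>t' where good: "critical_bases T lam Uy v' vt'" "eigenfunction_coordinates v' vt' w wt \<beta>' \<beta>t'" by blast
  have v'_L2: "\<forall>\<^sub>F l in at 0. v' 1 l \<in> L2per \<and> v' 2 l \<in> L2per"
  proof -
    have "L2_analytic_near_0 (v' 1)" "L2_analytic_near_0 (v' 2)" using good(1) unfolding critical_bases_def by blast+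
    then have "\<forall>\<^sub>F l in nhds 0. v' 1 l \<in> L2per" "\<forall>\<^sub>F l in nhds 0. v' 2 l \<in> L2per"
      unfolding L2_analytic_near_0_def by (auto elim: eventually_mono)
    then have "\<forall>\<^sub>F l in nhds 0. v' 1 l \<in> L2per \<and> v' 2 l \<in> L2per" by eventually_elim auto
    then show ?thesis by (simp add: eventually_at_filter eventually_mono)
  qed
  have kk0: "complex_of_real k \<noteq> 0" using k_ne_0 by simp
  have sc: "scal_exp2 (\<lambda>l. poly ?p11 (of_real l)) p0 (p1 * p0)" "scal_exp2 (\<lambda>l. of_real l * poly ?s (of_real l)) 0 s"
    "scal_exp2 (\<lambda>l. poly ?p21 (of_real l)) (- R * p0) (p1 * p0 - R * (p1 * p0))"
    "scal_exp2 (\<lambda>l. poly ?p22 (of_real l)) 1 (- p1 - R * s)"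
    using scal_exp2_poly[of ?p11] scal_exp2_var_mult[OF scal_exp2_poly[of ?s]] scal_exp2_poly[of ?p21] scal_exp2_poly[of ?p22]
    by (simp_all add: One_nat_def)
  have "L2_exp2 (v' 1) (\<lambda>y. of_real (1 / k) \<odot> Uy y) (\<lambda>y. \<i> \<odot> Uk y)"
  proof (rule L2_exp2_cong[OF L2_exp2_add[OF L2_exp2_mult[OF sc(1) E1] L2_exp2_mult[OF sc(2) E2]]])
    show "\<forall>\<^sub>F l in at 0. (\<lambda>y. poly ?p11 (of_real l) \<odot> v 1 l y + (of_real l * poly ?s (of_real l)) \<odot> v 2 l y) \<doteq> v' 1 l \<and> v' 1 l \<in> L2per"
      using v'_L2 by eventually_elim (simp add: v'_def)
    show "(\<lambda>y. p0 \<odot> (X / (\<i> * of_real k)) \<odot> Uy y + 0 \<odot> v 2 0 y) \<doteq> (\<lambda>y. of_real (1 / k) \<odot> Uy y)"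
      using X by (intro AE_I2) (simp add: cmul_cmul p0_def)
    have c1: "p0 * X = \<i>" using X by (simp add: p0_def)
    have c2: "p0 * B + s * (1 / m) = 0" using m0 by (simp add: s_def)
    have c3: "p0 * A + p1 * p0 * (X / (\<i> * of_real k)) + s * C = 0"
      using X kk0 by (simp add: p1_def p0_def)
    show "(\<lambda>y. p0 \<odot> (X \<odot> Uk y + B \<odot> Ub y + A \<odot> Uy y) + (p1 * p0) \<odot> (X / (\<i> * of_real k)) \<odot> Uy y + (0 \<odot> a2 y + s \<odot> v 2 0 y)) \<doteq> (\<lambda>y. \<i> \<odot> Uk y)"
      using C
    proof eventually_elim
      case (elim y)
      have "p0 \<odot> (X \<odot> Uk y + B \<odot> Ub y + A \<odot> Uy y) + (p1 * p0) \<odot> (X / (\<i> * of_real k)) \<odot> Uy y + (0 \<odot> a2 y + s \<odot> v 2 0 y)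
        = (p0 * X) \<odot> Uk y + (p0 * B + s * (1 / m)) \<odot> Ub y + (p0 * A + p1 * p0 * (X / (\<i> * of_real k)) + s * C) \<odot> Uy y"
        unfolding elim by (simp only: cmul_add_right cmul_add_left cmul_cmul cmul_zero_left) (simp add: add_ac)
      then show ?case unfolding c1 c2 c3 by simp
    qed
  qed (intro L2per_cmul tangent_L2per)+
  then have "L2_order 2 (\<lambda>l y. v' 1 l y - modulated_translation c H k b l y)"
    by (simp add: L2_exp2_def modulated_translation_def cmul_cmul mult.commute)
  from L2_order_bigo[OF this]
  have one: "bigo_L2 (\<lambda>l y. v' 1 l y - modulated_translation c H k b l y) (\<lambda>l. l\<^sup>2)" .
  let ?b1 = "\<lambda>y. (- R * p0) \<odot> (X \<odot> Uk y + B \<odot> Ub y + A \<odot> Uy y) + (p1 * p0 - R * (p1 * p0)) \<odot> (X / (\<i> * of_real k)) \<odot> Uy y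
      + (1 \<odot> a2 y + (- p1 - R * s) \<odot> v 2 0 y)"
  have "L2_exp2 (v' 2) (\<lambda>y. (1 / m) \<odot> Ub y) ?b1"
  proof (rule L2_exp2_cong[OF L2_exp2_add[OF L2_exp2_mult[OF sc(3) E1] L2_exp2_mult[OF sc(4) E2]]])
    show "\<forall>\<^sub>F l in at 0. (\<lambda>y. poly ?p21 (of_real l) \<odot> v 1 l y + poly ?p22 (of_real l) \<odot> v 2 l y) \<doteq> v' 2 l \<and> v' 2 l \<in> L2per"
      using v'_L2 by eventually_elim (simp add: v'_def)
    have c: "- R * p0 * (X / (\<i> * of_real k)) + C = 0" using X kk0 by (simp add: R_def p0_def)
    show "(\<lambda>y. (- R * p0) \<odot> (X / (\<i> * of_real k)) \<odot> Uy y + 1 \<odot> v 2 0 y) \<doteq> (\<lambda>y. (1 / m) \<odot> Ub y)"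
      using C
    proof eventually_elim
      case (elim y)
      have "(- R * p0) \<odot> (X / (\<i> * of_real k)) \<odot> Uy y + 1 \<odot> v 2 0 y
        = (- R * p0 * (X / (\<i> * of_real k)) + C) \<odot> Uy y + (1 / m) \<odot> Ub y"
        unfolding elim by (simp only: cmul_add_left cmul_cmul cmul_one) (simp add: add_ac)
      then show ?case unfolding c by simp
    qed
    show "?b1 \<in> L2per" by (intro L2per_add L2per_cmul tangent_L2per a2 bases_0)
  qed (auto intro: L2per_cmul tangent_L2per)
  from L2_order_bigo[OF L2_exp2_order_1[OF this]]
  have "bigo_L2 (\<lambda>l y. v' 2 l y - of_real (1 / d2 (mean H) k b) \<odot> Ub y) (\<lambda>l. l)" by (simp add: m_def)
  with one good show ?thesis by blast
qed

end

theorem lemma3: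
  fixes \<delta> F :: real
    and \<Omega> :: "(real \<times> real) set"
    and c :: "real \<Rightarrow> real \<Rightarrow> real"
    and H :: "real \<Rightarrow> real \<Rightarrow> real \<Rightarrow> real"
    and ks bs :: real
    and T :: "real \<Rightarrow> graph_op"
    and lam :: "nat \<Rightarrow> real \<Rightarrow> complex"
    and v vt w wt :: "nat \<Rightarrow> real \<Rightarrow> vfun"
    and \<beta> \<beta>t :: "nat \<Rightarrow> nat \<Rightarrow> real \<Rightarrow> complex"
  assumes "\<delta> > 0" and "F > 0"
    and "wave_family \<delta> F \<Omega> c H"
    and "nondegenerate_family \<delta> F \<Omega> c H"
    and "(ks, bs) \<in> \<Omega>"
    and "T = bloch \<delta> F c H ks bs"
    and "zero_eigenspace (T 0) (dyU c H ks bs)"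
    and "critical_eigenvalues T lam"
    and "critical_bases T lam (dyU c H ks bs) v vt"
    and "dual_eigenfunctions T lam w wt"
    and "eigenfunction_coordinates v vt w wt \<beta> \<beta>t"
  shows "(\<forall>j\<in>{1,2}. \<exists>k0 k1 b0 lam0 :: complex.
            bigo_L2 (\<lambda>l y. w j l y -
               ((1 / (\<i> * of_real l) * (k0 + \<i> * of_real l * k1)) \<odot> modulated_translation c H ks bs l y
                + b0 \<odot> dbU c H ks bs y)) (\<lambda>l. l) \<and>
            (\<lambda>l. lam j l - of_real ks * \<i> * of_real l * lam0) \<in> O[at 0](\<lambda>l. of_real (l\<^sup>2)) \<and>
            whitham_leading_term c H ks bs lam0 k0 b0 \<and>
            whitham_order_zero c H ks bs lam0 k0 b0) \<and>
         (\<exists>v' vt' \<beta>' \<beta>t'.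
            critical_bases T lam (dyU c H ks bs) v' vt' \<and>
            eigenfunction_coordinates v' vt' w wt \<beta>' \<beta>t' \<and>
            bigo_L2 (\<lambda>l y. v' 1 l y - modulated_translation c H ks bs l y) (\<lambda>l. l\<^sup>2) \<and>
            bigo_L2 (\<lambda>l y. v' 2 l y - of_real (1 / d2 (mean H) ks bs) \<odot> dbU c H ks bs y) (\<lambda>l. l))"
proof -
  interpret bloch_spectrum \<delta> F \<Omega> c H ks bs lam v vt w wt \<beta> \<beta>t
    using assms by unfold_locales (auto simp: nondegenerate_family_def)
  show ?thesis
  proof (intro conjI ballI)
    fix j :: nat assume "j \<in> {1,2}"
    from eigenfunction_expansion[OF this] obtain k0 k1 b0 lam0 where
      lam0: "scal_exp2 (lam j) 0 (of_real ks * \<i> * lam0)" and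
      W: "L2_exp2 (\<lambda>l y. of_real l \<odot> w j l y) (\<lambda>y. (k0 / (\<i> * of_real ks)) \<odot> dyU c H ks bs y)
        (\<lambda>y. k0 \<odot> dkU c H ks bs y + b0 \<odot> dbU c H ks bs y + (k1 / of_real ks) \<odot> dyU c H ks bs y)" and
      wh: "whitham_order_zero c H ks bs lam0 k0 b0" "(k0, b0) \<noteq> (0, 0)" by blast
    have "(\<lambda>l. lam j l - (0 + of_real l * (of_real ks * \<i> * lam0))) \<in> O[at 0](\<lambda>l. of_real (l\<^sup>2))"
      using scal_order_bigo[OF lam0[unfolded scal_exp2_def]] .
    then have "(\<lambda>l. lam j l - of_real ks * \<i> * of_real l * lam0) \<in> O[at 0](\<lambda>l. of_real (l\<^sup>2))"
      by (simp add: mult_ac)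
    with eigenfunction_remainder[OF W] whitham_order_zero_imp_leading_term[OF wh] wh(1)
    show "\<exists>k0 k1 b0 lam0 :: complex.
            bigo_L2 (\<lambda>l y. w j l y -
               ((1 / (\<i> * of_real l) * (k0 + \<i> * of_real l * k1)) \<odot> modulated_translation c H ks bs l y
                + b0 \<odot> dbU c H ks bs y)) (\<lambda>l. l) \<and>
            (\<lambda>l. lam j l - of_real ks * \<i> * of_real l * lam0) \<in> O[at 0](\<lambda>l. of_real (l\<^sup>2)) \<and>
            whitham_leading_term c H ks bs lam0 k0 b0 \<and>
            whitham_order_zero c H ks bs lam0 k0 b0" by blast
  next
    show "\<exists>v' vt' \<beta>' \<beta>t'.
            critical_bases T lam (dyU c H ks bs) v' vt' \<and>
            eigenfunction_coordinates v' vt' w wt \<beta>' \<beta>t' \<and>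
            bigo_L2 (\<lambda>l y. v' 1 l y - modulated_translation c H ks bs l y) (\<lambda>l. l\<^sup>2) \<and>
            bigo_L2 (\<lambda>l y. v' 2 l y - of_real (1 / d2 (mean H) ks bs) \<odot> dbU c H ks bs y) (\<lambda>l. l)"
      unfolding \<open>T = bloch \<delta> F c H ks bs\<close> by (rule adapted_bases)
  qed
qed

end
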